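(* Let $p$ be an odd prime, $F$ a field containing a primitive $p$th root of unity, $a\in\dot F\setminus\dot F^p$ and $E=F(\sqrt[p]{a})$. If $F$ is $p$-rigid, then $E$ is $p$-rigid.
   Context: For a field $L$, $\dot L=L\setminus\{0\}$ and $\dot L^p$ is the group of nonzero $p$th powers. An element $b\in\dot L\setminus\dot L^p$ is $p$-rigid if every element of $N_{L(\sqrt[p]{b})/L}(L(\sqrt[p]{b})^\times)$ lies in $\bigcup_{k=0}^{p-1}b^k\dot L^p$; $L$ is $p$-rigid if every element of $\dot L\setminus\dot L^p$ is $p$-rigid. *)

theory Defs
  imports "HOL-Computational_Algebra.Primes" "Jordan_Normal_Form.Determinant"
begin

text \<open>Fields are modelled as subfields L of an ambient field of type 'a.\<close>

definition is_subfield :: "'a::field set \<Rightarrow> bool" where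
  "is_subfield L \<longleftrightarrow> 0 \<in> L \<and> 1 \<in> L \<and>
     (\<forall>x\<in>L. \<forall>y\<in>L. x + y \<in> L \<and> x - y \<in> L \<and> x * y \<in> L) \<and>
     (\<forall>x\<in>L. inverse x \<in> L)"

definition gen_field :: "'a::field set \<Rightarrow> 'a set" where
  "gen_field S = \<Inter> {L. is_subfield L \<and> S \<subseteq> L}"

definition pth_powers :: "'a::field set \<Rightarrow> nat \<Rightarrow> 'a set" where
  "pth_powers L p = {y ^ p | y. y \<in> L \<and> y \<noteq> 0}"

text \<open>Matrix of multiplication by c_0 + c_1 beta + ... + c_(p-1) beta^(p-1) on
  L(beta), beta^p = b, w.r.t. the basis 1, beta, ..., beta^(p-1)
  (column j = image of beta^j).\<close>
definition mult_matrix :: "nat \<Rightarrow> 'a::field \<Rightarrow> (nat \<Rightarrow> 'a) \<Rightarrow> 'a mat" where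
  "mult_matrix p b c = mat p p (\<lambda>(k, j). if j \<le> k then c (k - j) else b * c (k + p - j))"

text \<open>The norm group N_{L(b^(1/p))/L}(L(b^(1/p))^x), for b not a p-th power in L
  (so that x^p - b is irreducible and 1,...,beta^(p-1) is an L-basis);
  the norm is the determinant of the multiplication map.\<close>
definition norm_group :: "'a::field set \<Rightarrow> nat \<Rightarrow> 'a \<Rightarrow> 'a set" where
  "norm_group L p b = {det (mult_matrix p b c) | c.
      (\<forall>i<p. c i \<in> L) \<and> (\<exists>i<p. c i \<noteq> 0)}"

definition p_rigid_elem :: "'a::field set \<Rightarrow> nat \<Rightarrow> 'a \<Rightarrow> bool" where
  "p_rigid_elem L p b \<longleftrightarrow> b \<in> L - {0} - pth_powers L p \<and>
     norm_group L p b \<subseteq> (\<Union>k<p. (\<lambda>y. b ^ k * y) ` pth_powers L p)"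

definition p_rigid :: "'a::field set \<Rightarrow> nat \<Rightarrow> bool" where
  "p_rigid L p \<longleftrightarrow> (\<forall>b \<in> L - {0} - pth_powers L p. p_rigid_elem L p b)"

end

theory Submission
  imports "HOL-Algebra.Algebraic_Closure_Type" "HOL-Number_Theory.Residues" Defs
begin

text \<open>
Write \<open>T\<close> for the group of nonzero \<open>p\<close>-th powers of \<open>F\<close>. Rigidity gives \<open>1 - x \<in> x^i T\<close> for every
\<open>x \<notin> T\<close>, and a multiplicativity argument for \<open>(i - 1)/i\<close> shows that outside a subgroup
\<open>H = <u> T\<close> only \<open>i = 0\<close> and \<open>i = 1\<close> occur. Ware's construction then produces a
valuation ring of \<open>F\<close> whose principal units lie in \<open>T\<close> and whose units lie in \<open>H\<close>. Conversely a field
with such a valuation ring is rigid: adjoining a \<open>p\<close>-th root is either totally ramified or unramified,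
and in both cases norms can be read off from a leading term. It remains to extend the valuation ring
to \<open>E\<close>, where Hilbert 90 and the rigidity of \<open>a\<close> show that \<open>E*\<close> is generated by \<open>\<alpha>\<close>, \<open>F*\<close> and \<open>p\<close>-th powers.
\<close>

section \<open>Subfields and classes modulo \<open>p\<close>-th powers\<close>

text \<open>Rigidity of \<open>E\<close> concerns norms from extensions of \<open>E\<close>, about
  which rigidity of \<open>F\<close> says nothing directly. The valuation ring helps because the two
  properties kept in \<open>rigid_val\<close> can be tested on leading terms and therefore survive
  the passage to \<open>E\<close>. The generator \<open>u\<close> stays the same in the ramified
  case. In the unramified case the old units become \<open>p\<close>-th powers and the adjoined root
  takes the place of \<open>u\<close>. The function \<open>(i - 1)/i\<close> comes from
  \<open>1 - x * y = (1 - x) * (1 + B)\<close> with \<open>B = x * (1 - y) / (1 - x)\<close>: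
  comparing classes gives \<open>(l - 1)/l = ((i - 1)/i) * ((j - 1)/j)\<close> modulo
  \<open>p\<close> for the exponent \<open>l\<close> of \<open>x * y\<close>. Two obstacles shape
  the proof. If the residue characteristic is \<open>p\<close>, traces cannot be normalised by
  dividing by \<open>p\<close>; but then all units are \<open>p\<close>-th powers, so the unramified
  case does not arise. And the ambient type contains a root of \<open>a\<close> but not necessarily
  roots of other elements, so norms are determinants that are evaluated in the algebraic closure and
  pulled back.\<close>

locale subfield_set =
  fixes K :: "'a::field set"
  assumes subfield: "is_subfield K"
begin

lemma zero_mem [simp, intro]: "0 \<in> K" and one_mem [simp, intro]: "1 \<in> K"
  using subfield by (auto simp: is_subfield_def)

lemma add_mem [intro]: "x \<in> K \<Longrightarrow> y \<in> K \<Longrightarrow> x + y \<in> K"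
  and diff_mem [intro]: "x \<in> K \<Longrightarrow> y \<in> K \<Longrightarrow> x - y \<in> K"
  and mult_mem [intro]: "x \<in> K \<Longrightarrow> y \<in> K \<Longrightarrow> x * y \<in> K"
  and inverse_mem [intro]: "x \<in> K \<Longrightarrow> inverse x \<in> K"
  using subfield by (auto simp: is_subfield_def)

lemma uminus_mem [intro]: "x \<in> K \<Longrightarrow> - x \<in> K"
  using diff_mem[of 0 x] by simp

lemma divide_mem [intro]: "x \<in> K \<Longrightarrow> y \<in> K \<Longrightarrow> x / y \<in> K"
  by (simp add: field_class.field_divide_inverse inverse_mem mult_mem)

lemma power_mem [intro]: "x \<in> K \<Longrightarrow> x ^ n \<in> K"
  by (induction n) auto

lemma of_nat_mem [simp, intro]: "of_nat n \<in> K"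
  by (induction n) auto

lemma sum_mem: "(\<And>i. i \<in> A \<Longrightarrow> f i \<in> K) \<Longrightarrow> sum f A \<in> K"
  by (induction A rule: infinite_finite_induct) auto

end

locale root_field = subfield_set K for K :: "'a::field set" +
  fixes p :: nat and \<zeta> :: 'a
  assumes prime_p: "prime p" and odd_p: "odd p"
    and root_mem: "\<zeta> \<in> K" and root_power: "\<zeta> ^ p = 1"
    and root_primitive: "\<forall>k. 0 < k \<and> k < p \<longrightarrow> \<zeta> ^ k \<noteq> 1"
begin

abbreviation T :: "'a set" where "T \<equiv> pth_powers K p"

definition pspan :: "'a \<Rightarrow> 'a set" where
  "pspan u = {u ^ k * t | k t. t \<in> T}"

lemma p_gt_2: "p > 2"
  using prime_p odd_p prime_ge_2_nat[of p] by (cases "p = 2") auto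

lemma p_pos [simp]: "0 < p"
  using p_gt_2 by simp

lemma root_nz: "\<zeta> \<noteq> 0"
  using root_power p_gt_2 by (auto simp: power_0_left)

lemma power_in_T: "y \<in> K \<Longrightarrow> y \<noteq> 0 \<Longrightarrow> y ^ p \<in> T"
  by (auto simp: pth_powers_def)

lemma T_memD: "t \<in> T \<Longrightarrow> t \<in> K" and T_nz: "t \<in> T \<Longrightarrow> t \<noteq> 0"
  by (auto simp: pth_powers_def)

lemma T_one [simp]: "1 \<in> T"
  using power_in_T[of 1] by simp

lemma T_mult: "s \<in> T \<Longrightarrow> t \<in> T \<Longrightarrow> s * t \<in> T"
  unfolding pth_powers_def by (auto simp: power_mult_distrib[symmetric])

lemma T_inverse: "t \<in> T \<Longrightarrow> inverse t \<in> T"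
proof -
  assume "t \<in> T"
  then obtain y where "t = y ^ p" "y \<in> K" "y \<noteq> 0" by (auto simp: pth_powers_def)
  then show ?thesis using power_in_T[of "inverse y"] by (simp add: inverse_mem power_inverse)
qed

lemma T_divide: "s \<in> T \<Longrightarrow> t \<in> T \<Longrightarrow> s / t \<in> T"
  by (simp add: field_class.field_divide_inverse T_inverse T_mult)

lemma T_uminus: "t \<in> T \<Longrightarrow> - t \<in> T"
proof -
  assume "t \<in> T"
  moreover have "- 1 \<in> T"
    using power_in_T[of "-1"] odd_p by (auto simp: uminus_mem)
  ultimately show ?thesis using T_mult[of "-1" t] by simp
qed

lemma T_uminus_iff [simp]: "- t \<in> T \<longleftrightarrow> t \<in> T"
  using T_uminus[of t] T_uminus[of "-t"] by auto

lemma T_power: "t \<in> T \<Longrightarrow> t ^ n \<in> T"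
  by (induction n) (auto intro: T_mult)

lemma T_mult_right_iff: "t \<in> T \<Longrightarrow> x * t \<in> T \<longleftrightarrow> x \<in> T"
  using T_mult[of x t] T_divide[of "x * t" t] T_nz[of t] by auto

lemma T_mult_left_iff: "t \<in> T \<Longrightarrow> t * x \<in> T \<longleftrightarrow> x \<in> T"
  using T_mult_right_iff[of t x] by (simp add: mult.commute)

text \<open>Every class modulo \<open>T\<close> is killed by \<open>p\<close>: with
  \<open>n * s = p * t + 1\<close>, \<open>x\<close> is the element \<open>x ^ (n * s)\<close> of
  \<open>G\<close> divided by the element \<open>(x ^ t) ^ p\<close> of \<open>T\<close>.\<close>

lemma group_root:
  assumes "T \<subseteq> G" "\<And>x y. x \<in> G \<Longrightarrow> y \<in> G \<Longrightarrow> x * y \<in> G"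
    and "x \<in> K" "x \<noteq> 0" "x ^ n \<in> G" "\<not> p dvd n"
  shows "x \<in> G"
proof -
  have "n \<noteq> 0" using assms(6) by (cases n) auto
  moreover have "gcd n p = 1"
    using prime_p assms(6) prime_imp_coprime[of p n] by (simp add: coprime_iff_gcd_eq_1 gcd.commute)
  ultimately obtain s t where st: "n * s = p * t + 1"
    using bezout_nat[of n p] by auto
  have pw: "y ^ k \<in> G" if "y \<in> G" for y k
    using that assms(1,2) by (induction k) auto
  have "x ^ (n * s) \<in> G" using pw[OF assms(5), of s] by (simp add: power_mult)
  moreover have "inverse ((x ^ t) ^ p) \<in> G"
    using assms(1,3,4) T_inverse[OF power_in_T[of "x ^ t"]] by auto
  ultimately have "x ^ (n * s) * inverse ((x ^ t) ^ p) \<in> G" by (rule assms(2))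
  moreover have "x ^ (n * s) * inverse ((x ^ t) ^ p) = x"
    unfolding st using assms(4) by (simp add: power_mult[symmetric] mult.commute power_add)
  ultimately show ?thesis by simp
qed

lemma T_root: "x \<in> K \<Longrightarrow> x \<noteq> 0 \<Longrightarrow> x ^ n \<in> T \<Longrightarrow> \<not> p dvd n \<Longrightarrow> x \<in> T"
  using group_root[of T] T_mult by blast

lemma pspanI: "t \<in> T \<Longrightarrow> u ^ k * t \<in> pspan u"
  by (auto simp: pspan_def)

lemma T_subset_pspan: "T \<subseteq> pspan u"
  using pspanI[of _ u 0] by auto

lemma gen_in_pspan: "u \<in> pspan u"
  using pspanI[of 1 u 1] by simp

lemma pspan_memD: "x \<in> pspan u \<Longrightarrow> u \<in> K \<Longrightarrow> x \<in> K"
  by (auto simp: pspan_def T_memD)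

lemma pspan_nz: "x \<in> pspan u \<Longrightarrow> u \<noteq> 0 \<Longrightarrow> x \<noteq> 0"
  by (auto simp: pspan_def T_nz)

lemma pspan_mult: "x \<in> pspan u \<Longrightarrow> y \<in> pspan u \<Longrightarrow> x * y \<in> pspan u"
proof -
  assume "x \<in> pspan u" "y \<in> pspan u"
  then obtain k s l t where "x = u ^ k * s" "y = u ^ l * t" "s \<in> T" "t \<in> T"
    by (auto simp: pspan_def)
  moreover have "u ^ k * s * (u ^ l * t) = u ^ (k + l) * (s * t)"
    by (simp add: power_add)
  ultimately show ?thesis using pspanI[OF T_mult] by metis
qed

lemma pspan_power: "x \<in> pspan u \<Longrightarrow> x ^ n \<in> pspan u"
  using T_subset_pspan[of u] by (induction n) (auto intro: pspan_mult)

lemma pspan_inverse: "x \<in> pspan u \<Longrightarrow> u \<in> K \<Longrightarrow> u \<noteq> 0 \<Longrightarrow> inverse x \<in> pspan u"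
proof -
  assume x: "x \<in> pspan u" "u \<in> K" "u \<noteq> 0"
  then have "x \<in> K" "x \<noteq> 0" using pspan_memD pspan_nz by auto
  then have "inverse (x ^ p) \<in> T" by (intro T_inverse power_in_T)
  then have "x ^ (p - 1) * inverse (x ^ p) \<in> pspan u"
    using pspan_mult pspan_power[OF x(1)] T_subset_pspan by blast
  moreover have "x ^ (p - 1) * inverse (x ^ p) = inverse x"
    using \<open>x \<noteq> 0\<close> power_minus_mult[OF p_pos, of x] by (simp add: field_simps)
  ultimately show ?thesis by simp
qed

lemma pspan_divide:
  "x \<in> pspan u \<Longrightarrow> y \<in> pspan u \<Longrightarrow> u \<in> K \<Longrightarrow> u \<noteq> 0 \<Longrightarrow> x / y \<in> pspan u"
  by (simp add: field_class.field_divide_inverse pspan_inverse pspan_mult)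

lemma pspan_root:
  "x \<in> K \<Longrightarrow> x \<noteq> 0 \<Longrightarrow> x ^ n \<in> pspan u \<Longrightarrow> \<not> p dvd n \<Longrightarrow> x \<in> pspan u"
  using group_root[of "pspan u"] pspan_mult T_subset_pspan by blast

lemma pspan_subset: "x \<in> pspan u \<Longrightarrow> pspan x \<subseteq> pspan u"
proof
  fix y assume x: "x \<in> pspan u" and "y \<in> pspan x"
  then obtain k t where "y = x ^ k * t" "t \<in> T" by (auto simp: pspan_def)
  then show "y \<in> pspan u"
    using pspan_mult[OF pspan_power[OF x]] T_subset_pspan by blast
qed

lemma pspan_eq:
  assumes "x \<in> pspan u" "x \<notin> T" "u \<in> K" "u \<noteq> 0"
  shows "pspan x = pspan u"
proof -
  obtain k t where x: "x = u ^ k * t" and t: "t \<in> T" using assms(1) by (auto simp: pspan_def)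
  have "\<not> p dvd k"
  proof
    assume "p dvd k"
    then obtain n where "k = n * p" by (auto simp: dvd_def mult.commute)
    then have "u ^ k \<in> T"
      using assms power_in_T[of "u ^ n"] by (auto simp: power_mult)
    then show False using assms(2) x t T_mult by auto
  qed
  moreover have "u ^ k \<in> pspan x"
  proof -
    have "x * inverse t \<in> pspan x"
      using T_inverse[OF t] pspan_mult gen_in_pspan T_subset_pspan by blast
    moreover have "x * inverse t = u ^ k" using x T_nz[OF t] by simp
    ultimately show ?thesis by simp
  qed
  ultimately have "u \<in> pspan x" using assms pspan_root by blast
  then show ?thesis using assms(1) pspan_subset by blast
qed

lemma pspan_eq_Union: "u \<in> K \<Longrightarrow> u \<noteq> 0 \<Longrightarrow> (\<Union>k<p. (\<lambda>y. u ^ k * y) ` T) = pspan u"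
proof safe
  fix x assume u: "u \<in> K" "u \<noteq> 0" and "x \<in> pspan u"
  then obtain k t where x: "x = u ^ k * t" "t \<in> T" by (auto simp: pspan_def)
  have "x = u ^ (k mod p) * ((u ^ (k div p)) ^ p * t)"
    unfolding x(1) by (simp add: mult.assoc[symmetric] power_mult[symmetric] power_add[symmetric])
  moreover have "(u ^ (k div p)) ^ p * t \<in> T"
    using u by (intro T_mult x(2) power_in_T power_mem) auto
  ultimately show "x \<in> (\<Union>k<p. (\<lambda>y. u ^ k * y) ` T)"
    using p_pos by (metis (no_types, lifting) UN_iff image_eqI lessThan_iff mod_less_divisor)
qed (auto intro: pspanI)

lemma p_rigid_elem_iff:
  "p_rigid_elem K p b \<longleftrightarrow> b \<in> K - {0} - T \<and> norm_group K p b \<subseteq> pspan b"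
  unfolding p_rigid_elem_def using pspan_eq_Union[of b] by auto

end

section \<open>Valuation rings\<close>

locale val_ring = subfield_set K for K :: "'a::field set" +
  fixes V :: "'a set"
  assumes V_subset: "V \<subseteq> K" and V_zero [simp]: "0 \<in> V" and V_one [simp]: "1 \<in> V"
    and V_add: "x \<in> V \<Longrightarrow> y \<in> V \<Longrightarrow> x + y \<in> V"
    and V_uminus: "x \<in> V \<Longrightarrow> - x \<in> V"
    and V_mult: "x \<in> V \<Longrightarrow> y \<in> V \<Longrightarrow> x * y \<in> V"
    and V_total: "x \<in> K \<Longrightarrow> x \<noteq> 0 \<Longrightarrow> x \<in> V \<or> inverse x \<in> V"
begin

text \<open>\<open>M\<close> is the maximal ideal of \<open>V\<close> and \<open>U\<close> its unit
  group.\<close>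

definition M :: "'a set" where "M = {x \<in> V. x = 0 \<or> inverse x \<notin> V}"
definition U :: "'a set" where "U = {x \<in> V. x \<noteq> 0 \<and> inverse x \<in> V}"

lemma V_diff: "x \<in> V \<Longrightarrow> y \<in> V \<Longrightarrow> x - y \<in> V"
  using V_add[of x "-y"] V_uminus by simp

lemma V_power: "x \<in> V \<Longrightarrow> x ^ n \<in> V"
  by (induction n) (auto intro: V_mult)

lemma V_of_nat: "of_nat n \<in> V"
  by (induction n) (auto intro: V_add)

lemma V_sum: "(\<And>i. i \<in> A \<Longrightarrow> f i \<in> V) \<Longrightarrow> sum f A \<in> V"
  by (induction A rule: infinite_finite_induct) (auto intro: V_add)

lemma M_subset_V: "M \<subseteq> V" and U_subset_V: "U \<subseteq> V"
  by (auto simp: M_def U_def)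

lemma V_cases: "x \<in> V \<Longrightarrow> x \<in> M \<or> x \<in> U" and not_M_and_U: "x \<in> M \<Longrightarrow> x \<notin> U"
  by (auto simp: M_def U_def)

lemma U_nz: "x \<in> U \<Longrightarrow> x \<noteq> 0" by (auto simp: U_def)

lemma U_memD: "x \<in> U \<Longrightarrow> x \<in> K" and M_memD: "x \<in> M \<Longrightarrow> x \<in> K"
  using V_subset by (auto simp: U_def M_def)

lemma U_one [simp]: "1 \<in> U" by (simp add: U_def)

lemma M_zero [simp]: "0 \<in> M" by (simp add: M_def)

lemma U_inverse: "x \<in> U \<Longrightarrow> inverse x \<in> U" by (auto simp: U_def)

lemma U_mult: "x \<in> U \<Longrightarrow> y \<in> U \<Longrightarrow> x * y \<in> U"
  by (auto simp: U_def V_mult)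

lemma U_divide: "x \<in> U \<Longrightarrow> y \<in> U \<Longrightarrow> x / y \<in> U"
  by (simp add: field_class.field_divide_inverse U_mult U_inverse)

lemma U_power: "x \<in> U \<Longrightarrow> x ^ n \<in> U"
  by (induction n) (auto intro: U_mult)

lemma V_mult_M: "x \<in> V \<Longrightarrow> y \<in> M \<Longrightarrow> x * y \<in> M"
proof -
  assume a: "x \<in> V" "y \<in> M"
  have False if "x * y \<noteq> 0" "inverse (x * y) \<in> V"
  proof -
    have "x * inverse (x * y) \<in> V" using that a by (intro V_mult)
    moreover have "x * inverse (x * y) = inverse y" using that by (simp add: field_simps)
    ultimately have "inverse y \<in> V" by metis
    then show False using a that by (auto simp: M_def)
  qed
  then show ?thesis using a V_mult M_subset_V by (auto simp: M_def)
qed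

lemma M_mult_V: "x \<in> M \<Longrightarrow> y \<in> V \<Longrightarrow> x * y \<in> M"
  using V_mult_M[of y x] by (simp add: mult.commute)

lemma inverse_in_M: "x \<in> K \<Longrightarrow> x \<notin> V \<Longrightarrow> inverse x \<in> M"
  using V_total[of x] by (cases "x = 0") (auto simp: M_def)

lemma V_ratio: "x \<in> K \<Longrightarrow> y \<in> K \<Longrightarrow> (\<exists>z\<in>V. x = z * y) \<or> (\<exists>z\<in>V. y = z * x)"
proof (cases "x = 0 \<or> y = 0")
  case True
  then show ?thesis using V_zero by (metis mult_zero_left)
next
  case False
  assume "x \<in> K" "y \<in> K"
  then have "x / y \<in> V \<or> inverse (x / y) \<in> V" using V_total[of "x / y"] False by auto
  then show ?thesis
  proof
    assume "x / y \<in> V" then show ?thesis using False by (intro disjI1 bexI[of _ "x / y"]) auto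
  next
    assume "inverse (x / y) \<in> V"
    then show ?thesis using False by (intro disjI2 bexI[of _ "y / x"]) auto
  qed
qed

lemma M_add: "x \<in> M \<Longrightarrow> y \<in> M \<Longrightarrow> x + y \<in> M"
proof -
  assume a: "x \<in> M" "y \<in> M"
  consider z where "z \<in> V" "x = z * y" | z where "z \<in> V" "y = z * x"
    using V_ratio[of x y] a M_memD by blast
  then show ?thesis
  proof cases
    case 1
    then have "x + y = (z + 1) * y" by (simp add: algebra_simps)
    then show ?thesis using 1 a by (auto intro!: V_mult_M V_add)
  next
    case 2
    then have "x + y = (z + 1) * x" by (simp add: algebra_simps)
    then show ?thesis using 2 a by (auto intro!: V_mult_M V_add)
  qed
qed

lemma M_uminus: "x \<in> M \<Longrightarrow> - x \<in> M"
  using V_mult_M[of "-1" x] V_uminus[of 1] by simp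

lemma M_diff: "x \<in> M \<Longrightarrow> y \<in> M \<Longrightarrow> x - y \<in> M"
  using M_add[of x "-y"] M_uminus by simp

lemma M_root: "x \<in> V \<Longrightarrow> x ^ n \<in> M \<Longrightarrow> x \<in> M"
  using V_cases[of x] U_power[of x n] not_M_and_U by auto

text \<open>The simplest case of integral closedness: otherwise \<open>inverse x\<close> lies in
  \<open>M\<close>, and multiplying \<open>x ^ n\<close> by its \<open>n\<close>-th power would put
  1 into \<open>M\<close>.\<close>

lemma V_root: "x \<in> K \<Longrightarrow> n > 0 \<Longrightarrow> x ^ n \<in> V \<Longrightarrow> x \<in> V"
proof (rule ccontr)
  assume a: "x \<in> K" "n > 0" "x ^ n \<in> V" "x \<notin> V"
  then have i: "inverse x \<in> M" by (auto intro: inverse_in_M)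
  have "x \<noteq> 0" using a by auto
  have "x ^ n * (inverse x) ^ n = 1" using \<open>x \<noteq> 0\<close> by (simp add: power_mult_distrib[symmetric])
  moreover have "(inverse x) ^ n \<in> M"
    using i a(2) by (cases n) (auto intro!: M_mult_V V_power simp: subsetD[OF M_subset_V])
  ultimately have "1 \<in> M" using V_mult_M a(3) by metis
  then show False using not_M_and_U U_one by blast
qed

lemma U_root: "x \<in> K \<Longrightarrow> n > 0 \<Longrightarrow> x ^ n \<in> U \<Longrightarrow> x \<in> U"
proof -
  assume a: "x \<in> K" "n > 0" "x ^ n \<in> U"
  then have "x \<in> V" using V_root U_subset_V by blast
  moreover have "x \<noteq> 0" using a by (auto simp: U_def power_0_left)
  moreover have "inverse x \<in> V"
    using V_root[of "inverse x" n] a by (auto simp: U_def power_inverse)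
  ultimately show ?thesis by (simp add: U_def)
qed

lemma one_plus_M: "x \<in> M \<Longrightarrow> 1 + x \<in> U"
proof -
  assume x: "x \<in> M"
  have "1 + x \<in> V" using x M_subset_V V_add by auto
  moreover have "1 + x \<notin> M"
    using M_diff[of "1 + x" x] x not_M_and_U[of 1] by auto
  ultimately show ?thesis using V_cases by blast
qed

end

text \<open>The valuation ring attached to a subgroup \<open>T\<close> of the multiplicative group all of whose
  non-rigid elements lie in \<open>H\<close>, following Ware.\<close>

locale ware = subfield_set K for K :: "'a::field set" +
  fixes T H :: "'a set"
  assumes H_subset: "H \<subseteq> K - {0}" and T_subset: "T \<subseteq> H"
    and T1: "1 \<in> T" and Tneg: "t \<in> T \<Longrightarrow> - t \<in> T"
    and Tmul: "s \<in> T \<Longrightarrow> t \<in> T \<Longrightarrow> s * t \<in> T" and Tinv: "t \<in> T \<Longrightarrow> inverse t \<in> T"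
    and Hmul: "x \<in> H \<Longrightarrow> y \<in> H \<Longrightarrow> x * y \<in> H" and Hinv: "x \<in> H \<Longrightarrow> inverse x \<in> H"
    and Hsqrt: "x \<in> K \<Longrightarrow> x ^ 2 \<in> H \<Longrightarrow> x \<in> H"
    and rigid: "x \<in> K \<Longrightarrow> x \<noteq> 0 \<Longrightarrow> x \<notin> H \<Longrightarrow> 1 + x \<in> T \<or> inverse x * (1 + x) \<in> T"
begin

text \<open>Outside \<open>H\<close>, \<open>1 + x\<close> has the class of 1 or of
  \<open>x\<close>, as if the summand of smaller value decided. \<open>O1\<close> collects the
  elements outside \<open>H\<close> that should accordingly have positive value, and
  \<open>O2\<close> the elements of \<open>H\<close> that multiply \<open>O1\<close> into
  itself.\<close>

definition O1 :: "'a set" where "O1 = {x \<in> K - {0} - H. 1 + x \<in> T}"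
definition O2 :: "'a set" where "O2 = {x \<in> H. \<forall>y\<in>O1. x * y \<in> O1}"
definition W :: "'a set" where "W = insert 0 (O1 \<union> O2)"

lemma T_nz: "t \<in> T \<Longrightarrow> t \<noteq> 0" and T_K: "t \<in> T \<Longrightarrow> t \<in> K"
  using T_subset H_subset by auto

lemma H_nz: "t \<in> H \<Longrightarrow> t \<noteq> 0" and H_K: "t \<in> H \<Longrightarrow> t \<in> K"
  using H_subset by auto

lemma H_cancel: "x \<in> H \<Longrightarrow> x * y \<in> H \<longleftrightarrow> y \<in> H"
  using Hmul[of x y] Hmul[of "inverse x" "x * y"] Hinv[of x] H_nz[of x]
  by (auto simp: mult.assoc[symmetric])

lemma H_cancel2: "x \<in> H \<Longrightarrow> y * x \<in> H \<longleftrightarrow> y \<in> H"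
  using H_cancel[of x y] by (simp add: mult.commute)

lemma T_cancel: "x \<in> T \<Longrightarrow> x * y \<in> T \<longleftrightarrow> y \<in> T"
  using Tmul[of x y] Tmul[of "inverse x" "x * y"] Tinv[of x] T_nz[of x]
  by (auto simp: mult.assoc[symmetric])

lemma T_H: "t \<in> T \<Longrightarrow> t \<in> H" using T_subset by auto

lemma H_inv_iff: "inverse x \<in> H \<longleftrightarrow> x \<in> H"
  using Hinv[of x] Hinv[of "inverse x"] by auto

text \<open>Homogeneous form of \<open>rigid\<close>, obtained from the element
  \<open>x * s / t\<close>. Later arguments split one sum as \<open>t + x * s\<close> in several
  ways and compare the classes that are allowed.\<close>

lemma rigid_sum:
  assumes "x \<in> K" "x \<noteq> 0" "x \<notin> H" "t \<in> T" "s \<in> T"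
  shows "t + x * s \<in> T \<or> inverse x * (t + x * s) \<in> T"
proof -
  define y where "y = x * (s / t)"
  have st: "s / t \<in> T" using assms Tmul[of s "inverse t"] Tinv by (simp add: field_class.field_divide_inverse)
  have y: "y \<in> K" "y \<noteq> 0" "y \<notin> H"
    using assms st T_K T_nz H_cancel2[OF T_H[OF st]] unfolding y_def by auto
  have eq: "t + x * s = t * (1 + y)" using T_nz[OF assms(4)] by (simp add: y_def field_simps)
  from rigid[OF y] show ?thesis
  proof
    assume "1 + y \<in> T" then show ?thesis using eq Tmul assms by simp
  next
    assume "inverse y * (1 + y) \<in> T"
    then have "s * (inverse y * (1 + y)) \<in> T" using Tmul assms by simp
    moreover have "s * (inverse y * (1 + y)) = inverse x * (t + x * s)"
      unfolding eq unfolding y_def using T_nz[OF assms(4)] T_nz[OF assms(5)] assms(2)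
      by (simp add: field_simps)
    ultimately show ?thesis by simp
  qed
qed

lemma O1_memD: "x \<in> O1 \<Longrightarrow> x \<in> K \<and> x \<noteq> 0 \<and> x \<notin> H \<and> 1 + x \<in> T"
  by (auto simp: O1_def)

lemma O1_I: "x \<in> K \<Longrightarrow> x \<noteq> 0 \<Longrightarrow> x \<notin> H \<Longrightarrow> 1 + x \<in> T \<Longrightarrow> x \<in> O1"
  by (auto simp: O1_def)

definition same :: "'a \<Rightarrow> 'a \<Rightarrow> bool" where "same x y \<longleftrightarrow> inverse x * y \<in> T"

lemma same_sym: "same x y \<Longrightarrow> same y x"
  unfolding same_def using Tinv[of "inverse x * y"] by (simp add: mult.commute)

lemma same_trans: "x \<noteq> 0 \<Longrightarrow> y \<noteq> 0 \<Longrightarrow> same x y \<Longrightarrow> same y z \<Longrightarrow> same x z"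
  unfolding same_def using Tmul[of "inverse x * y" "inverse y * z"] by (simp add: field_simps)

lemma same_T: "same 1 x \<longleftrightarrow> x \<in> T" by (simp add: same_def)

lemma same_H: "same x y \<Longrightarrow> x \<noteq> 0 \<Longrightarrow> y \<in> H \<longleftrightarrow> x \<in> H"
proof -
  assume a: "same x y" "x \<noteq> 0"
  have "y = x * (inverse x * y)" using a by simp
  then show ?thesis using H_cancel2[OF T_H[of "inverse x * y"]] a(1) unfolding same_def by metis
qed

lemma same_mult_left: "z \<noteq> 0 \<Longrightarrow> same (z * x) (z * y) \<longleftrightarrow> same x y"
  unfolding same_def by (simp add: field_simps)

lemma rigid_sum_same:
  assumes "x \<in> K" "x \<noteq> 0" "x \<notin> H" "t \<in> T" "s \<in> T"
  shows "same 1 (t + x * s) \<or> same x (t + x * s)"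
  using rigid_sum[OF assms] by (simp add: same_def)

lemma sq_notin_H: "x \<in> K \<Longrightarrow> x \<notin> H \<Longrightarrow> x * x \<notin> H"
  using Hsqrt[of x] by (auto simp: power2_eq_square)

lemma not_O1_same:
  assumes "x \<in> K" "x \<noteq> 0" "x \<notin> H" "x \<notin> O1"
  shows "same x (1 + x)" and "inverse x \<in> O1"
proof -
  have r: "inverse x * (1 + x) \<in> T" using rigid[of x] assms O1_I by blast
  then show "same x (1 + x)" by (simp add: same_def)
  have "inverse x * (1 + x) = 1 + inverse x" using assms by (simp add: field_simps)
  then show "inverse x \<in> O1" using r assms by (intro O1_I) (auto simp: H_inv_iff)
qed

lemma same_cancel1: "x \<noteq> 0 \<Longrightarrow> same x (x * y) \<longleftrightarrow> y \<in> T"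
  by (simp add: same_def mult.assoc[symmetric])

lemma same_nz: "same x y \<Longrightarrow> x \<noteq> 0 \<and> y \<noteq> 0"
  using T_nz[of "inverse x * y"] by (auto simp: same_def)

lemma same_tr: "same x z \<Longrightarrow> same y z \<Longrightarrow> same x y"
  using same_trans same_sym same_nz by metis

text \<open>If \<open>1 - x\<close> had the class of \<open>-x\<close>, so would
  \<open>(1 + x) * (1 - x) = 1 - x * x\<close>, whereas rigidity of \<open>-(x * x)\<close> allows
  only the classes of 1 and of \<open>-(x * x)\<close>. Either coincidence puts \<open>x\<close>
  into \<open>H\<close>. Closure of \<open>H\<close> under square roots keeps \<open>x * x\<close>
  outside \<open>H\<close>.\<close>

lemma O1_uminus: "x \<in> O1 \<Longrightarrow> - x \<in> O1"
proof (rule ccontr)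
  assume x: "x \<in> O1" and n: "- x \<notin> O1"
  note xd = O1_memD[OF x]
  have hx: "- x \<notin> H"
    using H_cancel[of "-1" "-x"] T_H[OF Tneg[OF T1]] xd by auto
  have s: "same (- x) (1 - x)" using not_O1_same[of "-x"] xd hx n by auto
  have "inverse (- x) * (1 - x) \<in> T" using s by (simp add: same_def)
  then have "(1 + x) * (inverse (- x) * (1 - x)) \<in> T" using xd Tmul by blast
  then have s2: "same (- x) (1 + - (x * x))" by (simp add: same_def algebra_simps)
  have hxx: "- (x * x) \<notin> H"
    using H_cancel[of "-1" "-(x*x)"] T_H[OF Tneg[OF T1]] sq_notin_H xd by auto
  then have "same 1 (1 + - (x * x)) \<or> same (- (x * x)) (1 + - (x * x))"
    using rigid[of "-(x*x)"] xd by (auto simp: same_def)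
  then have "same (- x) 1 \<or> same (- x) (- (x * x))"
    using same_tr[OF s2] by blast
  then show False
  proof
    assume "same (- x) 1"
    then show False using same_H[of 1 "-x"] same_sym hx T_H[OF T1] by auto
  next
    assume "same (- x) (- (x * x))"
    then have "x \<in> T" using same_cancel1[of "-x" x] xd by simp
    then show False using xd T_H by auto
  qed
qed

lemma O1_minus: "x \<in> O1 \<Longrightarrow> 1 - x \<in> T"
  using O1_memD[OF O1_uminus] by simp

text \<open>Rests on the splitting \<open>1 - x * y = (1 - x) + x * (1 - y)\<close>.\<close>

lemma one_minus_prod:
  assumes "x \<in> O1" "y \<in> O1"
  shows "same 1 (1 - x * y) \<or> same x (1 - x * y)"
proof -
  have "same 1 ((1 - x) + x * (1 - y)) \<or> same x ((1 - x) + x * (1 - y))"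
    using assms O1_minus O1_memD by (intro rigid_sum_same) auto
  then show ?thesis by (simp add: algebra_simps)
qed

lemma not_same_1: "x \<notin> H \<Longrightarrow> \<not> same 1 x" "x \<notin> H \<Longrightarrow> \<not> same x 1"
  using T_H same_T same_sym by blast+

text \<open>Two constraints meet: \<open>1 - x * y\<close> has class 1 or \<open>x\<close> by
  \<open>one_minus_prod\<close>, and class 1 or \<open>-(x * y)\<close> by rigidity. If
  \<open>x\<close> and \<open>-(x * y)\<close> had the same class, \<open>y\<close> would be in
  \<open>T\<close>.\<close>

lemma O1_mult:
  assumes "x \<in> O1" "y \<in> O1" "x * y \<notin> H"
  shows "x * y \<in> O1"
proof -
  note d = O1_memD[OF assms(1)] O1_memD[OF assms(2)]
  have neg: "- (x * y) \<notin> H"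
    using H_cancel[of "-1" "-(x*y)"] T_H[OF Tneg[OF T1]] assms(3) by auto
  have "same 1 (1 - x * y)"
  proof (rule ccontr)
    assume "\<not> same 1 (1 - x * y)"
    then have n: "1 - x * y \<notin> T" and s: "same x (1 - x * y)"
      using one_minus_prod[OF assms(1,2)] by (auto simp: same_T)
    have "inverse (- (x * y)) * (1 + - (x * y)) \<in> T"
      using rigid[of "- (x * y)"] d neg n by (simp add: mult_mem uminus_mem)
    then have "same (x * (- y)) (1 - x * y)" by (simp add: same_def)
    then have "same x (x * (- y))" using same_tr[OF s] by simp
    then have "- y \<in> T" using same_cancel1 d by blast
    then show False using Tneg[of "-y"] d T_H by auto
  qed
  then have "- (x * y) \<in> O1" using d neg by (intro O1_I) (auto simp: same_T)
  then show ?thesis using O1_uminus[of "- (x * y)"] by simp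
qed

lemma O1_mult_H:
  assumes "x \<in> O1" "y \<in> O1" "x * y \<in> H"
  shows "x * y \<in> O2" and "1 - x * y \<in> T" and "1 + x * y \<in> T"
proof -
  have *: "1 - x * y \<in> T" if "x \<in> O1" "y \<in> O1" "x * y \<in> H" for x y
  proof (rule ccontr)
    assume n: "1 - x * y \<notin> T"
    then have "same x (1 - x * y)" using one_minus_prod[OF that(1,2)] same_T by auto
    moreover have "same y (1 - x * y)"
      using n one_minus_prod[OF that(2,1)] same_T by (auto simp: mult.commute)
    ultimately have "same x y" by (rule same_tr)
    then have "same (x * x) (x * y)" using same_mult_left[of x x y] O1_memD[OF that(1)] by simp
    then have "x * x \<in> H" using same_H[of "x * x" "x * y"] O1_memD[OF that(1)] that(3) by auto
    then show False using sq_notin_H O1_memD[OF that(1)] by blast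
  qed
  show "1 - x * y \<in> T" by (rule *[OF assms])
  have "(- x) * y \<in> H" using H_cancel[of "-1" "x*y"] T_H[OF Tneg[OF T1]] assms(3) by auto
  then show "1 + x * y \<in> T" using *[OF O1_uminus[OF assms(1)] assms(2)] by simp
  note d = O1_memD[OF assms(1)] O1_memD[OF assms(2)]
  show "x * y \<in> O2"
    unfolding O2_def
  proof safe
    fix z assume z: "z \<in> O1"
    note zd = O1_memD[OF z]
    have nh: "x * y * z \<notin> H" using H_cancel[OF assms(3)] zd by simp
    \<comment> \<open>Associativity reduces the claim to \<open>O1_mult\<close> unless
      \<open>x * z\<close> and \<open>y * z\<close> both lie in \<open>H\<close>; then
      \<open>x * x = (x * y) * (x * z) / (y * z)\<close> would lie in \<open>H\<close>.\<close>
    consider "x * z \<notin> H" | "y * z \<notin> H" | "x * z \<in> H" "y * z \<in> H" by blast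
    then show "x * y * z \<in> O1"
    proof cases
      case 1
      then show ?thesis using O1_mult[OF O1_mult[OF assms(1) z] assms(2)] nh by (simp add: ac_simps)
    next
      case 2
      then show ?thesis using O1_mult[OF O1_mult[OF assms(2) z] assms(1)] nh by (simp add: ac_simps)
    next
      case 3
      have "(x * y) * ((x * z) * inverse (y * z)) \<in> H"
        using 3 assms Hmul Hinv by blast
      moreover have "(x * y) * ((x * z) * inverse (y * z)) = x * x"
        using d zd by (simp add: field_simps)
      ultimately have "x * x \<in> H" by metis
      then show ?thesis using sq_notin_H d by auto
    qed
  qed (use assms in auto)
qed

section \<open>Ring axioms, totality and units of \<open>W\<close>\<close>

lemma W_mult: "x \<in> W \<Longrightarrow> y \<in> W \<Longrightarrow> x * y \<in> W"
proof -
  have 1: "x * y \<in> W" if "x \<in> O1" "y \<in> O1" for x y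
    using O1_mult[OF that] O1_mult_H[OF that] by (auto simp: W_def)
  have 2: "x * y \<in> W" if "x \<in> O2" "y \<in> O1" for x y
    using that by (auto simp: W_def O2_def)
  have 3: "x * y \<in> W" if "x \<in> O2" "y \<in> O2" for x y
    using that by (auto simp: W_def O2_def Hmul mult.assoc)
  assume "x \<in> W" "y \<in> W"
  then consider "x = 0 \<or> y = 0" | "x \<in> O1" "y \<in> O1" | "x \<in> O2" "y \<in> O1"
    | "y \<in> O2" "x \<in> O1" | "x \<in> O2" "y \<in> O2" unfolding W_def by blast
  then show ?thesis
    by cases (use 1 2 3 2[of y x] in \<open>auto simp: mult.commute W_def\<close>)
qed

lemma O2_one: "1 \<in> O2" using T1 T_H by (auto simp: O2_def)

lemma W_uminus: "x \<in> W \<Longrightarrow> - x \<in> W"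
proof -
  have "- 1 \<in> O2" using T_H[OF Tneg[OF T1]] O1_uminus by (auto simp: O2_def)
  then show "x \<in> W \<Longrightarrow> - x \<in> W" using W_mult[of "-1" x] by (auto simp: W_def)
qed

text \<open>If \<open>x\<close> moves some \<open>y\<close> out of \<open>O1\<close>, then
  \<open>inverse (x * y)\<close> is in \<open>O1\<close>, and
  \<open>inverse x = y * inverse (x * y)\<close>. This gives totality of \<open>W\<close> on
  \<open>H\<close> and later describes the non-units inside \<open>H\<close>.\<close>

lemma not_O2_inverse:
  assumes "x \<in> H" "x \<notin> O2"
  obtains y z where "y \<in> O1" "z \<in> O1" "inverse x = y * z"
proof -
  obtain y where y: "y \<in> O1" "x * y \<notin> O1" using assms by (auto simp: O2_def)
  note d = O1_memD[OF y(1)]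
  have "x * y \<notin> H" using d H_cancel[OF assms(1)] by simp
  then have "inverse (x * y) \<in> O1"
    using not_O1_same(2)[of "x * y"] d y(2) H_nz[OF assms(1)] H_K[OF assms(1)] by auto
  moreover have "inverse x = y * inverse (x * y)" using d H_nz[OF assms(1)] by (simp add: field_simps)
  ultimately show ?thesis using that y by blast
qed

lemma W_total: "x \<in> K \<Longrightarrow> x \<noteq> 0 \<Longrightarrow> x \<in> W \<or> inverse x \<in> W"
proof (cases "x \<in> H")
  case True
  show ?thesis
  proof (cases "x \<in> O2")
    case False
    then obtain y z where yz: "y \<in> O1" "z \<in> O1" "inverse x = y * z"
      using not_O2_inverse True by blast
    then have "y * z \<in> H" using Hinv[OF True] by simp
    then show ?thesis using O1_mult_H(1)[OF yz(1,2)] yz by (auto simp: W_def)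
  qed (auto simp: W_def)
next
  case False
  assume "x \<in> K" "x \<noteq> 0"
  then show ?thesis using not_O1_same(2)[of x] False by (auto simp: W_def)
qed

text \<open>Addition reduces to this by factoring out a summand. To show that \<open>1 + x\<close>
  multiplies \<open>O1\<close> into itself, the class of \<open>1 + (1 + x) * z\<close> is computed
  from several splittings; each allows two classes, and together with the negated goal they force an
  element outside \<open>H\<close> into \<open>T\<close>.\<close>

lemma one_plus_W: "x \<in> W \<Longrightarrow> 1 + x \<in> W"
proof -
  assume "x \<in> W"
  then consider "x = 0" | "x \<in> O1" | "x \<in> O2" by (auto simp: W_def)
  then show ?thesis
  proof cases
    case 1
    then show ?thesis using O2_one by (auto simp: W_def)
  next
    case 2
    note d = O1_memD[OF 2]
    have "1 + x \<in> O2"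
      unfolding O2_def
    proof safe
      fix z assume z: "z \<in> O1"
      note zd = O1_memD[OF z]
      have nh: "(1 + x) * z \<notin> H" using H_cancel[OF T_H] d zd by simp
      show "(1 + x) * z \<in> O1"
      proof (rule ccontr)
        assume n: "(1 + x) * z \<notin> O1"
        have "same ((1 + x) * z) (1 + (1 + x) * z)"
          using not_O1_same(1)[of "(1 + x) * z"] nh n d zd T_nz[of "1+x"] T_K[of "1+x"] by auto
        moreover have "same z ((1 + x) * z)"
          using same_cancel1[of z "1 + x"] zd d by (simp add: mult.commute)
        ultimately have sz: "same z (1 + (1 + x) * z)" using same_trans same_nz by blast
        \<comment> \<open>Splitting off \<open>- x\<close> allows only the classes of 1 and
          \<open>x\<close>, so \<open>x\<close> and \<open>z\<close> agree modulo \<open>T\<close>,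
          and \<open>x * z\<close> is outside \<open>H\<close> along with
          \<open>x * x\<close>.\<close>
        have "same 1 (((1 + z) * (1 + x)) + x * (- 1)) \<or> same x (((1 + z) * (1 + x)) + x * (- 1))"
          using d zd Tmul Tneg[OF T1] by (intro rigid_sum_same) auto
        moreover have "((1 + z) * (1 + x)) + x * (- 1) = 1 + (1 + x) * z" by (simp add: algebra_simps)
        ultimately have "same 1 z \<or> same x z" using sz same_tr by metis
        then have xz: "same x z" using not_same_1 zd by blast
        then have "same (x * x) (x * z)" using same_mult_left[of x x z] d by simp
        then have xzH: "x * z \<notin> H" using same_H[of "x * x"] d sq_notin_H by auto
        have "same 1 ((1 + z) + (x * z) * 1) \<or> same (x * z) ((1 + z) + (x * z) * 1)"
          using d zd xzH T1 by (intro rigid_sum_same) auto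
        moreover have "(1 + z) + (x * z) * 1 = 1 + (1 + x) * z" by (simp add: algebra_simps)
        ultimately have "same 1 z \<or> same (z * x) z" using sz same_tr by (metis mult.commute)
        then have "same z (z * x)" using not_same_1 zd same_sym by blast
        then show False using same_cancel1 zd d T_H by blast
      qed
    qed (use d T_H in auto)
    then show ?thesis by (auto simp: W_def)
  next
    case 3
    then have x: "x \<in> H" "\<And>z. z \<in> O1 \<Longrightarrow> x * z \<in> O1" by (auto simp: O2_def)
    have xn: "x \<noteq> 0" "x \<in> K" using x H_nz H_K by auto
    show ?thesis
    proof (cases "1 + x = 0")
      case True
      then show ?thesis by (simp add: W_def)
    next
      case nz: False
      show ?thesis
      proof (cases "1 + x \<in> H")
        case False
        \<comment> \<open>Otherwise \<open>inverse (1 + x)\<close> is in \<open>O1\<close>, and so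
          is its product with \<open>x\<close>, which is therefore outside \<open>H\<close>; but
          that product is \<open>1 - inverse (1 + x)\<close>, an element of
          \<open>T\<close>.\<close>
        have "1 + x \<in> O1"
        proof (rule ccontr)
          assume "1 + x \<notin> O1"
          then have i: "inverse (1 + x) \<in> O1" using not_O1_same(2) False nz xn by auto
          have "x * inverse (1 + x) \<notin> H" using O1_memD[OF x(2)[OF i]] by simp
          moreover have "x * inverse (1 + x) = 1 - inverse (1 + x)"
            using nz by (simp add: field_simps)
          ultimately show False using O1_minus[OF i] T_H by simp
        qed
        then show ?thesis by (simp add: W_def)
      next
        case True
        have "1 + x \<in> O2"
          unfolding O2_def
        proof safe
          fix z assume z: "z \<in> O1"
          note zd = O1_memD[OF z] and xzd = O1_memD[OF x(2)[OF z]]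
          have nh: "(1 + x) * z \<notin> H" using H_cancel[OF True] zd by simp
          show "(1 + x) * z \<in> O1"
          proof (rule ccontr)
            assume n: "(1 + x) * z \<notin> O1"
            have s: "same ((1 + x) * z) (1 + (1 + x) * z)"
              using not_O1_same(1)[of "(1 + x) * z"] nh n nz xn zd by auto
            have n1: "\<not> same 1 (1 + (1 + x) * z)"
              using same_tr[OF _ s] not_same_1(1)[OF nh] by blast
            have "same (x * z) ((1 + z) + (x * z) * 1)"
              using rigid_sum_same[of "x * z" "1 + z" 1] zd xzd T1 n1 by (auto simp: algebra_simps)
            moreover have "same z ((1 + x * z) + z * 1)"
              using rigid_sum_same[of z "1 + x * z" 1] zd xzd T1 n1 by (auto simp: algebra_simps)
            moreover have "(1 + z) + (x * z) * 1 = 1 + (1 + x) * z"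
              "(1 + x * z) + z * 1 = 1 + (1 + x) * z" by (auto simp: algebra_simps)
            ultimately have s1: "same (x * z) (1 + (1 + x) * z)" and s2: "same z (1 + (1 + x) * z)"
              by metis+
            then have "same z (x * z)" using same_tr by blast
            then have xT: "x \<in> T" using same_cancel1[of z x] zd by (simp add: mult.commute)
            \<comment> \<open>Now that \<open>x\<close> is in \<open>T\<close>, a third splitting,
              off \<open>z * z * x\<close>, becomes available and allows only the classes of 1 and
              \<open>z * z\<close>.\<close>
            have zz: "z * z \<notin> H" using sq_notin_H zd by blast
            have "same 1 (((1 + z) * (1 + x * z)) + (z * z) * (- x)) \<or>
                  same (z * z) (((1 + z) * (1 + x * z)) + (z * z) * (- x))"
              using zd xzd Tmul Tneg[OF xT] zz by (intro rigid_sum_same) auto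
            moreover have "((1 + z) * (1 + x * z)) + (z * z) * (- x) = 1 + (1 + x) * z"
              by (simp add: algebra_simps)
            ultimately have "same z (z * z)" using n1 s2 same_tr by metis
            then show False using same_cancel1 zd T_H by blast
          qed
        qed (use True in auto)
        then show ?thesis by (simp add: W_def)
      qed
    qed
  qed
qed

lemma W_subset: "W \<subseteq> K"
  using H_K O1_memD by (auto simp: W_def O2_def)

lemma W_add: "x \<in> W \<Longrightarrow> y \<in> W \<Longrightarrow> x + y \<in> W"
proof -
  have *: "x + y \<in> W" if "x \<in> W" "y \<in> W" "y \<noteq> 0" "x * inverse y \<in> W" for x y
  proof -
    have "y * (1 + x * inverse y) \<in> W" using W_mult one_plus_W that by blast
    then show ?thesis using that by (simp add: algebra_simps)
  qed
  assume a: "x \<in> W" "y \<in> W"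
  show ?thesis
  proof (cases "x = 0 \<or> y = 0")
    case False
    then have "x * inverse y \<in> W \<or> inverse (x * inverse y) \<in> W"
      using a W_subset by (intro W_total) auto
    then show ?thesis
      using *[of x y] *[of y x] False a by (auto simp: add.commute mult.commute)
  qed (use a in auto)
qed

sublocale val: val_ring K W
  using W_subset O2_one W_add W_uminus W_mult W_total
  by unfold_locales (auto simp: W_def)

text \<open>A unit outside \<open>H\<close> would have both \<open>1 + x\<close> and
  \<open>1 + inverse x\<close> in \<open>T\<close>, and their quotient is \<open>x\<close>.\<close>

lemma val_U: "val.U \<subseteq> H"
proof
  fix x assume x: "x \<in> val.U"
  show "x \<in> H"
  proof (rule ccontr)
    assume n: "x \<notin> H"
    then have "x \<in> O1" "inverse x \<in> O1"
      using x unfolding val.U_def by (auto simp: W_def O2_def H_inv_iff)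
    then have "1 + x \<in> T" "1 + inverse x \<in> T" "x \<noteq> 0" using O1_memD by auto
    moreover have "1 + x = x * (1 + inverse x)" using \<open>x \<noteq> 0\<close> by (simp add: field_simps)
    ultimately have "x \<in> T" using T_cancel[of "1 + inverse x" x] by (simp add: mult.commute)
    then show False using n T_H by auto
  qed
qed

text \<open>A nonzero non-unit in \<open>H\<close> has its inverse outside \<open>O2\<close>, so it
  is a product of two elements of \<open>O1\<close> and \<open>O1_mult_H\<close> applies.\<close>

lemma val_M: "x \<in> val.M \<Longrightarrow> 1 + x \<in> T"
proof -
  assume x: "x \<in> val.M"
  show ?thesis
  proof (cases "x = 0")
    case False
    then have "x \<in> O1 \<or> x \<in> O2" "inverse x \<notin> W" using x unfolding val.M_def by (auto simp: W_def)
    then consider "x \<in> O1" | "x \<in> H" "inverse x \<notin> O2" "inverse x \<in> H"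
      by (auto simp: W_def O2_def Hinv)
    then show ?thesis
    proof cases
      case 1
      then show ?thesis using O1_memD by blast
    next
      case 2
      then obtain y z where "y \<in> O1" "z \<in> O1" "inverse (inverse x) = y * z"
        using not_O2_inverse by blast
      then show ?thesis using O1_mult_H(3)[of y z] 2 by auto
    qed
  qed (use T1 in auto)
qed

end

section \<open>Kummer extensions\<close>

text \<open>Isolates the terms of \<open>(1 + r) ^ p\<close> that matter for a valuation: the middle
  coefficients are divisible by \<open>p\<close>, and beyond the linear term a further factor
  \<open>r\<close> comes out.\<close>

lemma binomial_prime:
  fixes r :: "'a::comm_ring_1"
  assumes "prime p" "p > 2"
  shows "(1 + r) ^ p = 1 + r ^ p + of_nat p * r *
    (1 + r * (\<Sum>k\<in>{2..<p}. of_nat ((p choose k) div p) * r ^ (k - 2)))"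
proof -
  have split: "{..p} = insert 0 (insert 1 (insert p {2..<p}))" using assms(2) by auto
  have term_eq: "of_nat (p choose k) * r ^ k =
      of_nat p * r * (r * (of_nat ((p choose k) div p) * r ^ (k - 2)))" if "k \<in> {2..<p}" for k
  proof -
    have "p dvd (p choose k)" using that assms by (intro dvd_choose_prime) auto
    then have "of_nat (p choose k) = of_nat p * (of_nat ((p choose k) div p) :: 'a)"
      by (metis dvd_mult_div_cancel of_nat_mult)
    moreover have "r ^ k = r * r * r ^ (k - 2)"
      using that by (metis atLeastLessThan_iff le_add_diff_inverse power2_eq_square power_add)
    ultimately show ?thesis by (simp add: ac_simps)
  qed
  have "(1 + r) ^ p = (\<Sum>k\<le>p. of_nat (p choose k) * r ^ k)"
    using binomial_ring[of r 1 p] by (simp add: add.commute)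
  also have "\<dots> = 1 + of_nat p * r + r ^ p + (\<Sum>k\<in>{2..<p}. of_nat (p choose k) * r ^ k)"
    unfolding split using assms(2) by simp
  also have "(\<Sum>k\<in>{2..<p}. of_nat (p choose k) * r ^ k) =
      of_nat p * r * (r * (\<Sum>k\<in>{2..<p}. of_nat ((p choose k) div p) * r ^ (k - 2)))"
    unfolding sum_distrib_left by (intro sum.cong refl term_eq)
  finally show ?thesis by (simp add: algebra_simps)
qed

text \<open>The row of powers of \<open>\<gamma>\<close> is a left eigenvector of the multiplication
  matrix; its eigenvalue is the multiplying polynomial evaluated at \<open>\<gamma>\<close>. The
  factor \<open>b\<close> in the wrapped entries stands for \<open>\<gamma> ^ p\<close>.\<close>

lemma mult_matrix_eigen:
  fixes \<gamma> :: "'a::field"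
  assumes "\<gamma> ^ p = b" "k < p"
  shows "(\<Sum>m<p. \<gamma> ^ m * (if k \<le> m then c (m - k) else b * c (m + p - k))) =
    \<gamma> ^ k * (\<Sum>i<p. c i * \<gamma> ^ i)"
proof -
  let ?f = "\<lambda>m. \<gamma> ^ m * (if k \<le> m then c (m - k) else b * c (m + p - k))"
  let ?g = "\<lambda>i. \<gamma> ^ k * (c i * \<gamma> ^ i)"
  have 1: "sum ?f {..<k} = sum ?g {p-k..<p}"
  proof (rule sum.reindex_bij_witness[of _ "\<lambda>i. i + k - p" "\<lambda>m. m + p - k"])
    fix m assume m: "m \<in> {..<k}"
    have "\<gamma> ^ m * b = \<gamma> ^ k * \<gamma> ^ (m + p - k)"
      using m assms by (simp add: assms(1)[symmetric] power_add[symmetric])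
    then show "?g (m + p - k) = ?f m" using m by (simp add: ac_simps)
  qed (use assms in auto)
  have 2: "sum ?f {k..<p} = sum ?g {..<p-k}"
  proof (rule sum.reindex_bij_witness[of _ "\<lambda>i. i + k" "\<lambda>m. m - k"])
    fix m assume m: "m \<in> {k..<p}"
    have "\<gamma> ^ m = \<gamma> ^ k * \<gamma> ^ (m - k)" using m by (simp add: power_add[symmetric])
    then show "?g (m - k) = ?f m" using m by (simp add: ac_simps)
  qed (use assms in auto)
  have split: "sum h {..<p} = sum h {..<m} + sum h {m..<p}" if "m \<le> p" for h :: "nat \<Rightarrow> 'a" and m
    using sum.atLeastLessThan_concat[of 0 m p h] that by (simp add: lessThan_atLeast0)
  have "sum ?f {..<p} = sum ?f {..<k} + sum ?f {k..<p}"
    using assms(2) by (intro split) simp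
  also have "\<dots> = sum ?g {..<p-k} + sum ?g {p-k..<p}" unfolding 1 2 by simp
  also have "\<dots> = sum ?g {..<p}" by (rule split[symmetric]) simp
  finally show ?thesis by (simp add: sum_distrib_left)
qed

section \<open>Orthogonality of roots of unity and the determinant as a product over
  conjugates\<close>

context root_field
begin

lemma root_power_mult: "\<zeta> ^ (p * n) = 1"
  by (simp add: power_mult root_power)

lemma root_power_eq_1_iff: "\<zeta> ^ k = 1 \<longleftrightarrow> p dvd k"
proof -
  have "\<zeta> ^ k = \<zeta> ^ (p * (k div p) + k mod p)" by simp
  also have "\<dots> = \<zeta> ^ (k mod p)" unfolding power_add root_power_mult by simp
  finally have "\<zeta> ^ k = \<zeta> ^ (k mod p)" .
  then show ?thesis using root_primitive p_pos by (cases "k mod p = 0") (auto simp: dvd_eq_mod_eq_0)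
qed

lemma root_sum: "(\<Sum>j<p. \<zeta> ^ (j * k)) = (if p dvd k then of_nat p else 0)"
proof (cases "p dvd k")
  case True
  then have "\<zeta> ^ (j * k) = 1" for j using root_power_eq_1_iff by (simp add: dvd_mult)
  then show ?thesis using True by simp
next
  case False
  have "(\<Sum>j<p. \<zeta> ^ (j * k)) = (\<Sum>j<p. (\<zeta> ^ k) ^ j)" by (simp add: power_mult[symmetric] mult.commute)
  also have "\<dots> = ((\<zeta> ^ k) ^ p - 1) / (\<zeta> ^ k - 1)"
    using False root_power_eq_1_iff by (intro geometric_sum) auto
  also have "(\<zeta> ^ k) ^ p = 1" using root_power_mult[of k] by (simp add: power_mult[symmetric] mult.commute)
  finally show ?thesis using False by simp
qed

text \<open>A primitive \<open>p\<close>-th root of unity rules out characteristic \<open>p\<close>,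
  where \<open>\<zeta> ^ p = 1\<close> would give \<open>(\<zeta> - 1) ^ p = 0\<close>.\<close>

lemma p_nz: "of_nat p \<noteq> (0::'a)"
proof
  assume z: "of_nat p = (0::'a)"
  have "(1 + (\<zeta> - 1)) ^ p = 1 + (\<zeta> - 1) ^ p"
    by (subst binomial_prime[OF prime_p p_gt_2]) (simp add: z)
  then have "\<zeta> = 1" using root_power by simp
  then show False using root_primitive[rule_format, of 1] p_gt_2 by simp
qed

text \<open>The Vandermonde matrix of the roots \<open>\<zeta> ^ j * \<beta>\<close> diagonalises
  the multiplication matrix. The formula starts from a single root \<open>\<beta>\<close> and can
  therefore serve later to prove that the powers of \<open>\<beta>\<close> are independent.\<close>

lemma det_mult_matrix:
  assumes b: "\<beta> ^ p = b" and nz: "\<beta> \<noteq> 0"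
  shows "det (mult_matrix p b c) = (\<Prod>j<p. \<Sum>i<p. c i * (\<zeta> ^ j * \<beta>) ^ i)"
proof -
  define V where "V = mat p p (\<lambda>(j, k). (\<zeta> ^ j * \<beta>) ^ k)"
  \<comment> \<open>Inverse Fourier matrix witnessing that \<open>V\<close> is invertible;
    \<open>p - j\<close> stands for \<open>-j\<close> to keep the exponent natural.\<close>
  define W where "W = mat p p (\<lambda>(k, j). inverse (of_nat p) * (\<zeta> ^ (p - j) * inverse \<beta>) ^ k)"
  define D where "D = mat p p (\<lambda>(i, j). if i = j then \<Sum>l<p. c l * (\<zeta> ^ i * \<beta>) ^ l else 0)"
  let ?M = "mult_matrix p b c"
  have carr [simp]: "V \<in> carrier_mat p p" "W \<in> carrier_mat p p" "D \<in> carrier_mat p p" "?M \<in> carrier_mat p p"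
    by (auto simp: V_def W_def D_def mult_matrix_def)
  have gp: "(\<zeta> ^ j * \<beta>) ^ p = b" for j
    by (simp add: power_mult_distrib b power_mult[symmetric] mult.commute[of j p] root_power_mult)
  have VW: "V * W = 1\<^sub>m p"
  proof (rule eq_matI)
    fix j l assume "j < dim_row (1\<^sub>m p)" "l < dim_col (1\<^sub>m p)"
    then have jl: "j < p" "l < p" by auto
    have "(V * W) $$ (j, l) =
        (\<Sum>k<p. (\<zeta> ^ j * \<beta>) ^ k * (inverse (of_nat p) * (\<zeta> ^ (p - l) * inverse \<beta>) ^ k))"
      using jl by (simp add: V_def W_def scalar_prod_def lessThan_atLeast0)
    also have "\<dots> = (\<Sum>k<p. inverse (of_nat p) * \<zeta> ^ (k * (j + (p - l))))"
    proof (rule sum.cong[OF refl])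
      fix k
      have "(\<zeta> ^ j * \<beta>) ^ k * (\<zeta> ^ (p - l) * inverse \<beta>) ^ k =
          ((\<zeta> ^ j * \<beta>) * (\<zeta> ^ (p - l) * inverse \<beta>)) ^ k"
        by (simp only: power_mult_distrib)
      also have "(\<zeta> ^ j * \<beta>) * (\<zeta> ^ (p - l) * inverse \<beta>) = \<zeta> ^ (j + (p - l))"
        using nz by (simp add: power_add)
      finally show "(\<zeta> ^ j * \<beta>) ^ k * (inverse (of_nat p) * (\<zeta> ^ (p - l) * inverse \<beta>) ^ k) =
          inverse (of_nat p) * \<zeta> ^ (k * (j + (p - l)))"
        by (simp add: power_mult[symmetric] mult.commute mult.left_commute)
    qed
    also have "\<dots> = inverse (of_nat p) * (if p dvd j + (p - l) then of_nat p else 0)"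
      unfolding sum_distrib_left[symmetric] root_sum ..
    also have "p dvd j + (p - l) \<longleftrightarrow> j = l"
    proof
      assume "p dvd j + (p - l)"
      then obtain q where q: "j + (p - l) = p * q" by (auto simp: dvd_def)
      have "0 < p * q" "p * q < p * 2" unfolding q[symmetric] using jl by auto
      then have "q = 1" by (cases q) auto
      then show "j = l" using q jl by simp
    qed (use jl in auto)
    finally show "(V * W) $$ (j, l) = 1\<^sub>m p $$ (j, l)" using jl p_nz by simp
  qed (auto simp: V_def W_def)
  have VM: "V * ?M = D * V"
  proof (rule eq_matI)
    fix j k assume "j < dim_row (D * V)" "k < dim_col (D * V)"
    then have jk: "j < p" "k < p" by (auto simp: D_def V_def)
    have "(V * ?M) $$ (j, k) =
        (\<Sum>m<p. (\<zeta> ^ j * \<beta>) ^ m * (if k \<le> m then c (m - k) else b * c (m + p - k)))"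
      using jk by (simp add: V_def mult_matrix_def scalar_prod_def lessThan_atLeast0)
    also have "\<dots> = (\<zeta> ^ j * \<beta>) ^ k * (\<Sum>i<p. c i * (\<zeta> ^ j * \<beta>) ^ i)"
      using gp jk by (intro mult_matrix_eigen)
    also have "\<dots> = (\<Sum>m<p. (if j = m then \<Sum>l<p. c l * (\<zeta> ^ j * \<beta>) ^ l else 0) * (\<zeta> ^ m * \<beta>) ^ k)"
      using jk by (simp add: if_distrib[of "\<lambda>x. x * _"] sum.delta' cong: if_cong)
    also have "\<dots> = (D * V) $$ (j, k)"
      using jk by (simp add: V_def D_def scalar_prod_def lessThan_atLeast0 if_distrib cong: if_cong)
    finally show "(V * ?M) $$ (j, k) = (D * V) $$ (j, k)" .
  qed (auto simp: D_def V_def mult_matrix_def)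
  have "det V * det W = 1" using VW det_mult[of V p W] by simp
  then have "det V \<noteq> 0" by auto
  moreover have "det V * det ?M = det D * det V"
    using arg_cong[OF VM, of det] det_mult[of V p ?M] det_mult[of D p V] by simp
  ultimately have "det ?M = det D" by simp
  also have "det D = prod_list (diag_mat D)"
    by (rule det_upper_triangular[of _ p]) (auto simp: D_def)
  also have "\<dots> = (\<Prod>j<p. \<Sum>i<p. c i * (\<zeta> ^ j * \<beta>) ^ i)"
    by (simp add: diag_mat_def D_def prod.list_conv_set_nth lessThan_atLeast0)
  finally show ?thesis .
qed

end

text \<open>Independence of the powers of \<open>\<beta>\<close> takes the place of irreducibility
  of \<open>X^p - b\<close>. It is supplied in two ways: by an algebraically closed ambient field,
  or by a norm group that avoids 0.\<close>

locale kummer = root_field K p \<zeta> for K :: "'a::field set" and p and \<zeta> :: 'a +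
  fixes b \<beta> :: 'a
  assumes b_mem: "b \<in> K" and b_nz: "b \<noteq> 0" and \<beta>_power: "\<beta> ^ p = b"
    and indep: "\<And>c i. (\<forall>i<p. c i \<in> K) \<Longrightarrow> (\<Sum>i<p. c i * \<beta> ^ i) = 0 \<Longrightarrow> i < p \<Longrightarrow> c i = 0"
begin

definition ev :: "(nat \<Rightarrow> 'a) \<Rightarrow> 'a" where "ev c = (\<Sum>i<p. c i * \<beta> ^ i)"
definition L :: "'a set" where "L = {ev c | c. \<forall>i<p. c i \<in> K}"
definition coord :: "'a \<Rightarrow> nat \<Rightarrow> 'a" where "coord x = (SOME c. (\<forall>i<p. c i \<in> K) \<and> ev c = x)"
text \<open>The \<open>j\<close>-th power of the automorphism \<open>\<sigma>\<close> sending
  \<open>\<beta>\<close> to \<open>\<zeta> * \<beta>\<close>, given on coordinates; \<open>j\<close>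
  is any natural number, with period \<open>p\<close>.\<close>

definition sg :: "nat \<Rightarrow> 'a \<Rightarrow> 'a" where "sg j x = ev (\<lambda>i. coord x i * \<zeta> ^ (i * j))"
definition N :: "'a \<Rightarrow> 'a" where "N x = (\<Prod>j<p. sg j x)"

lemma \<beta>_nz: "\<beta> \<noteq> 0"
  using b_nz \<beta>_power p_pos by (metis power_0_left neq0_conv)

lemma coord:
  assumes "x \<in> L"
  shows "i < p \<Longrightarrow> coord x i \<in> K" and "ev (coord x) = x"
proof -
  have "\<exists>c. (\<forall>i<p. c i \<in> K) \<and> ev c = x" using assms by (auto simp: L_def)
  from someI_ex[OF this] show "i < p \<Longrightarrow> coord x i \<in> K" "ev (coord x) = x"
    by (auto simp: coord_def)
qed

lemma ev_mem: "(\<And>i. i < p \<Longrightarrow> c i \<in> K) \<Longrightarrow> ev c \<in> L"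
  by (auto simp: L_def)

lemma coord_ev:
  assumes "\<And>i. i < p \<Longrightarrow> c i \<in> K" "i < p"
  shows "coord (ev c) i = c i"
proof -
  have l: "ev c \<in> L" using assms(1) by (rule ev_mem)
  have "(\<Sum>i<p. (coord (ev c) i - c i) * \<beta> ^ i) = ev (coord (ev c)) - ev c"
    by (simp add: ev_def left_diff_distrib sum_subtractf)
  also have "\<dots> = 0" using coord(2)[OF l] by simp
  finally have "coord (ev c) i - c i = 0"
    by (rule indep[rotated]) (use assms coord(1)[OF l] in auto)
  then show ?thesis by simp
qed

lemma ev_cong: "(\<And>i. i < p \<Longrightarrow> c i = d i) \<Longrightarrow> ev c = ev d"
  by (auto simp: ev_def intro: sum.cong)

lemma sg_ev:
  assumes "\<And>i. i < p \<Longrightarrow> c i \<in> K"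
  shows "sg j (ev c) = ev (\<lambda>i. c i * \<zeta> ^ (i * j))"
  unfolding sg_def by (rule ev_cong) (simp add: coord_ev[OF assms])

lemma sg_mem: "x \<in> L \<Longrightarrow> sg j x \<in> L"
  unfolding sg_def by (rule ev_mem) (auto simp: coord root_mem mult_mem power_mem)

lemma monom_eq_ev: "k * \<beta> ^ n = ev (\<lambda>i. if i = n mod p then k * b ^ (n div p) else 0)"
proof -
  have "ev (\<lambda>i. if i = n mod p then k * b ^ (n div p) else 0) = k * b ^ (n div p) * \<beta> ^ (n mod p)"
    unfolding ev_def by (simp add: if_distrib[of "\<lambda>x. x * _"] sum.delta cong: if_cong)
  also have "\<dots> = k * \<beta> ^ (p * (n div p)) * \<beta> ^ (n mod p)"
    by (simp add: \<beta>_power[symmetric] power_mult)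
  also have "\<dots> = k * \<beta> ^ n" by (simp add: mult.assoc power_add[symmetric])
  finally show ?thesis by simp
qed

lemma monom_mem: "k \<in> K \<Longrightarrow> k * \<beta> ^ n \<in> L"
  unfolding monom_eq_ev by (rule ev_mem) (auto simp: b_mem power_mem mult_mem)

lemma sg_monom: "k \<in> K \<Longrightarrow> sg j (k * \<beta> ^ n) = k * \<zeta> ^ (n * j) * \<beta> ^ n"
proof -
  assume k: "k \<in> K"
  have z: "\<zeta> ^ (n mod p * j) = \<zeta> ^ (n * j)"
  proof -
    have "n * j = n mod p * j + p * (n div p * j)"
      by (metis add.commute mult.assoc mult_div_mod_eq add_mult_distrib)
    then show ?thesis by (simp add: power_add root_power_mult)
  qed
  have "sg j (k * \<beta> ^ n) = ev (\<lambda>i. (if i = n mod p then k * b ^ (n div p) else 0) * \<zeta> ^ (i * j))"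
    unfolding monom_eq_ev by (rule sg_ev) (auto simp: k b_mem power_mem mult_mem)
  also have "\<dots> = ev (\<lambda>i. if i = n mod p then (k * \<zeta> ^ (n * j)) * b ^ (n div p) else 0)"
    by (rule ev_cong) (auto simp: z)
  also have "\<dots> = (k * \<zeta> ^ (n * j)) * \<beta> ^ n" by (rule monom_eq_ev[symmetric])
  finally show ?thesis .
qed

lemma K_subset_L: "k \<in> K \<Longrightarrow> k \<in> L"
  using monom_mem[of k 0] by simp

lemma sg_K: "k \<in> K \<Longrightarrow> sg j k = k"
  using sg_monom[of k j 0] by simp

lemma \<beta>_mem: "\<beta> \<in> L"
  using monom_mem[of 1 1] by simp

lemma sg_\<beta>: "sg j \<beta> = \<zeta> ^ j * \<beta>"
  using sg_monom[of 1 j 1] by simp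

lemma ev_add: "ev c + ev d = ev (\<lambda>i. c i + d i)"
  by (simp add: ev_def sum.distrib algebra_simps)

lemma L_add: assumes "x \<in> L" "y \<in> L" shows "x + y \<in> L" and "sg j (x + y) = sg j x + sg j y"
proof -
  have eq: "x + y = ev (\<lambda>i. coord x i + coord y i)"
    unfolding ev_add[symmetric] using coord(2) assms by simp
  show "x + y \<in> L" unfolding eq by (rule ev_mem) (use coord(1) assms in auto)
  show "sg j (x + y) = sg j x + sg j y"
    unfolding eq
    by (subst sg_ev) (use coord(1) assms in \<open>auto simp: sg_def ev_add algebra_simps\<close>)
qed

lemma sg_0: "sg j 0 = 0"
  using sg_K[of 0] by simp

lemma sg_1: "sg j 1 = 1"
  using sg_K[of 1] by simp

lemma L_sum:
  assumes "\<And>i. i \<in> A \<Longrightarrow> f i \<in> L"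
  shows "sum f A \<in> L" and "sg j (sum f A) = (\<Sum>i\<in>A. sg j (f i))"
  using assms
  by (induction A rule: infinite_finite_induct) (auto simp: L_add sg_0 K_subset_L)

lemma L_mult: assumes "x \<in> L" "y \<in> L" shows "x * y \<in> L" and "sg j (x * y) = sg j x * sg j y"
proof -
  let ?c = "coord x" and ?d = "coord y"
  have eq: "x * y = (\<Sum>i<p. \<Sum>k<p. ?c i * ?d k * \<beta> ^ (i + k))"
  proof -
    have "x * y = ev ?c * ev ?d" using coord(2) assms by simp
    also have "\<dots> = (\<Sum>i<p. \<Sum>k<p. ?c i * ?d k * \<beta> ^ (i + k))"
      unfolding ev_def sum_product by (simp add: power_add ac_simps)
    finally show ?thesis .
  qed
  have m: "?c i * ?d k * \<beta> ^ (i + k) \<in> L" if "i < p" "k < p" for i k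
    using that coord(1) assms by (intro monom_mem) auto
  show "x * y \<in> L" unfolding eq by (intro L_sum(1)) (use m in auto)
  have "sg j (x * y) = (\<Sum>i<p. \<Sum>k<p. sg j (?c i * ?d k * \<beta> ^ (i + k)))"
    unfolding eq
  proof (subst L_sum(2))
    show "(\<Sum>i<p. sg j (\<Sum>k<p. ?c i * ?d k * \<beta> ^ (i + k))) =
       (\<Sum>i<p. \<Sum>k<p. sg j (?c i * ?d k * \<beta> ^ (i + k)))"
      by (intro sum.cong refl L_sum(2)) (use m in auto)
  qed (use m in \<open>auto intro!: L_sum(1)\<close>)
  also have "\<dots> = (\<Sum>i<p. \<Sum>k<p. (?c i * \<zeta> ^ (i * j) * \<beta> ^ i) * (?d k * \<zeta> ^ (k * j) * \<beta> ^ k))"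
  proof (intro sum.cong refl)
    fix i k assume "i \<in> {..<p}" "k \<in> {..<p}"
    then have "?c i * ?d k \<in> K" using coord(1) assms by auto
    from sg_monom[OF this, of j "i + k"] show "sg j (?c i * ?d k * \<beta> ^ (i + k)) =
        (?c i * \<zeta> ^ (i * j) * \<beta> ^ i) * (?d k * \<zeta> ^ (k * j) * \<beta> ^ k)"
      by (simp add: power_add add_mult_distrib mult.assoc mult.left_commute)
  qed
  also have "\<dots> = sg j x * sg j y"
    unfolding sg_def ev_def sum_product by simp
  finally show "sg j (x * y) = sg j x * sg j y" .
qed

lemma L_power: assumes "x \<in> L" shows "x ^ n \<in> L" and "sg j (x ^ n) = sg j x ^ n"
  using assms by (induction n) (auto simp: L_mult sg_1 K_subset_L)

lemma L_prod:
  assumes "\<And>i. i \<in> A \<Longrightarrow> f i \<in> L"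
  shows "prod f A \<in> L" and "sg j (prod f A) = (\<Prod>i\<in>A. sg j (f i))"
  using assms
  by (induction A rule: infinite_finite_induct) (auto simp: L_mult sg_1 K_subset_L)

lemma L_uminus: assumes "x \<in> L" shows "- x \<in> L" and "sg j (- x) = - sg j x"
  using L_mult[of "-1" x] assms K_subset_L[of "-1"] sg_K[of "-1"] by (auto simp: uminus_mem)

lemma L_diff: assumes "x \<in> L" "y \<in> L" shows "x - y \<in> L" and "sg j (x - y) = sg j x - sg j y"
  using L_add[of x "-y"] L_uminus[of y] assms by auto

lemma sg_id: "x \<in> L \<Longrightarrow> sg 0 x = x"
  using coord(2) by (simp add: sg_def)

lemma sg_sg: assumes "x \<in> L" shows "sg j (sg k x) = sg (k + j) x"
proof -
  have "sg j (ev (\<lambda>i. coord x i * \<zeta> ^ (i * k))) = ev (\<lambda>i. (coord x i * \<zeta> ^ (i * k)) * \<zeta> ^ (i * j))"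
    by (rule sg_ev) (use coord(1)[OF assms] root_mem in auto)
  then show ?thesis by (simp add: sg_def power_add ac_simps distrib_left)
qed

lemma sg_mod: "x \<in> L \<Longrightarrow> sg (j mod p) x = sg j x"
proof -
  have "\<zeta> ^ (i * (j mod p)) = \<zeta> ^ (i * j)" for i
  proof -
    have "i * j = i * (j mod p) + p * (i * (j div p))"
      by (metis mult.left_commute mult_div_mod_eq add.commute add_mult_distrib2)
    then show ?thesis by (simp add: power_add root_power_mult)
  qed
  then show ?thesis by (simp add: sg_def)
qed

lemma sg_nz: assumes "x \<in> L" "x \<noteq> 0" shows "sg j x \<noteq> 0"
proof
  assume "sg j x = 0"
  then have "sg (p - j mod p) (sg (j mod p) x) = 0" using assms(1) by (simp add: sg_mod sg_0)
  then have "sg (j mod p + (p - j mod p)) x = 0" using sg_sg[OF assms(1)] by simp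
  then have "sg p x = 0" by (simp add: less_imp_le)
  then show False using sg_mod[OF assms(1), of p] sg_id[OF assms(1)] assms(2) by simp
qed

lemma fixed_in_K: assumes "x \<in> L" "sg 1 x = x" shows "x \<in> K" and "x = coord x 0"
proof -
  have z: "coord x i = 0" if "i < p" "i \<noteq> 0" for i
  proof -
    have "coord (sg 1 x) i = coord x i * \<zeta> ^ (i * 1)"
      unfolding sg_def by (rule coord_ev) (use coord(1)[OF assms(1)] root_mem that in auto)
    then have "coord x i * (\<zeta> ^ i - 1) = 0" using assms(2) by (simp add: algebra_simps)
    moreover have "\<zeta> ^ i \<noteq> 1" using that root_primitive by auto
    ultimately show ?thesis by simp
  qed
  have "x = ev (coord x)" using coord(2)[OF assms(1)] by simp
  also have "\<dots> = (\<Sum>i<p. if i = 0 then coord x 0 else 0)"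
    unfolding ev_def by (intro sum.cong refl) (auto simp: z)
  finally show x: "x = coord x 0" by (simp add: sum.delta)
  show "x \<in> K" using coord(1)[OF assms(1), of 0] x by simp
qed

lemma prod_sg_shift: "x \<in> L \<Longrightarrow> (\<Prod>j<p. sg (j + k) x) = N x"
proof -
  assume x: "x \<in> L"
  have step: "(\<Prod>j<p. sg (j + Suc k) x) = (\<Prod>j<p. sg (j + k) x)" for k
  proof -
    have "(\<Prod>j<p. sg (Suc j + k) x) * sg k x = (\<Prod>j<Suc p. sg (j + k) x)"
      by (subst prod.lessThan_Suc_shift) (simp add: mult.commute)
    also have "\<dots> = (\<Prod>j<p. sg (j + k) x) * sg (p + k) x" by simp
    also have "sg (p + k) x = sg k x" using sg_mod[OF x, of "p + k"] sg_mod[OF x, of k] by simp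
    finally show ?thesis using sg_nz[OF x] by (cases "x = 0") (auto simp: sg_0)
  qed
  show ?thesis using step by (induction k) (auto simp: N_def)
qed

lemma N_mem: assumes "x \<in> L" shows "N x \<in> K"
proof (rule fixed_in_K(1))
  show "N x \<in> L" unfolding N_def by (rule L_prod(1)) (use assms sg_mem in auto)
  have "sg 1 (N x) = (\<Prod>j<p. sg 1 (sg j x))"
    unfolding N_def by (rule L_prod(2)) (use assms sg_mem in auto)
  also have "\<dots> = N x" using prod_sg_shift[OF assms, of 1] by (simp add: sg_sg assms)
  finally show "sg 1 (N x) = N x" .
qed

lemma N_nz: "x \<in> L \<Longrightarrow> x \<noteq> 0 \<Longrightarrow> N x \<noteq> 0"
  by (simp add: N_def sg_nz)

lemma N_mult: "x \<in> L \<Longrightarrow> y \<in> L \<Longrightarrow> N (x * y) = N x * N y"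
  by (simp add: N_def L_mult prod.distrib)

lemma N_power: "x \<in> L \<Longrightarrow> N (x ^ n) = N x ^ n"
  by (simp add: N_def L_power prod_power_distrib)

lemma N_K: "k \<in> K \<Longrightarrow> N k = k ^ p"
  by (simp add: N_def sg_K)

lemma N_\<beta>: "N \<beta> = b"
proof -
  have "N \<beta> = (\<Prod>j<p. \<zeta> ^ j) * b" by (simp add: N_def sg_\<beta> prod.distrib \<beta>_power)
  also have "(\<Prod>j<p. \<zeta> ^ j) = \<zeta> ^ (\<Sum>j<p. j)" by (simp add: power_sum)
  \<comment> \<open>Oddness of \<open>p\<close> makes \<open>(p - 1) div 2\<close> exact, so the
    product of all \<open>\<zeta> ^ j\<close> is 1 and no sign appears.\<close>
  also have "(\<Sum>j<p. j) = p * ((p - 1) div 2)"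
    using Sum_Ico_nat[of 0 p] odd_p by (simp add: lessThan_atLeast0 div_mult_swap)
  finally show ?thesis by (simp add: root_power_mult)
qed

definition conj_prod :: "'a \<Rightarrow> 'a" where "conj_prod x = (\<Prod>j\<in>{1..<p}. sg j x)"

lemma N_conj_prod: "x \<in> L \<Longrightarrow> N x = x * conj_prod x"
proof -
  assume "x \<in> L"
  have "{..<p} = insert 0 {1..<p}" using p_pos by auto
  then show ?thesis by (simp add: N_def conj_prod_def sg_id[OF \<open>x \<in> L\<close>])
qed

lemma conj_prod_mem: "x \<in> L \<Longrightarrow> conj_prod x \<in> L"
  unfolding conj_prod_def by (rule L_prod(1)) (use sg_mem in auto)

lemma inverse_eq_conj_prod: "x \<in> L \<Longrightarrow> x \<noteq> 0 \<Longrightarrow> inverse x = inverse (N x) * conj_prod x"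
  using N_conj_prod[of x] N_nz[of x] by (simp add: field_simps)

lemma L_inverse: assumes "x \<in> L" shows "inverse x \<in> L"
proof (cases "x = 0")
  case False
  then show ?thesis
    using inverse_eq_conj_prod[OF assms] L_mult(1)[OF K_subset_L[OF inverse_mem[OF N_mem[OF assms]]]
        conj_prod_mem[OF assms]] by simp
qed (simp add: K_subset_L)

lemma L_subfield: "is_subfield L"
  unfolding is_subfield_def
  using L_add(1) L_diff(1) L_mult(1) L_inverse K_subset_L by auto

sublocale LF: root_field L p \<zeta>
  using L_subfield prime_p odd_p root_power root_primitive K_subset_L[OF root_mem]
  by unfold_locales auto

lemma sg_inverse: assumes "x \<in> L" shows "sg j (inverse x) = inverse (sg j x)"
proof (cases "x = 0")
  case False
  have "sg j x * sg j (inverse x) = 1"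
    using L_mult(2)[OF assms L_inverse[OF assms], of j] False by (simp add: sg_1)
  then show ?thesis by (metis inverse_unique)
qed (simp add: sg_0)

lemma gen_field_eq: "gen_field (insert \<beta> K) = L"
proof
  show "gen_field (insert \<beta> K) \<subseteq> L"
    unfolding gen_field_def using L_subfield K_subset_L \<beta>_mem by auto
  have "L \<subseteq> E" if "is_subfield E" "insert \<beta> K \<subseteq> E" for E
  proof -
    interpret E: subfield_set E using that by unfold_locales
    show ?thesis
      unfolding L_def ev_def using that(2) by (auto intro!: E.sum_mem E.mult_mem E.power_mem)
  qed
  then show "L \<subseteq> gen_field (insert \<beta> K)" unfolding gen_field_def by blast
qed

lemma det_eq_N: assumes "\<forall>i<p. c i \<in> K" shows "det (mult_matrix p b c) = N (ev c)"
proof -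
  have "(\<Sum>i<p. c i * (\<zeta> ^ j * \<beta>) ^ i) = sg j (ev c)" for j
    by (subst sg_ev) (use assms in \<open>auto simp: ev_def power_mult_distrib power_mult[symmetric] ac_simps\<close>)
  then show ?thesis
    using det_mult_matrix[OF \<beta>_power \<beta>_nz, of c] by (simp add: N_def)
qed

lemma norm_group_eq: "norm_group K p b = N ` (L - {0})"
proof
  show "norm_group K p b \<subseteq> N ` (L - {0})"
  proof
    fix y assume "y \<in> norm_group K p b"
    then obtain c where c: "y = det (mult_matrix p b c)" "\<forall>i<p. c i \<in> K" "\<exists>i<p. c i \<noteq> 0"
      by (auto simp: norm_group_def)
    then have "ev c \<noteq> 0" using indep[OF c(2)] by (auto simp: ev_def)
    moreover have "y = N (ev c)" using c(1) det_eq_N[OF c(2)] by simp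
    moreover have "ev c \<in> L" using c(2) by (simp add: ev_mem)
    ultimately show "y \<in> N ` (L - {0})" by simp
  qed
  show "N ` (L - {0}) \<subseteq> norm_group K p b"
  proof
    fix y assume "y \<in> N ` (L - {0})"
    then obtain x where x: "x \<in> L" "x \<noteq> 0" "y = N x" by auto
    have "y = det (mult_matrix p b (coord x))"
      using det_eq_N[of "coord x"] coord[OF x(1)] x(3) by simp
    moreover have "\<exists>i<p. coord x i \<noteq> 0"
    proof (rule ccontr)
      assume "\<not> ?thesis"
      then have "ev (coord x) = 0" unfolding ev_def by (intro sum.neutral) auto
      then show False using coord(2)[OF x(1)] x(2) by simp
    qed
    moreover have "\<forall>i<p. coord x i \<in> K" using coord(1)[OF x(1)] by simp
    ultimately show "y \<in> norm_group K p b" unfolding norm_group_def by blast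
  qed
qed

end

section \<open>Hilbert 90 and powers of \<open>1 - \<sigma>\<close>\<close>

context kummer
begin

text \<open>\<open>Z\<close> is the cocycle of partial products of conjugates of \<open>z\<close>,
  and \<open>y\<close> is the resolvent with summands \<open>Z k * sg k (\<beta> ^ j)\<close>.
  Conjugating and multiplying by \<open>z\<close> shifts the index, and the sum closes up because
  \<open>Z p = N z = 1\<close>.\<close>

lemma hilbert90:
  assumes z: "z \<in> L" "N z = 1"
  obtains y where "y \<in> L" "y \<noteq> 0" "z = y / sg 1 y"
proof -
  define Z where "Z k = (\<Prod>l<k. sg l z)" for k
  have ZL: "Z k \<in> L" for k unfolding Z_def by (rule L_prod(1)) (simp add: sg_mem z)
  have Z0: "Z 0 = 1" by (simp add: Z_def)
  have Zp: "Z p = 1" using z(2) by (simp add: Z_def N_def)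
  have ZS: "z * sg 1 (Z k) = Z (Suc k)" for k
  proof -
    have "sg 1 (Z k) = (\<Prod>l<k. sg 1 (sg l z))"
      unfolding Z_def by (rule L_prod(2)) (simp add: sg_mem z)
    also have "\<dots> = (\<Prod>l<k. sg (Suc l) z)" by (simp add: sg_sg z)
    finally show ?thesis
      unfolding Z_def by (subst prod.lessThan_Suc_shift) (simp add: sg_id z)
  qed
  \<comment> \<open>Some resolvent is nonzero by averaging: summing over all \<open>j\<close> leaves
    \<open>p * Z 0\<close>.\<close>
  have "\<exists>j. (\<Sum>k<p. Z k * \<zeta> ^ (j * k)) \<noteq> 0"
  proof (rule ccontr)
    assume "\<not> ?thesis"
    then have "0 = (\<Sum>j<p. \<Sum>k<p. Z k * \<zeta> ^ (j * k))" by simp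
    also have "\<dots> = (\<Sum>k<p. Z k * (\<Sum>j<p. \<zeta> ^ (j * k)))"
      by (subst sum.swap) (simp add: sum_distrib_left)
    also have "\<dots> = (\<Sum>k<p. if k = 0 then of_nat p else 0)"
      by (intro sum.cong refl) (auto simp: root_sum Z0 dest: dvd_imp_le)
    also have "\<dots> = of_nat p" by (simp add: sum.delta)
    finally show False using p_nz by simp
  qed
  then obtain j where j: "(\<Sum>k<p. Z k * \<zeta> ^ (j * k)) \<noteq> 0" by blast
  define g where "g k = Z k * (\<zeta> ^ (j * k) * \<beta> ^ j)" for k
  define y where "y = (\<Sum>k<p. g k)"
  have mon: "\<zeta> ^ (j * k) * \<beta> ^ j \<in> L" for k by (rule monom_mem) (simp add: root_mem power_mem)
  have gL: "g k \<in> L" for k unfolding g_def by (rule L_mult(1)[OF ZL mon])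
  have yL: "y \<in> L" unfolding y_def by (rule L_sum(1)) (rule gL)
  have "y = (\<Sum>k<p. Z k * \<zeta> ^ (j * k)) * \<beta> ^ j"
    by (simp add: y_def g_def sum_distrib_right mult.assoc)
  then have ynz: "y \<noteq> 0" using j \<beta>_nz by simp
  have gS: "z * sg 1 (g k) = g (Suc k)" for k
  proof -
    have "sg 1 (g k) = sg 1 (Z k) * (\<zeta> ^ (j * k) * \<zeta> ^ (j * 1) * \<beta> ^ j)"
      unfolding g_def L_mult(2)[OF ZL mon] by (subst sg_monom) (auto simp: root_mem power_mem)
    then have "z * sg 1 (g k) = z * sg 1 (Z k) * (\<zeta> ^ (j * k) * \<zeta> ^ (j * 1) * \<beta> ^ j)" by simp
    then show ?thesis unfolding ZS by (simp add: g_def power_add mult.commute mult.left_commute)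
  qed
  have "z * sg 1 y = (\<Sum>k<p. z * sg 1 (g k))"
    unfolding y_def L_sum(2)[OF gL] by (simp add: sum_distrib_left)
  also have "\<dots> = (\<Sum>k<p. g (Suc k))" unfolding gS ..
  also have "\<dots> = y"
  proof -
    have "g p = g 0" by (simp add: g_def Zp Z0 mult.commute[of j p] root_power_mult)
    moreover have "(\<Sum>k<Suc p. g k) = g 0 + (\<Sum>k<p. g (Suc k))" by (rule sum.lessThan_Suc_shift)
    moreover have "(\<Sum>k<Suc p. g k) = y + g p" by (simp add: y_def)
    ultimately show ?thesis by simp
  qed
  finally have "z = y / sg 1 y" using sg_nz[OF yL ynz] by (simp add: field_simps)
  then show ?thesis using that yL ynz by blast
qed

definition D :: "'a \<Rightarrow> 'a" where "D y = y / sg 1 y"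

lemma D_mem: "y \<in> L \<Longrightarrow> D y \<in> L"
  by (auto simp: D_def LF.divide_mem sg_mem)

lemma D_mult: "x \<in> L \<Longrightarrow> y \<in> L \<Longrightarrow> D (x * y) = D x * D y"
  by (simp add: D_def L_mult)

lemma D_K: "k \<in> K \<Longrightarrow> k \<noteq> 0 \<Longrightarrow> D k = 1"
  by (simp add: D_def sg_K)

lemma sg_power_int: "x \<in> L \<Longrightarrow> sg j (x powi k) = sg j x powi k"
  and power_int_mem: "x \<in> L \<Longrightarrow> x powi k \<in> L"
  by (auto simp: power_int_def L_power sg_inverse LF.inverse_mem)

text \<open>Binomial expansion of \<open>(1 - \<sigma>) ^ n\<close> in multiplicative notation, with
  the signed coefficients as integer exponents.\<close>

lemma Dn_formula:
  assumes y: "y \<in> L" "y \<noteq> 0"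
  shows "(D ^^ n) y = (\<Prod>k\<le>n. sg k y powi ((- 1) ^ k * int (n choose k)))"
proof (induction n)
  case 0
  show ?case by (simp add: sg_id y)
next
  case (Suc n)
  let ?e = "\<lambda>n k. (- 1) ^ k * int (n choose k)"
  have yk: "sg k y \<in> L" "sg k y \<noteq> 0" for k using sg_mem sg_nz y by auto
  have "sg 1 ((D ^^ n) y) = (\<Prod>k\<le>n. sg 1 (sg k y powi ?e n k))"
    unfolding Suc by (rule L_prod(2)) (simp add: power_int_mem yk)
  also have "\<dots> = (\<Prod>k\<le>n. sg (Suc k) y powi ?e n k)"
    by (simp add: sg_power_int yk sg_sg y)
  finally have "(D ^^ Suc n) y =
      (\<Prod>k\<le>n. sg k y powi ?e n k) / (\<Prod>k\<le>n. sg (Suc k) y powi ?e n k)"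
    by (simp add: D_def Suc)
  also have "(\<Prod>k\<le>n. sg k y powi ?e n k) = (\<Prod>k\<le>Suc n. sg k y powi ?e n k)"
    by (simp add: binomial_eq_0)
  also have "\<dots> = y * (\<Prod>k\<le>n. sg (Suc k) y powi ?e n (Suc k))"
    by (subst prod.atMost_Suc_shift) (simp add: sg_id y)
  also have "y * (\<Prod>k\<le>n. sg (Suc k) y powi ?e n (Suc k)) / (\<Prod>k\<le>n. sg (Suc k) y powi ?e n k) =
      y * (\<Prod>k\<le>n. sg (Suc k) y powi ?e n (Suc k) / sg (Suc k) y powi ?e n k)"
    by (simp only: prod_dividef times_divide_eq_right)
  also have "(\<Prod>k\<le>n. sg (Suc k) y powi ?e n (Suc k) / sg (Suc k) y powi ?e n k) =
      (\<Prod>k\<le>n. sg (Suc k) y powi ?e (Suc n) (Suc k))"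
  proof (intro prod.cong refl)
    fix k
    have "?e (Suc n) (Suc k) = ?e n (Suc k) - ?e n k" by (simp add: algebra_simps)
    then show "sg (Suc k) y powi ?e n (Suc k) / sg (Suc k) y powi ?e n k =
        sg (Suc k) y powi ?e (Suc n) (Suc k)"
      using power_int_diff[of "sg (Suc k) y" "?e n (Suc k)" "?e n k"] yk(2) by metis
  qed
  also have "y * \<dots> = (\<Prod>k\<le>Suc n. sg k y powi ?e (Suc n) k)"
    by (subst prod.atMost_Suc_shift) (simp add: sg_id y)
  finally show ?case .
qed

text \<open>In \<open>(1 - \<sigma>) ^ p\<close> the two extreme terms cancel, since
  \<open>\<sigma> ^ p\<close> is the identity and \<open>p\<close> is odd; all other coefficients
  are divisible by \<open>p\<close>.\<close>

lemma Dp_in_T: assumes y: "y \<in> L" "y \<noteq> 0" shows "(D ^^ p) y \<in> LF.T"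
proof -
  let ?e = "\<lambda>k. (- 1) ^ k * int (p choose k)"
  have split: "{..p} = insert 0 (insert p {1..<p})" using p_gt_2 by auto
  have "sg p y = y" using sg_mod[OF y(1), of p] by (simp add: sg_id y)
  have mid: "sg k y powi ?e k \<in> LF.T" if "k \<in> {1..<p}" for k
  proof -
    have "p dvd (p choose k)" using that prime_p by (intro dvd_choose_prime) auto
    then obtain m where m: "p choose k = p * m" by (auto simp: dvd_def)
    have "?e k = ((- 1) ^ k * int m) * int p" by (simp add: m)
    then have "sg k y powi ?e k = (sg k y powi ((- 1) ^ k * int m)) ^ p"
      by (simp only: power_int_mult power_int_of_nat)
    then show ?thesis
      using LF.power_in_T[OF power_int_mem[OF sg_mem[OF y(1)]], of k "(- 1) ^ k * int m"]
        sg_nz[OF y, of k] by (metis power_int_eq_0_iff)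
  qed
  have "(D ^^ p) y = y * (y powi - 1 * (\<Prod>k\<in>{1..<p}. sg k y powi ?e k))"
  proof -
    have "(D ^^ p) y = (\<Prod>k\<in>insert 0 (insert p {1..<p}). sg k y powi ?e k)"
      unfolding Dn_formula[OF y] split ..
    also have "\<dots> = sg 0 y powi ?e 0 * (sg p y powi ?e p * (\<Prod>k\<in>{1..<p}. sg k y powi ?e k))"
      using p_gt_2 by (subst prod.insert; simp)+
    finally show ?thesis using odd_p by (simp add: \<open>sg p y = y\<close> sg_id y)
  qed
  also have "\<dots> = (\<Prod>k\<in>{1..<p}. sg k y powi ?e k)" using y by (simp add: power_int_minus)
  also have "\<dots> \<in> LF.T"
  proof -
    have *: "prod f A \<in> LF.T" if "\<And>k. k \<in> A \<Longrightarrow> f k \<in> LF.T" for f and A :: "nat set"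
      using that by (induction A rule: infinite_finite_induct) (auto intro: LF.T_mult)
    show ?thesis by (rule *) (rule mid)
  qed
  finally show ?thesis .
qed

text \<open>By Hilbert 90 the quotient of \<open>L*\<close> by \<open>p\<close>-th powers, \<open>\<beta>\<close> and \<open>K*\<close> equals its own image under
  \<open>1 - \<sigma>\<close>, and \<open>1 - \<sigma>\<close> is nilpotent modulo \<open>p\<close>-th powers.\<close>

lemma class_decomposition:
  assumes norms: "\<And>x. x \<in> L \<Longrightarrow> x \<noteq> 0 \<Longrightarrow> N x \<in> pspan b"
    and x: "x \<in> L" "x \<noteq> 0"
  obtains i f e where "f \<in> K" "f \<noteq> 0" "e \<in> L" "e \<noteq> 0" "x = \<beta> ^ i * f * e ^ p"
proof -
  have step: "\<exists>k t y. t \<in> K \<and> t \<noteq> 0 \<and> y \<in> L \<and> y \<noteq> 0 \<and> x = \<beta> ^ k * t * D y"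
    if x: "x \<in> L" "x \<noteq> 0" for x
  proof -
    obtain k t where kt: "N x = b ^ k * t ^ p" "t \<in> K" "t \<noteq> 0"
      using norms[OF x] by (auto simp: pspan_def pth_powers_def)
    define w where "w = \<beta> ^ k * t"
    have w: "w \<in> L" "w \<noteq> 0"
      using kt \<beta>_nz monom_mem[of t k] by (auto simp: w_def mult.commute)
    have "N w = N x"
      unfolding w_def kt(1) using kt by (simp add: N_mult L_power \<beta>_mem K_subset_L N_power N_\<beta> N_K)
    moreover have "x = w * (x / w)" using w by simp
    ultimately have "N (x / w) = 1"
      using N_mult[OF w(1) LF.divide_mem[OF x(1) w(1)]] N_nz[OF w] by simp
    then obtain y where "y \<in> L" "y \<noteq> 0" "x / w = D y"
      using hilbert90[of "x / w"] LF.divide_mem[OF x(1) w(1)] unfolding D_def by blast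
    moreover from this have "x = \<beta> ^ k * t * D y" using w by (simp add: w_def field_simps)
    ultimately show ?thesis using kt by blast
  qed
  have Dz: "(D ^^ n) (\<zeta> ^ s * w) = (if n = 0 then \<zeta> ^ s else 1) * (D ^^ n) w" if "w \<in> L" for n s w
  proof (cases n)
    case (Suc m)
    have "D (\<zeta> ^ s * w) = D w"
      using that root_nz by (subst D_mult) (auto simp: D_K K_subset_L root_mem power_mem)
    then show ?thesis using Suc by (simp add: funpow_Suc_right del: funpow.simps)
  qed simp
  have D\<beta>: "D (\<beta> ^ k * t) = \<zeta> ^ ((p - 1) * k)" if "t \<in> K" "t \<noteq> 0" for k t
  proof -
    have "\<zeta> ^ ((p - 1) * k) * \<zeta> ^ k = 1"
    proof -
      have "(p - 1) * k + k = p * k" using p_pos by (cases p) auto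
      then show ?thesis by (simp add: power_add[symmetric] root_power_mult)
    qed
    moreover have "D (\<beta> ^ k * t) = inverse (\<zeta> ^ k)"
      unfolding D_def using that sg_monom[of t 1 k] \<beta>_nz root_nz by (simp add: mult.commute field_simps)
    ultimately show ?thesis using inverse_unique[of "\<zeta> ^ k" "\<zeta> ^ ((p - 1) * k)"]
      by (simp add: mult.commute)
  qed
  \<comment> \<open>Each round writes \<open>y\<close> as \<open>D y'\<close> times a power of
    \<open>\<beta>\<close> and an element of \<open>K\<close>. One \<open>D\<close> turns these
    extra factors into a power of \<open>\<zeta>\<close> and a second \<open>D\<close> kills it, so
    only the round \<open>n = 0\<close> contributes a root of unity.\<close>
  have iter: "\<exists>r y. y \<in> L \<and> y \<noteq> 0 \<and> D x = \<zeta> ^ r * (D ^^ Suc n) y" if "x \<in> L" "x \<noteq> 0" for x n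
  proof (induction n)
    case 0
    show ?case using that by (intro exI[of _ 0] exI[of _ x]) auto
  next
    case (Suc n)
    then obtain r y where y: "y \<in> L" "y \<noteq> 0" "D x = \<zeta> ^ r * (D ^^ Suc n) y" by blast
    obtain k t y' where y': "t \<in> K" "t \<noteq> 0" "y' \<in> L" "y' \<noteq> 0" "y = \<beta> ^ k * t * D y'"
      using step[OF y(1,2)] by blast
    have "D y = \<zeta> ^ ((p - 1) * k) * D (D y')"
      unfolding y'(5) D\<beta>[OF y'(1,2), symmetric] using y' monom_mem[of t k]
      by (intro D_mult) (auto simp: D_mem mult.commute)
    then have "(D ^^ Suc n) y = (D ^^ n) (\<zeta> ^ ((p - 1) * k) * D (D y'))"
      by (simp add: funpow_Suc_right del: funpow.simps)
    also have "\<dots> = (if n = 0 then \<zeta> ^ ((p - 1) * k) else 1) * (D ^^ n) (D (D y'))"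
      by (rule Dz) (simp add: D_mem y')
    also have "(D ^^ n) (D (D y')) = (D ^^ Suc (Suc n)) y'"
      by (simp add: funpow_Suc_right del: funpow.simps)
    finally have "D x = \<zeta> ^ (r + (if n = 0 then (p - 1) * k else 0)) * (D ^^ Suc (Suc n)) y'"
      using y(3) by (auto simp: power_add)
    then show ?case using y' by blast
  qed
  obtain k t y where y: "t \<in> K" "t \<noteq> 0" "y \<in> L" "y \<noteq> 0" "x = \<beta> ^ k * t * D y"
    using step[OF x] by blast
  obtain r y' where y': "y' \<in> L" "y' \<noteq> 0" "D y = \<zeta> ^ r * (D ^^ Suc (p - 1)) y'"
    using iter[OF y(3,4)] by blast
  have "(D ^^ p) y' \<in> LF.T" by (rule Dp_in_T[OF y'(1,2)])
  then obtain e where e: "(D ^^ p) y' = e ^ p" "e \<in> L" "e \<noteq> 0" by (auto simp: pth_powers_def)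
  have "x = \<beta> ^ k * (t * \<zeta> ^ r) * e ^ p" using y(5) y'(3) e(1) p_pos by simp
  then show ?thesis using that[of "t * \<zeta> ^ r" e k] y e root_nz root_mem by auto
qed

end

section \<open>Extending the valuation to a Kummer extension\<close>

lemma (in root_field) p_nonzero [simp]: "p \<noteq> 0"
  using p_pos by simp

locale root_val = root_field K p \<zeta> + val_ring K V for K :: "'a::field set" and p \<zeta> V +
  assumes one_plus_M_T: "x \<in> M \<Longrightarrow> 1 + x \<in> T"
begin

text \<open>With \<open>l = 1 - \<zeta>\<close>, \<open>p\<close> is \<open>l ^ (p - 1)\<close> up
  to a unit, and a \<open>p\<close>-th root \<open>1 + r\<close> of \<open>1 + l\<close> exhibits
  \<open>l\<close> as \<open>r ^ p\<close> up to a unit. For a unit \<open>a\<close>, the root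
  \<open>1 + s\<close> of \<open>1 + a * r ^ p\<close> then gives
  \<open>(s / r) ^ p = a * (1 - m)\<close> with \<open>m\<close> in \<open>M\<close>. The lemma is
  applied contrapositively: a unit outside \<open>T\<close> makes \<open>p\<close> a unit.\<close>

lemma U_subset_T_if_residue_char:
  assumes pM: "of_nat p \<in> M"
  shows "U \<subseteq> T"
proof -
  define \<rho> where "\<rho> r = (\<Sum>k\<in>{2..<p}. of_nat ((p choose k) div p) * r ^ (k - 2))" for r :: 'a
  have \<rho>V: "\<rho> r \<in> V" if "r \<in> V" for r
    unfolding \<rho>_def using that by (intro V_sum V_mult V_of_nat V_power)
  have bin: "(1 + r) ^ p = 1 + r ^ p + of_nat p * r * (1 + r * \<rho> r)" for r
    unfolding \<rho>_def by (rule binomial_prime[OF prime_p p_gt_2])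
  define l where "l = 1 - \<zeta>"
  have "\<zeta> \<in> U" using U_root[of \<zeta> p] root_mem root_power by simp
  then have lV: "l \<in> V" unfolding l_def using U_subset_V V_diff by auto
  have l_nz: "l \<noteq> 0" using root_primitive[rule_format, of 1] p_gt_2 by (auto simp: l_def)
  \<comment> \<open>Expansion of \<open>(1 - l) ^ p = \<zeta> ^ p = 1\<close>; cancelling a factor
    \<open>l\<close> expresses \<open>l ^ (p - 1)\<close> through \<open>p\<close>.\<close>
  have "1 = 1 - l ^ p - of_nat p * l * (1 - l * \<rho> (- l))"
  proof -
    have "1 + - l = \<zeta>" by (simp add: l_def)
    then have "1 = 1 + (- l) ^ p + of_nat p * (- l) * (1 + (- l) * \<rho> (- l))"
      using bin[of "- l"] root_power by simp
    then show ?thesis using odd_p by simp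
  qed
  then have "l ^ p = l * (- of_nat p * (1 - l * \<rho> (- l)))" by (simp add: algebra_simps)
  moreover have "l ^ p = l * l ^ (p - 1)" using power_Suc[of l "p - 1"] p_pos by simp
  ultimately have "l * l ^ (p - 1) = l * (- of_nat p * (1 - l * \<rho> (- l)))" by metis
  then have lp: "l ^ (p - 1) = - of_nat p * (1 - l * \<rho> (- l))"
    using l_nz by (simp only: mult_cancel_left) simp
  have \<rho>l: "1 - l * \<rho> (- l) \<in> V"
    using lV by (intro V_diff V_mult \<rho>V V_uminus) auto
  have "l ^ (p - 1) \<in> M" unfolding lp by (rule M_mult_V[OF M_uminus[OF pM] \<rho>l])
  then have lM: "l \<in> M" using M_root lV by blast
  have eU: "1 - l * \<rho> (- l) \<in> U"
    using one_plus_M[OF M_uminus[OF M_mult_V[OF lM \<rho>V[OF V_uminus[OF lV]]]]] by simp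
  \<comment> \<open>This is \<open>p / l\<close>. It lies in \<open>M\<close> because
    \<open>p - 2 > 0\<close> leaves another factor \<open>l\<close>.\<close>
  define \<mu> where "\<mu> = - (l ^ (p - 2)) * inverse (1 - l * \<rho> (- l))"
  have "l ^ (p - 2) \<in> M"
  proof -
    obtain n where "p - 2 = Suc n" using p_gt_2 by (cases "p - 2") auto
    then show ?thesis using M_mult_V[OF lM V_power[OF lV, of n]] by simp
  qed
  then have \<mu>M: "\<mu> \<in> M"
    unfolding \<mu>_def using eU by (intro M_mult_V M_uminus) (auto simp: U_def)
  have "l ^ (p - 1) = l * l ^ (p - 2)" using p_gt_2 power_Suc[of l "p - 2"] by (simp add: Suc_diff_Suc numeral_2_eq_2)
  then have "of_nat p = l * (- (l ^ (p - 2))) * inverse (1 - l * \<rho> (- l))"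
    using lp U_nz[OF eU] by (simp add: field_simps)
  then have p_eq: "of_nat p = l * \<mu>" by (simp add: \<mu>_def)
  have root: "\<exists>w\<in>V. 1 + x = (1 + w) ^ p" if "x \<in> M" for x
  proof -
    have "1 + x \<in> T" by (rule one_plus_M_T[OF that])
    then obtain w where w: "1 + x = w ^ p" "w \<in> K" by (auto simp: pth_powers_def)
    have "w ^ p \<in> V" using one_plus_M[OF that] U_subset_V w(1) by auto
    then have "w - 1 \<in> V" using V_root[OF w(2) p_pos] by (simp add: V_diff)
    then show ?thesis using w(1) by (intro bexI[of _ "w - 1"]) auto
  qed
  obtain r where r: "r \<in> V" "1 + l = (1 + r) ^ p" using root[OF lM] by blast
  define \<epsilon> where "\<epsilon> = 1 - \<mu> * (r * (1 + r * \<rho> r))"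
  have \<epsilon>U: "\<epsilon> \<in> U"
  proof -
    have "\<mu> * (r * (1 + r * \<rho> r)) \<in> M" using r \<mu>M by (intro M_mult_V V_mult V_add \<rho>V) auto
    then show ?thesis using one_plus_M[OF M_uminus] by (simp add: \<epsilon>_def)
  qed
  have rp: "r ^ p = l * \<epsilon>"
    using r(2) bin[of r] unfolding p_eq \<epsilon>_def by (simp add: algebra_simps)
  then have r_nz: "r \<noteq> 0" using l_nz U_nz[OF \<epsilon>U] p_pos by (auto simp: power_0_left)
  have rM: "r ^ p \<in> M" unfolding rp using M_mult_V[OF lM] \<epsilon>U U_subset_V by auto
  define \<mu>' where "\<mu>' = \<mu> * inverse \<epsilon>"
  have \<mu>'M: "\<mu>' \<in> M" unfolding \<mu>'_def using \<mu>M \<epsilon>U by (intro M_mult_V) (auto simp: U_def)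
  \<comment> \<open>\<open>p\<close> is \<open>r ^ p\<close> times an element of \<open>M\<close>,
    so the binomial error terms are negligible against \<open>a * r ^ p\<close>.\<close>
  have p_eq': "of_nat p = r ^ p * \<mu>'" unfolding rp \<mu>'_def p_eq using U_nz[OF \<epsilon>U] by simp
  show ?thesis
  proof
    fix a assume a: "a \<in> U"
    then have aV: "a \<in> V" using U_subset_V by auto
    obtain s where s: "s \<in> V" "1 + a * r ^ p = (1 + s) ^ p" using root[OF V_mult_M[OF aV rM]] by blast
    define m where "m = inverse a * (\<mu>' * (s * (1 + s * \<rho> s)))"
    have mM: "m \<in> M" unfolding m_def
      using a s \<mu>'M by (intro V_mult_M M_mult_V V_mult V_add \<rho>V) (auto simp: U_def)
    have "a * r ^ p = s ^ p + r ^ p * \<mu>' * s * (1 + s * \<rho> s)"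
      using s(2) bin[of s] unfolding p_eq' by (simp add: algebra_simps)
    then have "s ^ p = r ^ p * (a - \<mu>' * (s * (1 + s * \<rho> s)))" by (simp add: algebra_simps)
    also have "a - \<mu>' * (s * (1 + s * \<rho> s)) = a * (1 + - m)"
      unfolding m_def using U_nz[OF a] by (simp add: field_simps)
    finally have "(s / r) ^ p = a * (1 + - m)" using r_nz by (simp add: power_divide)
    moreover have "a * (1 + - m) \<noteq> 0"
      using U_nz[OF a] U_nz[OF one_plus_M[OF M_uminus[OF mM]]] by simp
    moreover have "s / r \<in> K" using s r V_subset by auto
    moreover have "s / r \<noteq> 0" using calculation by (auto simp: power_0_left)
    ultimately have "a * (1 + - m) \<in> T" using power_in_T[of "s / r"] by simp
    then show "a \<in> T" using T_mult_right_iff[OF one_plus_M_T[OF M_uminus[OF mM]]] by simp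
  qed
qed

lemma ex_dominant:
  assumes "finite S" "S \<noteq> {}" "\<And>i. i \<in> S \<Longrightarrow> g i \<in> K \<and> g i \<noteq> 0"
  shows "\<exists>k\<in>S. \<forall>i\<in>S. g i / g k \<in> V"
  using assms
proof (induction S rule: finite_ne_induct)
  case (insert x F)
  then obtain k where k: "k \<in> F" "\<forall>i\<in>F. g i / g k \<in> V" by auto
  have kx: "g k \<in> K" "g k \<noteq> 0" "g x \<in> K" "g x \<noteq> 0" using insert k by auto
  then have "g x / g k \<in> V \<or> inverse (g x / g k) \<in> V" by (intro V_total) auto
  then show ?case
  proof
    assume "g x / g k \<in> V"
    then show ?thesis using k by (intro bexI[of _ k]) auto
  next
    assume *: "inverse (g x / g k) \<in> V"
    have "g i / g x \<in> V" if "i \<in> F" for i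
      using V_mult[OF k(2)[rule_format, OF that] *] kx by simp
    then show ?thesis using kx by (intro bexI[of _ x]) auto
  qed
qed auto

end

locale kummer_val = kummer K p \<zeta> b \<beta> + root_val K p \<zeta> V for K :: "'a::field set" and p \<zeta> b \<beta> V +
  assumes b_notin_T: "b \<notin> T"
begin

text \<open>The extension of \<open>I\<close>, where \<open>\<beta>\<close> is given \<open>1/p\<close> times the value of \<open>b\<close> and distinct
  monomials do not interfere.\<close>

definition ext :: "'a set \<Rightarrow> 'a set" where
  "ext I = {x \<in> L. \<forall>i<p. coord x i ^ p * b ^ i \<in> I}"

abbreviation VE :: "'a set" where "VE \<equiv> ext V"
abbreviation ME :: "'a set" where "ME \<equiv> ext M"

lemma coord_add: "x \<in> L \<Longrightarrow> y \<in> L \<Longrightarrow> i < p \<Longrightarrow> coord (x + y) i = coord x i + coord y i"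
proof -
  assume a: "x \<in> L" "y \<in> L" "i < p"
  have "coord (ev (\<lambda>i. coord x i + coord y i)) i = coord x i + coord y i"
    by (rule coord_ev) (use coord(1) a in auto)
  then show ?thesis unfolding ev_add[symmetric] coord(2)[OF a(1)] coord(2)[OF a(2)] .
qed

lemma coord_monom:
  "k \<in> K \<Longrightarrow> i < p \<Longrightarrow> coord (k * \<beta> ^ n) i = (if i = n mod p then k * b ^ (n div p) else 0)"
  unfolding monom_eq_ev by (rule coord_ev) (auto simp: b_mem power_mem mult_mem)

lemma coord_K: "k \<in> K \<Longrightarrow> i < p \<Longrightarrow> coord k i = (if i = 0 then k else 0)"
  using coord_monom[of k i 0] by simp

lemma coord_sg: "x \<in> L \<Longrightarrow> i < p \<Longrightarrow> coord (sg j x) i = coord x i * \<zeta> ^ (i * j)"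
  unfolding sg_def by (rule coord_ev) (auto simp: coord(1) root_mem power_mem mult_mem)

lemma expand: "x \<in> L \<Longrightarrow> x = (\<Sum>i<p. coord x i * \<beta> ^ i)"
  using coord(2)[of x] by (simp add: ev_def)

text \<open>What \<open>V\<close> and \<open>M\<close> share, so that the ring laws of
  \<open>VE\<close> and the ideal laws of \<open>ME\<close> come from the same proofs.\<close>

definition ideal_like :: "'a set \<Rightarrow> bool" where
  "ideal_like I \<longleftrightarrow> 0 \<in> I \<and> (\<forall>v\<in>V. \<forall>x\<in>I. v * x \<in> I)"

lemma ideal_like_V: "ideal_like V" and ideal_like_M: "ideal_like M"
  by (auto simp: ideal_like_def V_mult V_mult_M)

lemma ext_subset: "ext I \<subseteq> L" by (auto simp: ext_def)

lemma ME_subset_VE: "ME \<subseteq> VE" using M_subset_V by (auto simp: ext_def)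

text \<open>Of two coordinates one is a \<open>V\<close>-multiple of the other. With
  \<open>s = v * t\<close>, \<open>(s + t) ^ p * z\<close> is \<open>(v + 1) ^ p\<close> times
  \<open>t ^ p * z\<close>, so the power of the sum is never expanded.\<close>

lemma ext_add: assumes I: "ideal_like I" and x: "x \<in> ext I" and y: "y \<in> ext I"
  shows "x + y \<in> ext I"
proof -
  have xy: "x \<in> L" "y \<in> L" using x y by (auto simp: ext_def)
  have "(s + t) ^ p * z \<in> I" if st: "s \<in> K" "t \<in> K" "s ^ p * z \<in> I" "t ^ p * z \<in> I" for s t z
  proof -
    consider v where "v \<in> V" "s = v * t" | v where "v \<in> V" "t = v * s" using V_ratio[OF st(1,2)] by blast
    then show ?thesis
    proof cases
      case 1
      then have "s + t = (v + 1) * t" by (simp add: algebra_simps)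
      then have "(s + t) ^ p * z = (v + 1) ^ p * (t ^ p * z)" by (simp add: power_mult_distrib)
      moreover have "(v + 1) ^ p * (t ^ p * z) \<in> I"
        using I st(4) V_power[OF V_add[OF 1(1) V_one]] unfolding ideal_like_def by blast
      ultimately show ?thesis by metis
    next
      case 2
      then have "s + t = (v + 1) * s" by (simp add: algebra_simps)
      then have "(s + t) ^ p * z = (v + 1) ^ p * (s ^ p * z)" by (simp add: power_mult_distrib)
      moreover have "(v + 1) ^ p * (s ^ p * z) \<in> I"
        using I st(3) V_power[OF V_add[OF 2(1) V_one]] unfolding ideal_like_def by blast
      ultimately show ?thesis by metis
    qed
  qed
  then show ?thesis
    using x y xy coord(1) unfolding ext_def by (auto simp: L_add(1) coord_add)
qed

lemma ext_zero: "ideal_like I \<Longrightarrow> 0 \<in> ext I"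
  unfolding ext_def using coord_K[of 0] K_subset_L by (auto simp: ideal_like_def power_0_left)

lemma ext_sum: "ideal_like I \<Longrightarrow> (\<And>i. i \<in> A \<Longrightarrow> f i \<in> ext I) \<Longrightarrow> sum f A \<in> ext I"
  by (induction A rule: infinite_finite_induct) (auto simp: ext_add ext_zero)

text \<open>Trading \<open>\<beta> ^ p\<close> for \<open>b\<close> does not change the test value
  \<open>k ^ p * b ^ n\<close>, so exponents from \<open>p\<close> on obey the same criterion;
  products of monomials rely on this.\<close>

lemma ext_monom:
  assumes I: "ideal_like I" and k: "k \<in> K" "k ^ p * b ^ n \<in> I"
  shows "k * \<beta> ^ n \<in> ext I"
proof -
  have "(k * b ^ (n div p)) ^ p * b ^ (n mod p) = k ^ p * b ^ (p * (n div p) + n mod p)"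
    by (simp only: power_mult_distrib power_mult[symmetric] power_add mult.assoc mult.commute[of p])
  then have "(k * b ^ (n div p)) ^ p * b ^ (n mod p) \<in> I" using k by simp
  then show ?thesis
    unfolding ext_def using k I by (auto simp: monom_mem coord_monom ideal_like_def power_0_left)
qed

lemma ext_mult:
  assumes I: "ideal_like I" and x: "x \<in> VE" and y: "y \<in> ext I"
  shows "x * y \<in> ext I"
proof -
  have xy: "x \<in> L" "y \<in> L" using x y by (auto simp: ext_def)
  have "x * y = (\<Sum>i<p. \<Sum>k<p. (coord x i * coord y k) * \<beta> ^ (i + k))"
    by (subst expand[OF xy(1)], subst expand[OF xy(2)], unfold sum_product)
      (simp add: power_add mult_ac)
  moreover have "(coord x i * coord y k) * \<beta> ^ (i + k) \<in> ext I" if "i < p" "k < p" for i k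
  proof (rule ext_monom[OF I])
    show "coord x i * coord y k \<in> K" using that xy coord(1) by auto
    have "(coord x i * coord y k) ^ p * b ^ (i + k) =
        (coord x i ^ p * b ^ i) * (coord y k ^ p * b ^ k)"
      by (simp add: power_mult_distrib power_add mult_ac)
    then show "(coord x i * coord y k) ^ p * b ^ (i + k) \<in> I"
      using I x y that by (simp add: ideal_like_def ext_def)
  qed
  ultimately show ?thesis using I by (auto intro!: ext_sum)
qed

lemmas VE_add = ext_add[OF ideal_like_V] and ME_add = ext_add[OF ideal_like_M]
  and VE_sum = ext_sum[OF ideal_like_V] and ME_sum = ext_sum[OF ideal_like_M]
  and VE_mult = ext_mult[OF ideal_like_V] and ME_mult = ext_mult[OF ideal_like_M]

lemma ME_mult_right: "x \<in> ME \<Longrightarrow> y \<in> VE \<Longrightarrow> x * y \<in> ME"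
  using ME_mult[of y x] by (simp add: mult.commute)

lemma V_in_VE: "k \<in> V \<Longrightarrow> k \<in> VE"
  using ext_monom[OF ideal_like_V, of k 0] V_subset by (auto simp: V_power)

lemma M_in_ME: "k \<in> M \<Longrightarrow> k \<in> ME"
proof -
  assume k: "k \<in> M"
  have "k ^ p = k * k ^ (p - 1)" using power_Suc[of k "p - 1"] p_pos by simp
  then have "k ^ p \<in> M" using M_mult_V[OF k] V_power M_subset_V k by auto
  then show ?thesis using ext_monom[OF ideal_like_M, of k 0] M_memD[OF k] by simp
qed

lemma K_ext: "k \<in> K \<Longrightarrow> k \<in> ext I \<Longrightarrow> k ^ p \<in> I"
  using coord_K[of k 0] p_pos unfolding ext_def by (auto dest!: spec[of _ 0])

lemma K_VE: "k \<in> K \<Longrightarrow> k \<in> VE \<Longrightarrow> k \<in> V"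
  using K_ext[of k V] V_root[of k p] p_pos by auto

lemma K_ME: "k \<in> K \<Longrightarrow> k \<in> ME \<Longrightarrow> k \<in> M"
  using K_ext[of k M] K_VE[of k] ME_subset_VE M_root[of k p] by auto

lemma VE_one: "1 \<in> VE" by (simp add: V_in_VE)

lemma VE_uminus: "x \<in> VE \<Longrightarrow> - x \<in> VE" and ME_uminus: "x \<in> ME \<Longrightarrow> - x \<in> ME"
  using VE_mult[of "-1" x] ME_mult[of "-1" x] V_in_VE[of "-1"] V_uminus[OF V_one] by auto

lemma ME_diff: "x \<in> ME \<Longrightarrow> y \<in> ME \<Longrightarrow> x - y \<in> ME"
  using ME_add[of x "-y"] ME_uminus by auto

lemma VE_prod: "(\<And>i. i \<in> A \<Longrightarrow> f i \<in> VE) \<Longrightarrow> prod f A \<in> VE"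
  by (induction A rule: infinite_finite_induct) (auto simp: VE_mult VE_one)

lemma VE_power: "x \<in> VE \<Longrightarrow> x ^ n \<in> VE"
  by (induction n) (auto simp: VE_mult VE_one)

lemma ext_sg: "x \<in> ext I \<Longrightarrow> sg j x \<in> ext I"
proof -
  assume x: "x \<in> ext I"
  then have xL: "x \<in> L" by (simp add: ext_def)
  have "(\<zeta> ^ (i * j)) ^ p = 1" for i
    using root_power_mult[of "i * j"] by (simp add: power_mult[symmetric] mult.commute)
  then show ?thesis
    using x xL unfolding ext_def by (auto simp: sg_mem coord_sg power_mult_distrib)
qed

lemma N_VE: "x \<in> VE \<Longrightarrow> N x \<in> V"
  using K_VE[OF N_mem] VE_prod[of "{..<p}" "\<lambda>j. sg j x"] ext_subset ext_sg
  by (auto simp: N_def)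

lemma one_notin_ME: "1 \<notin> ME"
  using K_ME[of 1] not_M_and_U[of 1] by auto

lemma N_one_plus_ME:
  assumes "\<mu> \<in> ME"
  shows "N (1 + \<mu>) - 1 \<in> M"
proof -
  have "(\<Prod>j<n. 1 + sg j \<mu>) - 1 \<in> ME" for n
  proof (induction n)
    case 0
    then show ?case by (simp add: ext_zero[OF ideal_like_M])
  next
    case (Suc n)
    let ?P = "\<Prod>j<n. 1 + sg j \<mu>"
    have "?P \<in> VE"
      by (intro VE_prod VE_add VE_one) (use ext_sg[OF assms] ME_subset_VE in auto)
    then have "(?P - 1) + ?P * sg n \<mu> \<in> ME"
      by (intro ME_add[OF Suc] ME_mult ext_sg[OF assms])
    then show ?case by (simp add: algebra_simps)
  qed
  moreover have "1 + \<mu> \<in> L" "\<mu> \<in> L" using assms ext_subset L_add(1) K_subset_L[OF one_mem] by auto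
  moreover from this have "N (1 + \<mu>) = (\<Prod>j<p. 1 + sg j \<mu>)"
    by (simp add: N_def L_add(2) K_subset_L sg_1)
  ultimately show ?thesis using N_mem[of "1 + \<mu>"] by (intro K_ME) auto
qed

lemma inverse_in_VE:
  assumes "w \<in> VE" "N w \<in> U"
  shows "inverse w \<in> VE"
proof -
  have wL: "w \<in> L" using assms ext_subset by auto
  have "w \<noteq> 0" using assms(2) U_nz N_K[of 0] p_pos by (auto simp: power_0_left)
  moreover have "conj_prod w \<in> VE" unfolding conj_prod_def by (intro VE_prod ext_sg assms)
  moreover have "inverse (N w) \<in> VE" using assms(2) by (intro V_in_VE) (auto simp: U_def)
  ultimately show ?thesis using inverse_eq_conj_prod[OF wL] VE_mult by simp
qed

lemma inverse_one_plus_ME: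
  assumes "\<mu> \<in> ME"
  shows "1 + \<mu> \<noteq> 0" "1 + \<mu> \<in> VE" "inverse (1 + \<mu>) \<in> VE"
proof -
  show v: "1 + \<mu> \<in> VE" using assms VE_add[OF VE_one] ME_subset_VE by auto
  have "N (1 + \<mu>) \<in> U" using one_plus_M[OF N_one_plus_ME[OF assms]] by simp
  then show "inverse (1 + \<mu>) \<in> VE" by (rule inverse_in_VE[OF v])
  show "1 + \<mu> \<noteq> 0"
    using one_notin_ME ME_uminus[OF assms] by (metis add_eq_0_iff2 minus_minus add.inverse_inverse neg_eq_iff_add_eq_0)
qed

subsection \<open>The totally ramified case\<close>

text \<open>\<open>ram\<close> says that the value of \<open>b\<close> is nonzero modulo
  \<open>p\<close> times the value group; Bezout carries this to every multiple by an
  \<open>n\<close> prime to \<open>p\<close>.\<close>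

lemma ramified_power:
  assumes ram: "\<And>y. y \<in> K \<Longrightarrow> b * y ^ p \<notin> U" and y: "y \<in> K" and n: "\<not> p dvd n"
  shows "b ^ n * y ^ p \<notin> U"
proof
  assume u: "b ^ n * y ^ p \<in> U"
  have "n \<noteq> 0" using n by (cases n) auto
  moreover have "gcd n p = 1"
    using prime_p n prime_imp_coprime[of p n] by (simp add: coprime_iff_gcd_eq_1 gcd.commute)
  ultimately obtain s t where st: "n * s = p * t + 1" using bezout_nat[of n p] by auto
  have "(b ^ n * y ^ p) ^ s = b ^ (n * s) * (y ^ s) ^ p"
    by (simp add: power_mult_distrib power_mult[symmetric] mult.commute)
  also have "\<dots> = b * (b ^ t * y ^ s) ^ p"
    unfolding st by (simp add: power_mult_distrib power_mult[symmetric] mult.commute power_add mult_ac)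
  finally have "b * (b ^ t * y ^ s) ^ p \<in> U" using U_power[OF u, of s] by simp
  then show False using ram[of "b ^ t * y ^ s"] y b_mem by auto
qed

text \<open>The values of the nonzero \<open>g i\<close> are distinct modulo \<open>p\<close> times
  the value group, so a dominant monomial is strictly dominant and can be factored out.\<close>

lemma ramified_leading_term:
  assumes ram: "\<And>y. y \<in> K \<Longrightarrow> b * y ^ p \<notin> U" and x: "x \<in> L" "x \<noteq> 0"
  obtains c k \<mu> where "c \<in> K" "c \<noteq> 0" "k < p" "\<mu> \<in> ME" "x = c * \<beta> ^ k * (1 + \<mu>)"
proof -
  let ?c = "coord x"
  define g where "g i = ?c i ^ p * b ^ i" for i
  define S where "S = {i. i < p \<and> ?c i \<noteq> 0}"
  have "S \<noteq> {}"
  proof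
    assume "S = {}"
    then have "(\<Sum>i<p. ?c i * \<beta> ^ i) = 0" by (intro sum.neutral) (auto simp: S_def)
    then show False using expand[OF x(1)] x(2) by simp
  qed
  moreover have "finite S" by (simp add: S_def)
  moreover have "g i \<in> K \<and> g i \<noteq> 0" if "i \<in> S" for i
    using that coord(1)[OF x(1)] b_mem b_nz by (auto simp: g_def S_def)
  ultimately obtain k where k: "k \<in> S" "\<forall>i\<in>S. g i / g k \<in> V" using ex_dominant[of S g] by auto
  have kp: "k < p" and ck: "?c k \<noteq> 0" "?c k \<in> K" using k(1) coord(1)[OF x(1)] by (auto simp: S_def)
  \<comment> \<open>\<open>h i * \<beta> ^ (i + p - k)\<close> is the \<open>i\<close>-th monomial
    divided by the \<open>k\<close>-th; the \<open>b\<close> in the denominator pays for the shift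
    by \<open>p\<close> that keeps the exponent natural.\<close>
  define h where "h i = ?c i / (?c k * b)" for i
  have hK: "h i \<in> K" if "i < p" for i
    unfolding h_def using that coord(1)[OF x(1)] ck b_mem by auto
  have hg: "h i ^ p * b ^ (i + p - k) = g i / g k" for i
  proof -
    have "b ^ (i + p - k) * b ^ k = b ^ i * b ^ p" using kp by (simp add: power_add[symmetric])
    then have "b ^ (i + p - k) = b ^ i * b ^ p / b ^ k" using b_nz by (simp add: field_simps)
    then show ?thesis using b_nz ck by (simp add: h_def g_def power_divide power_mult_distrib field_simps)
  qed
  have "h i * \<beta> ^ (i + p - k) \<in> ME" if i: "i < p" "i \<noteq> k" for i
  proof (rule ext_monom[OF ideal_like_M hK[OF i(1)]])
    show "h i ^ p * b ^ (i + p - k) \<in> M"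
    proof (cases "?c i = 0")
      case True
      then show ?thesis using p_pos by (simp add: h_def power_0_left)
    next
      case False
      then have v: "h i ^ p * b ^ (i + p - k) \<in> V" unfolding hg using k(2) i by (simp add: S_def)
      have "\<not> p dvd i + p - k"
      proof
        assume "p dvd i + p - k"
        then obtain q where q: "i + p - k = p * q" by (auto simp: dvd_def)
        have "0 < p * q" "p * q < p * 2" unfolding q[symmetric] using i kp by auto
        then have "q = 1" by (cases q) auto
        then show False using q i kp by simp
      qed
      then have "h i ^ p * b ^ (i + p - k) \<notin> U"
        using ramified_power[OF ram hK[OF i(1)], of "i + p - k"] by (simp add: mult.commute)
      then show ?thesis using V_cases[OF v] by blast
    qed
  qed
  then have mu: "(\<Sum>i\<in>{..<p} - {k}. h i * \<beta> ^ (i + p - k)) \<in> ME" (is "?\<mu> \<in> _")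
    by (intro ME_sum) auto
  have "?c k * \<beta> ^ k * (h i * \<beta> ^ (i + p - k)) = ?c i * \<beta> ^ i" for i
  proof -
    have "\<beta> ^ k * \<beta> ^ (i + p - k) = \<beta> ^ i * b"
      using kp by (simp add: power_add[symmetric] \<beta>_power[symmetric])
    then have "?c k * \<beta> ^ k * (h i * \<beta> ^ (i + p - k)) = ?c k * h i * (\<beta> ^ i * b)" by (simp add: mult_ac)
    then show ?thesis using ck b_nz by (simp add: h_def)
  qed
  then have "?c k * \<beta> ^ k * (1 + ?\<mu>) = ?c k * \<beta> ^ k + (\<Sum>i\<in>{..<p} - {k}. ?c i * \<beta> ^ i)"
    by (simp add: distrib_left sum_distrib_left)
  also have "\<dots> = x"
    using expand[OF x(1)] sum.remove[of "{..<p}" k "\<lambda>i. ?c i * \<beta> ^ i"] kp by simp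
  finally show ?thesis using that[of "?c k" k ?\<mu>] ck kp mu by simp
qed

subsection \<open>The unramified case\<close>

lemma twisted_trace:
  assumes "x \<in> L"
  shows "(\<Sum>j<p. \<zeta> ^ (j * m) * sg j x) = (\<Sum>i<p. if p dvd m + i then of_nat p * coord x i * \<beta> ^ i else 0)"
proof -
  have "(\<Sum>j<p. \<zeta> ^ (j * m) * sg j x) = (\<Sum>j<p. \<Sum>i<p. \<zeta> ^ (j * (m + i)) * (coord x i * \<beta> ^ i))"
    by (simp add: sg_def ev_def sum_distrib_left power_add distrib_left mult_ac)
  also have "\<dots> = (\<Sum>i<p. (\<Sum>j<p. \<zeta> ^ (j * (m + i))) * (coord x i * \<beta> ^ i))"
    by (subst sum.swap) (simp add: sum_distrib_right)
  also have "\<dots> = (\<Sum>i<p. if p dvd m + i then of_nat p * coord x i * \<beta> ^ i else 0)"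
    by (intro sum.cong refl) (simp add: root_sum)
  finally show ?thesis .
qed

lemma dvd_add_iff_eq: "i < p \<Longrightarrow> k < p \<Longrightarrow> p dvd (p - k) + i \<longleftrightarrow> i = k"
proof
  assume a: "i < p" "k < p" "p dvd (p - k) + i"
  then obtain q where q: "(p - k) + i = p * q" by (auto simp: dvd_def)
  have "0 < p * q" "p * q < p * 2" unfolding q[symmetric] using a by auto
  then have "q = 1" by (cases q) auto
  then show "i = k" using q a by simp
qed auto

text \<open>\<open>p\<close> times the projection onto the eigenspace of \<open>\<sigma>\<close>
  spanned by \<open>\<beta> ^ k\<close>; the weight \<open>p - k\<close> stands for
  \<open>-k\<close>.\<close>

lemma twisted_trace_single:
  assumes "x \<in> L" "k < p"
  shows "(\<Sum>j<p. \<zeta> ^ (j * (p - k)) * sg j x) = of_nat p * coord x k * \<beta> ^ k"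
proof -
  have "(\<Sum>j<p. \<zeta> ^ (j * (p - k)) * sg j x) = (\<Sum>i<p. if i = k then of_nat p * coord x k * \<beta> ^ k else 0)"
    unfolding twisted_trace[OF assms(1)]
  proof (intro sum.cong refl)
    fix i assume "i \<in> {..<p}"
    then have "p dvd p - k + i \<longleftrightarrow> i = k" using dvd_add_iff_eq[of i k] assms(2) by simp
    then show "(if p dvd p - k + i then of_nat p * coord x i * \<beta> ^ i else 0) =
        (if i = k then of_nat p * coord x k * \<beta> ^ k else 0)" by auto
  qed
  then show ?thesis using assms(2) by (simp add: sum.delta)
qed

text \<open>A nonzero shift generates the residues modulo the prime \<open>p\<close>. Applied to a
  proper set of conjugates, it yields an index that the shift moves out of the set.\<close>

lemma shift_invariant_full:
  assumes S: "S \<subseteq> {..<p}" "S \<noteq> {}" and i: "0 < i" "i < p"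
    and inv: "\<And>s. s \<in> S \<Longrightarrow> (s + i) mod p \<in> S"
  shows "S = {..<p}"
proof -
  obtain s where s: "s \<in> S" using S by auto
  have *: "(s + n * i) mod p \<in> S" for n
  proof (induction n)
    case 0
    then show ?case using s S by auto
  next
    case (Suc n)
    have "((s + n * i) mod p + i) mod p = (s + Suc n * i) mod p" by (simp add: mod_simps add_ac)
    then show ?case using inv[OF Suc] by simp
  qed
  have "t \<in> S" if "t < p" for t
  proof -
    have "coprime i p"
      using prime_p i prime_imp_coprime[of p i] nat_dvd_not_less[of i p] by (simp add: coprime_commute)
    then obtain n where "[i * n = 1] (mod p)" using cong_solve_coprime_nat by auto
    then have "[i * n * (t + (p - s)) = 1 * (t + (p - s))] (mod p)" by (rule cong_scalar_right)
    then have "[s + i * n * (t + (p - s)) = s + 1 * (t + (p - s))] (mod p)" by (simp only: cong_add_lcancel_nat)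
    moreover have "s + 1 * (t + (p - s)) = t + p" using s S by auto
    ultimately have "(s + (n * (t + (p - s))) * i) mod p = t"
      using that by (simp add: cong_def mult_ac)
    then show ?thesis using *[of "n * (t + (p - s))"] by simp
  qed
  then show ?thesis using S by auto
qed

text \<open>If some primitive \<open>x\<close> had a norm in the maximal ideal, a maximal product \<open>y\<close> of conjugates of
  \<open>x\<close> outside \<open>ME\<close> would give, after normalisation, an idempotent \<open>e\<close> modulo \<open>ME\<close> whose conjugates
  are orthogonal with sum \<open>1\<close>. The resolvent \<open>r\<close> of \<open>e\<close> then lies in \<open>K \<beta>^(p-1)\<close> and satisfies
  \<open>r^p \<equiv> 1\<close>, so that \<open>b\<close> would be a \<open>p\<close>-th power.\<close>

lemma unramified_norm_unit:
  assumes bU: "b \<in> U" and x: "x \<in> VE" "x \<notin> ME"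
  shows "N x \<in> U"
proof (rule ccontr)
  assume "N x \<notin> U"
  then have NM: "N x \<in> ME" using V_cases[OF N_VE[OF x(1)]] M_in_ME by blast
  have xL: "x \<in> L" using x ext_subset by auto
  \<comment> \<open>Otherwise all units, \<open>b\<close> among them, would be in \<open>T\<close>.
    The normalisation below divides by \<open>p\<close>.\<close>
  have pU: "of_nat p \<in> U"
    using V_cases[OF V_of_nat] U_subset_T_if_residue_char bU b_notin_T by blast
  define P where "P S = (\<Prod>j\<in>S. sg j x)" for S
  have PV: "P S \<in> VE" for S unfolding P_def by (intro VE_prod ext_sg x)
  let ?F = "{S. S \<subseteq> {..<p} \<and> P S \<notin> ME}"
  have fin: "finite ?F" by (rule finite_subset[of _ "Pow {..<p}"]) auto
  have one: "{0} \<in> ?F" using x xL by (auto simp: P_def sg_id)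
  then have ne: "?F \<noteq> {}" by (rule ex_in_conv[THEN iffD1, OF exI])
  from finite_has_maximal[OF fin ne]
  obtain S where S: "S \<in> ?F" and max: "\<forall>S'\<in>?F. S \<subseteq> S' \<longrightarrow> S = S'" by (rule bexE)
  have Sp: "S \<subseteq> {..<p}" and fS: "finite S" using S finite_subset[of S "{..<p}"] by auto
  have "S \<noteq> {}" using max[rule_format, OF one] by auto
  have "S \<noteq> {..<p}" using S NM by (auto simp: P_def N_def)
  define y where "y = P S"
  have y: "y \<in> VE" "y \<notin> ME" "y \<in> L" using S PV ext_subset by (auto simp: y_def)
  \<comment> \<open>Some conjugate factor of \<open>sg i y\<close> has its index outside
    \<open>S\<close>; by maximality its product with \<open>y\<close> is in
    \<open>ME\<close>.\<close>
  have orth_y: "y * sg i y \<in> ME" if i: "0 < i" "i < p" for i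
  proof -
    obtain s where s: "s \<in> S" "(s + i) mod p \<notin> S"
      using shift_invariant_full[OF Sp \<open>S \<noteq> {}\<close> i] \<open>S \<noteq> {..<p}\<close> by blast
    let ?j = "(s + i) mod p"
    have "insert ?j S \<notin> ?F" using max[rule_format, of "insert ?j S"] s(2) by auto
    then have "P (insert ?j S) \<in> ME" using Sp by auto
    then have 1: "sg ?j x * y \<in> ME" using s(2) fS by (simp add: P_def y_def)
    have "sg i y = (\<Prod>l\<in>S. sg (l + i) x)"
      unfolding y_def P_def by (subst L_prod(2)) (auto simp: sg_mem sg_sg xL)
    also have "\<dots> = sg ?j x * (\<Prod>l\<in>S - {s}. sg (l + i) x)"
      using prod.remove[OF fS s(1), of "\<lambda>l. sg (l + i) x"] sg_mod[OF xL] by simp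
    finally have "y * sg i y = (sg ?j x * y) * (\<Prod>l\<in>S - {s}. sg (l + i) x)" by (simp add: mult_ac)
    also have "\<dots> \<in> ME" by (intro ME_mult_right[OF 1] VE_prod ext_sg x(1))
    finally show ?thesis .
  qed
  obtain i0 where i0: "i0 < p" "coord y i0 ^ p * b ^ i0 \<notin> M" using y by (auto simp: ext_def)
  define c where "c = coord y i0"
  have cK: "c \<in> K" using coord(1)[OF y(3) i0(1)] by (simp add: c_def)
  have "c ^ p * b ^ i0 \<in> U" using i0 y(1) V_cases by (auto simp: ext_def c_def)
  then have "c ^ p * b ^ i0 / b ^ i0 \<in> U" by (rule U_divide[OF _ U_power[OF bU]])
  then have cU: "c \<in> U" using U_root[OF cK p_pos] b_nz by simp
  \<comment> \<open>\<open>s\<close> is the twisted trace of \<open>y\<close> at a coordinate that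
    is a unit, so \<open>e = y / s\<close> has trace 1 and \<open>s\<close> is invertible in
    \<open>VE\<close>.\<close>
  define s where "s = of_nat p * c * \<beta> ^ i0"
  have s_nz: "s \<noteq> 0" using p_nz U_nz[OF cU] \<beta>_nz by (simp add: s_def)
  have sL: "s \<in> L" unfolding s_def by (rule monom_mem) (use cK in auto)
  have s_inv: "inverse s \<in> VE"
  proof -
    have "inverse s = (inverse (of_nat p * c * b)) * \<beta> ^ (p - i0)"
    proof -
      have "\<beta> ^ i0 * \<beta> ^ (p - i0) = b" using i0(1) by (simp add: power_add[symmetric] \<beta>_power)
      then have "s * (inverse (of_nat p * c * b) * \<beta> ^ (p - i0)) = 1"
        using p_nz U_nz[OF cU] b_nz unfolding s_def by (simp add: field_simps)
      then show ?thesis by (rule inverse_unique)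
    qed
    moreover have "inverse (of_nat p * c * b) \<in> U" by (intro U_inverse U_mult pU cU bU)
    ultimately show ?thesis
      using ext_monom[OF ideal_like_V, of "inverse (of_nat p * c * b)" "p - i0"]
        U_mult[OF U_power[of "inverse (of_nat p * c * b)" p] U_power[OF bU, of "p - i0"]] U_memD U_subset_V
      by auto
  qed
  have sg_s: "sg j s = \<zeta> ^ (i0 * j) * s" for j
    unfolding s_def by (subst sg_monom) (use cK in auto)
  define e where "e = y * inverse s"
  have eV: "e \<in> VE" unfolding e_def by (rule VE_mult[OF y(1) s_inv])
  then have eL: "e \<in> L" using ext_subset by auto
  have sg_e: "sg j e = \<zeta> ^ (j * (p - i0)) * sg j y * inverse s" for j
  proof -
    have "\<zeta> ^ (i0 * j) * \<zeta> ^ (j * (p - i0)) = 1"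
    proof -
      have "i0 * j + j * (p - i0) = p * j"
        using i0(1) by (simp add: algebra_simps diff_mult_distrib2)
      then show ?thesis by (simp add: power_add[symmetric] root_power_mult)
    qed
    then have "inverse (\<zeta> ^ (i0 * j)) = \<zeta> ^ (j * (p - i0))" by (rule inverse_unique)
    moreover have "sg j e = sg j y * inverse (\<zeta> ^ (i0 * j) * s)"
      unfolding e_def using L_mult(2)[OF y(3) L_inverse[OF sL], of j] by (simp only: sg_inverse[OF sL] sg_s)
    ultimately show ?thesis by (simp add: mult_ac)
  qed
  have trace_e: "(\<Sum>j<p. sg j e) = 1"
  proof -
    have "(\<Sum>j<p. sg j e) = s * inverse s"
      unfolding sg_e sum_distrib_right[symmetric] twisted_trace_single[OF y(3) i0(1)] by (simp add: s_def c_def)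
    then show ?thesis using s_nz by simp
  qed
  have zV: "\<zeta> ^ n \<in> VE" for n
    using U_root[of \<zeta> p] root_mem root_power U_power[of \<zeta> n] U_subset_V V_in_VE by auto
  have orth0: "e * sg i e \<in> ME" if i: "0 < i" "i < p" for i
  proof -
    have "e * sg i e = (y * sg i y) * (\<zeta> ^ (i * (p - i0)) * (inverse s * inverse s))"
      unfolding sg_e by (simp add: e_def mult_ac)
    also have "\<dots> \<in> ME" by (intro ME_mult_right[OF orth_y[OF i]] VE_mult zV s_inv)
    finally show ?thesis .
  qed
  have orth: "sg j e * sg l e \<in> ME" if "j < p" "l < p" "j \<noteq> l" for j l
  proof -
    have *: "sg j e * sg l e \<in> ME" if "j < l" "l < p" for j l
    proof -
      have "sg j (e * sg (l - j) e) \<in> ME" using that by (intro ext_sg orth0) auto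
      moreover have "sg j (e * sg (l - j) e) = sg j e * sg l e"
        using L_mult(2)[OF eL sg_mem[OF eL]] sg_sg[OF eL] that by simp
      ultimately show ?thesis by simp
    qed
    show ?thesis using *[of j l] *[of l j] that by (cases "j < l") (auto simp: mult.commute)
  qed
  \<comment> \<open>Multiplying the relation \<open>(\<Sum>j<p. sg j e) = 1\<close> by
    \<open>e\<close> leaves only \<open>e * e\<close> modulo \<open>ME\<close>, by
    orthogonality.\<close>
  have idem: "sg j e * sg j e - sg j e \<in> ME" for j
  proof -
    have "{..<p} = insert 0 {1..<p}" using p_pos by auto
    then have "1 = e + (\<Sum>i\<in>{1..<p}. sg i e)" using trace_e by (simp add: sg_id eL)
    then have "e = e * e + (\<Sum>i\<in>{1..<p}. e * sg i e)"
      by (metis distrib_left mult.right_neutral sum_distrib_left)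
    moreover have "(\<Sum>i\<in>{1..<p}. e * sg i e) \<in> ME" by (intro ME_sum orth0) auto
    ultimately have "e * e - e \<in> ME" using ME_uminus by (metis add_diff_cancel_left' minus_diff_eq)
    then have "sg j (e * e - e) \<in> ME" by (rule ext_sg)
    then show ?thesis using L_diff(2)[OF L_mult(1)[OF eL eL] eL] L_mult(2)[OF eL eL] by simp
  qed
  \<comment> \<open>Resolvents of \<open>e\<close>. Orthogonal idempotents make
    \<open>Q n * Q 1\<close> congruent to \<open>Q (Suc n)\<close>, and \<open>Q p\<close> is the
    trace, so \<open>Q 1 ^ p\<close> is congruent to 1.\<close>
  define Q where "Q n = (\<Sum>j<p. \<zeta> ^ (j * n) * sg j e)" for n
  have QV: "Q n \<in> VE" for n unfolding Q_def by (intro VE_sum VE_mult zV ext_sg eV)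
  have Qmult: "Q n * Q 1 - Q (Suc n) \<in> ME" for n
  proof -
    have "Q (Suc n) = (\<Sum>j<p. \<Sum>l<p. \<zeta> ^ (j * n) * \<zeta> ^ (l * 1) * (if l = j then sg j e else 0))"
      unfolding Q_def
      by (intro sum.cong refl) (simp add: if_distrib[of "\<lambda>x. _ * x"] sum.delta power_add mult_ac cong: if_cong)
    moreover have "Q n * Q 1 = (\<Sum>j<p. \<Sum>l<p. \<zeta> ^ (j * n) * \<zeta> ^ (l * 1) * (sg j e * sg l e))"
      unfolding Q_def sum_product by (simp add: mult_ac)
    ultimately have "Q n * Q 1 - Q (Suc n) =
        (\<Sum>j<p. \<Sum>l<p. \<zeta> ^ (j * n) * \<zeta> ^ (l * 1) * (sg j e * sg l e - (if l = j then sg j e else 0)))"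
      by (simp add: sum_subtractf[symmetric] right_diff_distrib)
    moreover have "\<zeta> ^ (j * n) * \<zeta> ^ (l * 1) * (sg j e * sg l e - (if l = j then sg j e else 0)) \<in> ME"
      if "j < p" "l < p" for j l
      by (intro ME_mult VE_mult zV) (use that idem orth in auto)
    ultimately show ?thesis by (auto intro!: ME_sum)
  qed
  have Qpow: "Q 1 ^ n - Q n \<in> ME" if "n \<ge> 1" for n
    using that
  proof (induction n rule: nat_induct_at_least)
    case base
    then show ?case by (simp add: ext_zero[OF ideal_like_M])
  next
    case (Suc n)
    have "(Q 1 ^ n - Q n) * Q 1 + (Q n * Q 1 - Q (Suc n)) \<in> ME"
      by (intro ME_add ME_mult_right Suc QV Qmult)
    then show ?case by (simp add: algebra_simps)
  qed
  have "Q p = 1" unfolding Q_def using trace_e by (simp add: mult.commute[of _ p] root_power_mult)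
  then have r1: "Q 1 ^ p - 1 \<in> ME" using Qpow[of p] p_gt_2 by simp
  define k where "k = of_nat p * coord e (p - 1)"
  have kK: "k \<in> K" unfolding k_def using coord(1)[OF eL] p_pos by auto
  \<comment> \<open>Weight 1 equals \<open>p - k\<close> for the coordinate index
    \<open>k = p - 1\<close>.\<close>
  have "Q 1 = k * \<beta> ^ (p - 1)"
    using twisted_trace_single[OF eL, of "p - 1"] p_gt_2 by (simp add: Q_def k_def)
  then have rp: "Q 1 ^ p = k ^ p * b ^ (p - 1)"
    by (simp add: power_mult_distrib \<beta>_power[symmetric] power_mult[symmetric] mult.commute)
  have "Q 1 ^ p - 1 \<in> M" using r1 kK b_mem unfolding rp by (intro K_ME) auto
  then have kT: "k ^ p * b ^ (p - 1) \<in> T" using one_plus_M_T[of "Q 1 ^ p - 1"] unfolding rp by simp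
  then have "k \<noteq> 0" using T_nz[of "k ^ p * b ^ (p - 1)"] by (auto simp: power_0_left)
  then have "b ^ (p - 1) \<in> T" using kT T_mult_left_iff[OF power_in_T[OF kK]] by simp
  moreover have "\<not> p dvd p - 1" using p_gt_2 by (auto dest: dvd_imp_le)
  ultimately show False using T_root[OF b_mem b_nz] b_notin_T by blast
qed

text \<open>Dividing by a coordinate of least value gives an element of \<open>VE\<close> with a
  coordinate 1, hence outside \<open>ME\<close>, and \<open>unramified_norm_unit\<close> makes its
  norm a unit.\<close>

lemma unramified_leading_term:
  assumes bU: "b \<in> U" and x: "x \<in> L" "x \<noteq> 0"
  obtains c w where "c \<in> K" "c \<noteq> 0" "w \<in> VE" "w \<noteq> 0" "inverse w \<in> VE" "N w \<in> U" "x = c * w"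
proof -
  let ?c = "coord x"
  define S where "S = {i. i < p \<and> ?c i \<noteq> 0}"
  have "S \<noteq> {}"
  proof
    assume "S = {}"
    then have "(\<Sum>i<p. ?c i * \<beta> ^ i) = 0" by (intro sum.neutral) (auto simp: S_def)
    then show False using expand[OF x(1)] x(2) by simp
  qed
  moreover have "finite S" by (simp add: S_def)
  moreover have "?c i \<in> K \<and> ?c i \<noteq> 0" if "i \<in> S" for i
    using that coord(1)[OF x(1)] by (auto simp: S_def)
  ultimately obtain k where k: "k \<in> S" "\<forall>i\<in>S. ?c i / ?c k \<in> V" using ex_dominant[of S ?c] by auto
  have kp: "k < p" and ck: "?c k \<noteq> 0" "?c k \<in> K" using k(1) coord(1)[OF x(1)] by (auto simp: S_def)
  define w where "w = x / ?c k"
  have quot: "?c i / ?c k \<in> V" if "i < p" for i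
    using k(2) that by (cases "?c i = 0") (auto simp: S_def)
  have w_eq: "w = ev (\<lambda>i. ?c i / ?c k)"
    unfolding w_def by (subst expand[OF x(1)]) (simp add: ev_def sum_divide_distrib)
  have coord_w: "coord w i = ?c i / ?c k" if "i < p" for i
    unfolding w_eq by (rule coord_ev) (use quot V_subset that in auto)
  have wL: "w \<in> L" unfolding w_eq by (rule ev_mem) (use quot V_subset in auto)
  have wV: "w \<in> VE"
    unfolding ext_def using wL coord_w quot bU U_subset_V
    by (auto intro!: V_mult V_power)
  have wM: "w \<notin> ME"
  proof
    assume "w \<in> ME"
    then have "coord w k ^ p * b ^ k \<in> M" using kp by (auto simp: ext_def)
    then show False using coord_w[OF kp] ck not_M_and_U[of "b ^ k"] U_power[OF bU] by simp
  qed
  have NU: "N w \<in> U" by (rule unramified_norm_unit[OF bU wV wM])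
  show ?thesis
    using that[of "?c k" w] ck wV inverse_in_VE[OF wV NU] NU x by (simp add: w_def)
qed

end

text \<open>The form of rigidity that is carried through field extensions: it yields
  \<open>p_rigid\<close> for \<open>K\<close> and is inherited by \<open>L\<close>. With
  \<open>u = 1\<close> it says that all units are \<open>p\<close>-th powers.\<close>

locale rigid_val = root_val K p \<zeta> V for K :: "'a::field set" and p \<zeta> V +
  fixes u :: 'a
  assumes u_mem: "u \<in> K" and u_nz: "u \<noteq> 0" and U_span: "U \<subseteq> pspan u"

locale kummer_rigid_val = kummer_val K p \<zeta> b \<beta> V + rigid_val K p \<zeta> V u
  for K :: "'a::field set" and p \<zeta> b \<beta> V u
begin

lemma pspan_b: "b \<in> U \<Longrightarrow> pspan b = pspan u"
  using pspan_eq[of b u] U_span b_notin_T u_mem u_nz by auto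

text \<open>Unramified: a norm is a \<open>p\<close>-th power times a unit, and unit classes lie in
  \<open>pspan u\<close>, which \<open>b\<close> itself generates. Ramified:
  \<open>c * \<beta> ^ k\<close> has norm \<open>c ^ p * b ^ k\<close>, and the remaining factor
  contributes a principal unit.\<close>

lemma norm_in_pspan:
  assumes "b \<in> U \<or> (\<forall>y\<in>K. b * y ^ p \<notin> U)" and x: "x \<in> L" "x \<noteq> 0"
  shows "N x \<in> pspan b"
  using assms(1)
proof
  assume bU: "b \<in> U"
  obtain c w where cw: "c \<in> K" "c \<noteq> 0" "w \<in> VE" "N w \<in> U" "x = c * w"
    using unramified_leading_term[OF bU x] by blast
  have "w \<in> L" using cw ext_subset by auto
  then have "N x = c ^ p * N w" using cw by (simp add: N_mult K_subset_L N_K)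
  moreover have "N w \<in> pspan b" using cw U_span pspan_b[OF bU] by auto
  moreover have "c ^ p \<in> pspan b" using T_subset_pspan power_in_T[OF cw(1,2)] by auto
  ultimately show ?thesis using pspan_mult by simp
next
  assume "\<forall>y\<in>K. b * y ^ p \<notin> U"
  then have ram: "\<And>y. y \<in> K \<Longrightarrow> b * y ^ p \<notin> U" by blast
  obtain c k \<mu> where c: "c \<in> K" "c \<noteq> 0" "k < p" "\<mu> \<in> ME" "x = c * \<beta> ^ k * (1 + \<mu>)"
    using ramified_leading_term[OF ram x] by blast
  have "1 + \<mu> \<in> L" using inverse_one_plus_ME(2)[OF c(4)] ext_subset by auto
  then have "N x = b ^ k * (c ^ p * N (1 + \<mu>))"
    unfolding c(5) using c by (simp add: N_mult K_subset_L N_K L_mult(1) L_power(1) \<beta>_mem N_power N_\<beta>)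
  moreover have "N (1 + \<mu>) \<in> T" using one_plus_M_T[OF N_one_plus_ME[OF c(4)]] by simp
  ultimately show ?thesis using pspanI[OF T_mult[OF power_in_T[OF c(1,2)]]] by simp
qed

end

section \<open>\<open>VE\<close> as a valuation ring of \<open>L\<close>\<close>

context kummer_val
begin

lemma monom_inverse:
  assumes "c \<in> K" "c \<noteq> 0" "k < p" "inverse (c ^ p * b ^ k) \<in> V"
  shows "inverse (c * \<beta> ^ k) \<in> VE"
proof -
  have "\<beta> ^ k * \<beta> ^ (p - k) = b" using assms(3) by (simp add: power_add[symmetric] \<beta>_power)
  then have "c * \<beta> ^ k * (inverse (c * b) * \<beta> ^ (p - k)) = 1"
    using assms(2) b_nz by (simp add: field_simps)
  then have eq: "inverse (c * \<beta> ^ k) = inverse (c * b) * \<beta> ^ (p - k)" by (rule inverse_unique)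
  have "b ^ k * b ^ (p - k) = b ^ p" using assms(3) by (simp add: power_add[symmetric])
  then have "c ^ p * b ^ k * (inverse (c * b) ^ p * b ^ (p - k)) = 1"
    using assms(2) b_nz by (simp add: field_simps)
  then have "inverse (c ^ p * b ^ k) = inverse (c * b) ^ p * b ^ (p - k)" by (rule inverse_unique)
  then show ?thesis
    unfolding eq using assms b_mem by (intro ext_monom[OF ideal_like_V]) auto
qed

text \<open>Common form of the two leading-term lemmas: a monomial times a unit of
  \<open>VE\<close>. The value of a monomial can be read off in \<open>K\<close>, which decides
  whether it or its inverse is in \<open>VE\<close>.\<close>

definition decomposes :: bool where
  "decomposes \<longleftrightarrow> (\<forall>x\<in>L. x \<noteq> 0 \<longrightarrow> (\<exists>c k w. c \<in> K \<and> c \<noteq> 0 \<and> k < p \<and> w \<in> VE \<and> w \<noteq> 0 \<and>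
     inverse w \<in> VE \<and> x = c * \<beta> ^ k * w))"

lemma decomposes_ramified:
  assumes ram: "\<And>y. y \<in> K \<Longrightarrow> b * y ^ p \<notin> U"
  shows decomposes
  unfolding decomposes_def
proof safe
  fix x assume x: "x \<in> L" "x \<noteq> 0"
  obtain c k \<mu> where "c \<in> K" "c \<noteq> 0" "k < p" "\<mu> \<in> ME" "x = c * \<beta> ^ k * (1 + \<mu>)"
    using ramified_leading_term[OF ram x] by blast
  then show "\<exists>c k w. c \<in> K \<and> c \<noteq> 0 \<and> k < p \<and> w \<in> VE \<and> w \<noteq> 0 \<and> inverse w \<in> VE \<and> x = c * \<beta> ^ k * w"
    using inverse_one_plus_ME[of \<mu>] by blast
qed

lemma decomposes_unramified:
  assumes bU: "b \<in> U"
  shows decomposes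
  unfolding decomposes_def
proof safe
  fix x assume x: "x \<in> L" "x \<noteq> 0"
  obtain c w where "c \<in> K" "c \<noteq> 0" "w \<in> VE" "w \<noteq> 0" "inverse w \<in> VE" "x = c * w"
    using unramified_leading_term[OF bU x] by blast
  then have "c \<in> K \<and> c \<noteq> 0 \<and> 0 < p \<and> w \<in> VE \<and> w \<noteq> 0 \<and> inverse w \<in> VE \<and> x = c * \<beta> ^ 0 * w"
    by simp
  then show "\<exists>c k w. c \<in> K \<and> c \<noteq> 0 \<and> k < p \<and> w \<in> VE \<and> w \<noteq> 0 \<and> inverse w \<in> VE \<and> x = c * \<beta> ^ k * w"
    by blast
qed

lemma val_ring_VE:
  assumes decomposes
  shows "val_ring L VE" and "val_ring.M VE \<subseteq> ME"
proof -
  have dec: "\<exists>c k w. c \<in> K \<and> c \<noteq> 0 \<and> k < p \<and> w \<in> VE \<and> w \<noteq> 0 \<and> inverse w \<in> VE \<and> x = c * \<beta> ^ k * w"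
    if "x \<in> L" "x \<noteq> 0" for x using assms that unfolding decomposes_def by blast
  have cases: "inverse x \<in> VE \<or> (x \<in> VE \<and> x \<in> ME)" if x: "x \<in> L" "x \<noteq> 0" for x
  proof -
    obtain c k w where c: "c \<in> K" "c \<noteq> 0" "k < p" "w \<in> VE" "w \<noteq> 0" "inverse w \<in> VE" "x = c * \<beta> ^ k * w"
      using dec[OF x] by blast
    have g: "c ^ p * b ^ k \<in> K" "c ^ p * b ^ k \<noteq> 0" using c b_mem b_nz by auto
    show ?thesis
    proof (cases "inverse (c ^ p * b ^ k) \<in> V")
      case True
      have "inverse x = inverse (c * \<beta> ^ k) * inverse w" using c(7) by simp
      then show ?thesis using VE_mult[OF monom_inverse[OF c(1-3) True] c(6)] by simp
    next
      case False
      then have "c ^ p * b ^ k \<in> M" using V_total[OF g] by (auto simp: M_def)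
      then have "c * \<beta> ^ k \<in> ME" by (rule ext_monom[OF ideal_like_M c(1)])
      then have "x \<in> ME" unfolding c(7) by (rule ME_mult_right[OF _ c(4)])
      then show ?thesis using ME_subset_VE by auto
    qed
  qed
  show val: "val_ring L VE"
  proof
    show "VE \<subseteq> L" by (rule ext_subset)
    show "0 \<in> VE" "1 \<in> VE" using VE_one ext_zero[OF ideal_like_V] by auto
    show "x + y \<in> VE" "x * y \<in> VE" if "x \<in> VE" "y \<in> VE" for x y using that VE_add VE_mult by auto
    show "- x \<in> VE" if "x \<in> VE" for x using that VE_uminus by auto
    show "x \<in> VE \<or> inverse x \<in> VE" if "x \<in> L" "x \<noteq> 0" for x using cases[OF that] by blast
  qed
  show "val_ring.M VE \<subseteq> ME"
  proof
    fix x assume "x \<in> val_ring.M VE"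
    then have "x \<in> VE" "x = 0 \<or> inverse x \<notin> VE" unfolding val_ring.M_def[OF val] by auto
    then show "x \<in> ME" using cases[of x] ext_subset ext_zero[OF ideal_like_M] by blast
  qed
qed

lemma norm_unit:
  assumes "m \<in> VE" "m \<noteq> 0" "inverse m \<in> VE"
  shows "N m \<in> U"
proof -
  have "m \<in> L" "inverse m \<in> L" using assms ext_subset by auto
  then have "N m * N (inverse m) = 1" using N_mult[of m "inverse m"] assms(2) N_K[of 1] by simp
  then have "inverse (N m) = N (inverse m)" by (rule inverse_unique)
  then show ?thesis using N_VE[OF assms(1)] N_VE[OF assms(3)] N_nz[of m] assms(2) \<open>m \<in> L\<close> by (auto simp: U_def)
qed

lemma K_unit: "d \<in> K \<Longrightarrow> d \<noteq> 0 \<Longrightarrow> d \<in> VE \<Longrightarrow> inverse d \<in> VE \<Longrightarrow> d \<in> U"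
  using K_VE[of d] K_VE[of "inverse d"] by (auto simp: U_def)

lemma T_subset_LF_T: "T \<subseteq> LF.T"
  using K_subset_L by (auto simp: pth_powers_def)

lemma one_plus_ME_power: "\<mu> \<in> ME \<Longrightarrow> (1 + \<mu>) ^ n - 1 \<in> ME"
proof (induction n)
  case 0
  then show ?case by (simp add: ext_zero[OF ideal_like_M])
next
  case (Suc n)
  have "((1 + \<mu>) ^ n - 1) + (1 + \<mu>) ^ n * \<mu> \<in> ME"
    using Suc inverse_one_plus_ME(2) by (intro ME_add ME_mult VE_power) auto
  then show ?case by (simp add: algebra_simps)
qed

lemma inverse_power_VE: "inverse w \<in> VE \<Longrightarrow> inverse (w ^ n) \<in> VE"
  using VE_power[of "inverse w" n] by (simp add: power_inverse)

end

section \<open>Passing the valuation data from \<open>K\<close> to \<open>L\<close>\<close>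

context kummer_rigid_val
begin

text \<open>In the decomposition of \<open>1 + \<mu>\<close> the norm is in \<open>T\<close> and has
  the class of \<open>b ^ i\<close>; as \<open>b\<close> has order \<open>p\<close> modulo
  \<open>T\<close>, the exponent \<open>i\<close> is a multiple of \<open>p\<close> and
  \<open>\<beta> ^ i\<close> lies in \<open>K\<close>.\<close>

lemma one_plus_ME_class:
  assumes norms: "\<And>x. x \<in> L \<Longrightarrow> x \<noteq> 0 \<Longrightarrow> N x \<in> pspan b" and \<mu>: "\<mu> \<in> ME"
  obtains d e where "d \<in> K" "d \<noteq> 0" "e \<in> L" "e \<noteq> 0" "1 + \<mu> = d * e ^ p"
proof -
  have z: "1 + \<mu> \<in> L" "1 + \<mu> \<noteq> 0" using inverse_one_plus_ME[OF \<mu>] ext_subset by auto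
  obtain i f e where f: "f \<in> K" "f \<noteq> 0" "e \<in> L" "e \<noteq> 0" "1 + \<mu> = \<beta> ^ i * f * e ^ p"
    using class_decomposition[OF norms z] by blast
  have "N (1 + \<mu>) = b ^ i * (f * N e) ^ p"
    unfolding f(5) using f
    by (simp add: N_mult K_subset_L N_K L_mult(1) L_power(1) \<beta>_mem N_power N_\<beta> power_mult_distrib)
  moreover have "N (1 + \<mu>) \<in> T" using one_plus_M_T[OF N_one_plus_ME[OF \<mu>]] by simp
  moreover have "(f * N e) ^ p \<in> T" using f N_mem N_nz by (intro power_in_T) auto
  ultimately have "b ^ i \<in> T" using T_mult_right_iff by metis
  then have "p dvd i" using T_root[OF b_mem b_nz] b_notin_T by blast
  then obtain q where "i = p * q" by (auto simp: dvd_def)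
  then have "1 + \<mu> = (b ^ q * f) * e ^ p" using f(5) by (simp add: power_mult \<beta>_power)
  then show ?thesis using that[of "b ^ q * f" e] f b_mem b_nz by auto
qed

text \<open>No new unit classes appear: if \<open>c * \<beta> ^ k\<close> is a unit, so is its norm
  \<open>b ^ k * c ^ p\<close>, which forces \<open>k = 0\<close> and makes \<open>c\<close> a unit
  of \<open>K\<close>.\<close>

lemma rigid_val_ramified:
  assumes norms: "\<And>x. x \<in> L \<Longrightarrow> x \<noteq> 0 \<Longrightarrow> N x \<in> pspan b"
    and ram: "\<And>y. y \<in> K \<Longrightarrow> b * y ^ p \<notin> U"
  shows "rigid_val L p \<zeta> VE u"
proof -
  interpret E: val_ring L VE by (rule val_ring_VE(1)[OF decomposes_ramified[OF ram]])
  have one_plus: "1 + \<mu> \<in> LF.T" if \<mu>: "\<mu> \<in> ME" for \<mu>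
  proof -
    obtain d e where d: "d \<in> K" "d \<noteq> 0" "e \<in> L" "e \<noteq> 0" "1 + \<mu> = d * e ^ p"
      using one_plus_ME_class[OF norms \<mu>] by blast
    obtain c k \<nu> where c: "c \<in> K" "c \<noteq> 0" "k < p" "\<nu> \<in> ME" "e = c * \<beta> ^ k * (1 + \<nu>)"
      using ramified_leading_term[OF ram d(3,4)] by blast
    note inv = inverse_one_plus_ME[OF c(4)]
    define g where "g = d * c ^ p * b ^ k"
    have gK: "g \<in> K" "g \<noteq> 0" using d c b_mem b_nz by (auto simp: g_def)
    have "(\<beta> ^ k) ^ p = b ^ k" by (simp add: \<beta>_power[symmetric] power_mult[symmetric] mult.commute)
    then have z: "1 + \<mu> = g * (1 + \<nu>) ^ p"
      using d(5) unfolding c(5) by (simp add: g_def power_mult_distrib mult_ac)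
    \<comment> \<open>\<open>1 + \<mu>\<close> and \<open>(1 + \<nu>) ^ p\<close> are both congruent
      to 1, so their quotient \<open>g\<close> is a principal unit of \<open>K\<close>.\<close>
    have "g - 1 = (\<mu> - ((1 + \<nu>) ^ p - 1)) * inverse ((1 + \<nu>) ^ p)"
      using z inv(1) by (simp add: field_simps)
    also have "\<dots> \<in> ME"
      by (rule ME_mult_right[OF ME_diff[OF \<mu> one_plus_ME_power[OF c(4)]] inverse_power_VE[OF inv(3)]])
    finally have "g - 1 \<in> M" using gK by (intro K_ME) auto
    then have "g \<in> T" using one_plus_M_T[of "g - 1"] by simp
    then have "g \<in> LF.T" using T_subset_LF_T by auto
    moreover have "(1 + \<nu>) ^ p \<in> LF.T" using inv ext_subset by (intro LF.power_in_T) auto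
    ultimately show ?thesis using z LF.T_mult by simp
  qed
  show ?thesis
  proof
    show "1 + x \<in> LF.T" if "x \<in> E.M" for x
      using one_plus val_ring_VE(2)[OF decomposes_ramified[OF ram]] that by auto
    show "u \<in> L" "u \<noteq> 0" using u_mem u_nz K_subset_L by auto
    show "E.U \<subseteq> LF.pspan u"
    proof
      fix x assume x: "x \<in> E.U"
      then have xd: "x \<in> VE" "x \<noteq> 0" "inverse x \<in> VE" by (auto simp: E.U_def)
      then have "x \<in> L" using ext_subset by auto
      then obtain c k \<mu> where c: "c \<in> K" "c \<noteq> 0" "k < p" "\<mu> \<in> ME" "x = c * \<beta> ^ k * (1 + \<mu>)"
        using ramified_leading_term[OF ram _ xd(2)] by blast
      note inv = inverse_one_plus_ME[OF c(4)]
      have "1 + \<mu> \<in> E.U" using inv by (auto simp: E.U_def)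
      then have "x / (1 + \<mu>) \<in> E.U" using x E.U_divide by blast
      moreover have "x / (1 + \<mu>) = c * \<beta> ^ k" using c(5) inv(1) by simp
      ultimately have "N (c * \<beta> ^ k) \<in> U" by (intro norm_unit) (auto simp: E.U_def)
      moreover have "N (c * \<beta> ^ k) = b ^ k * c ^ p"
        using c by (simp add: N_mult K_subset_L N_K L_power(1) \<beta>_mem N_power N_\<beta>)
      ultimately have bk: "b ^ k * c ^ p \<in> U" by simp
      then have "p dvd k" using ramified_power[OF ram c(1)] by blast
      then have k0: "k = 0" using c(3) by (auto dest: dvd_imp_le)
      then have "c \<in> U" using bk U_root[OF c(1) p_pos] by simp
      then have "c \<in> pspan u" using U_span by auto
      then have "c \<in> LF.pspan u" using T_subset_LF_T by (auto simp: pspan_def LF.pspan_def)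
      then have "c * (1 + \<mu>) \<in> LF.pspan u"
        using one_plus[OF c(4)] LF.pspan_mult LF.T_subset_pspan by blast
      then show "x \<in> LF.pspan u" using c(5) k0 by simp
    qed
  qed
qed

text \<open>The classes of the old units are generated by \<open>b = \<beta> ^ p\<close> and become
  trivial in \<open>L\<close>; by the class decomposition, only powers of \<open>\<beta>\<close>
  remain as unit classes.\<close>

lemma rigid_val_unramified:
  assumes norms: "\<And>x. x \<in> L \<Longrightarrow> x \<noteq> 0 \<Longrightarrow> N x \<in> pspan b"
    and bU: "b \<in> U"
  shows "rigid_val L p \<zeta> VE \<beta>"
proof -
  interpret E: val_ring L VE by (rule val_ring_VE(1)[OF decomposes_unramified[OF bU]])
  have UT: "U \<subseteq> LF.T"
  proof
    fix d assume "d \<in> U"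
    then have "d \<in> pspan b" using U_span pspan_b[OF bU] by auto
    then obtain k t where kt: "d = b ^ k * t" "t \<in> T" by (auto simp: pspan_def)
    have "b \<in> LF.T" using LF.power_in_T[OF \<beta>_mem \<beta>_nz] \<beta>_power by simp
    then show "d \<in> LF.T" using kt LF.T_mult LF.T_power T_subset_LF_T by auto
  qed
  have unit_mult: "d * w ^ p \<in> LF.T" if "d \<in> K" "d \<noteq> 0" "w \<in> VE" "w \<noteq> 0" "inverse w \<in> VE"
    "d * w ^ p \<in> E.U" for d w
  proof -
    have "w ^ p \<in> E.U" using that by (intro E.U_power) (auto simp: E.U_def)
    then have "d * w ^ p / w ^ p \<in> E.U" using that E.U_divide by blast
    then have "d \<in> E.U" using that by simp
    then have "d \<in> U" using that by (intro K_unit) (auto simp: E.U_def)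
    then have "d \<in> LF.T" using UT by auto
    moreover have "w ^ p \<in> LF.T" using that ext_subset by (intro LF.power_in_T) auto
    ultimately show ?thesis by (rule LF.T_mult)
  qed
  have dec: "\<exists>d w. d \<in> K \<and> d \<noteq> 0 \<and> w \<in> VE \<and> w \<noteq> 0 \<and> inverse w \<in> VE \<and> f * e ^ p = d * w ^ p"
    if f: "f \<in> K" "f \<noteq> 0" "e \<in> L" "e \<noteq> 0" for f e
  proof -
    obtain c w where c: "c \<in> K" "c \<noteq> 0" "w \<in> VE" "w \<noteq> 0" "inverse w \<in> VE" "e = c * w"
      using unramified_leading_term[OF bU f(3,4)] by blast
    then have "f * e ^ p = (f * c ^ p) * w ^ p" by (simp add: power_mult_distrib)
    moreover have "f * c ^ p \<in> K" "f * c ^ p \<noteq> 0" using f c by auto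
    ultimately show ?thesis using c by blast
  qed
  show ?thesis
  proof
    show "1 + x \<in> LF.T" if "x \<in> E.M" for x
    proof -
      have x: "x \<in> ME" using val_ring_VE(2)[OF decomposes_unramified[OF bU]] that by auto
      obtain d e where d: "d \<in> K" "d \<noteq> 0" "e \<in> L" "e \<noteq> 0" "1 + x = d * e ^ p"
        using one_plus_ME_class[OF norms x] by blast
      then obtain d' w where "d' \<in> K" "d' \<noteq> 0" "w \<in> VE" "w \<noteq> 0" "inverse w \<in> VE" "1 + x = d' * w ^ p"
        using dec by metis
      then show ?thesis using unit_mult[of d' w] E.one_plus_M[OF that] by simp
    qed
    show "\<beta> \<in> L" "\<beta> \<noteq> 0" by (rule \<beta>_mem, rule \<beta>_nz)
    have "\<beta> \<in> VE" using ext_monom[OF ideal_like_V, of 1 1] bU U_subset_V by auto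
    then have \<beta>U: "\<beta> \<in> E.U" using inverse_in_VE[of \<beta>] N_\<beta> bU \<beta>_nz by (simp add: E.U_def)
    show "E.U \<subseteq> LF.pspan \<beta>"
    proof
      fix x assume x: "x \<in> E.U"
      have "x \<in> L" "x \<noteq> 0" using x E.U_memD E.U_nz by auto
      then obtain i f e where f: "f \<in> K" "f \<noteq> 0" "e \<in> L" "e \<noteq> 0" "x = \<beta> ^ i * f * e ^ p"
        using class_decomposition[OF norms] by blast
      obtain d w where d: "d \<in> K" "d \<noteq> 0" "w \<in> VE" "w \<noteq> 0" "inverse w \<in> VE" "f * e ^ p = d * w ^ p"
        using dec[OF f(1-4)] by blast
      have "x / \<beta> ^ i \<in> E.U" using E.U_divide[OF x E.U_power[OF \<beta>U]] .
      moreover have "x / \<beta> ^ i = d * w ^ p" using f(5) d(6) \<beta>_nz by (simp add: mult.assoc)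
      ultimately have "d * w ^ p \<in> LF.T" using unit_mult[OF d(1-5)] by simp
      then have "\<beta> ^ i * (d * w ^ p) \<in> LF.pspan \<beta>" by (rule LF.pspanI)
      then show "x \<in> LF.pspan \<beta>" using f(5) d(6) by (simp add: mult.assoc)
    qed
  qed
qed

end

section \<open>The valuation of a rigid field\<close>

lemma to_ac_det_mult_matrix:
  "det (mult_matrix p (to_ac b) (\<lambda>i. to_ac (c i))) = to_ac (det (mult_matrix p b c))"
proof -
  interpret comm_ring_hom to_ac by unfold_locales auto
  have "mult_matrix p (to_ac b) (\<lambda>i. to_ac (c i)) = map_mat to_ac (mult_matrix p b c)"
    by (rule eq_matI) (auto simp: mult_matrix_def)
  then show ?thesis by simp
qed

context root_field
begin

lemma root_field_to_ac: "root_field (to_ac ` K) p (to_ac \<zeta>)"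
proof
  show "is_subfield (to_ac ` K)"
    unfolding is_subfield_def
  proof (intro conjI ballI)
    show "0 \<in> to_ac ` K" "1 \<in> to_ac ` K" using to_ac_0 to_ac_1 zero_mem one_mem by (metis image_eqI)+
    show "x + y \<in> to_ac ` K" "x - y \<in> to_ac ` K" "x * y \<in> to_ac ` K"
      if "x \<in> to_ac ` K" "y \<in> to_ac ` K" for x y
      using that by (auto simp flip: to_ac_add to_ac_diff to_ac_mult)
    show "inverse x \<in> to_ac ` K" if "x \<in> to_ac ` K" for x
      using that by (auto simp flip: to_ac_inverse)
  qed
  show "to_ac \<zeta> \<in> to_ac ` K" using root_mem by simp
  show "to_ac \<zeta> ^ p = 1" using root_power by (simp flip: to_ac_power)
  show "\<forall>k. 0 < k \<and> k < p \<longrightarrow> to_ac \<zeta> ^ k \<noteq> 1" using root_primitive by (simp flip: to_ac_power)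
qed (rule prime_p odd_p)+

text \<open>The factorisation of \<open>X^p - 1\<close> into linear factors, evaluated at
  \<open>inverse \<beta>\<close> and cleared of denominators.\<close>

lemma prod_one_minus:
  assumes "\<beta> \<noteq> 0"
  shows "(\<Prod>j<p. 1 - \<zeta> ^ j * \<beta>) = 1 - \<beta> ^ p"
proof -
  define f where "f = (\<Prod>j<p. [:- (\<zeta> ^ j), 1:])"
  define g where "g = Polynomial.monom 1 p - (1 :: 'a poly)"
  have degf: "Polynomial.degree f = p"
    unfolding f_def by (subst degree_prod_eq_sum_degree) auto
  have "lead_coeff f = 1" unfolding f_def by (simp add: lead_coeff_prod)
  then have cf: "poly.coeff f p = 1" using degf by simp
  have cg: "poly.coeff g p = 1" unfolding g_def by simp
  have degg: "Polynomial.degree g \<le> p"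
    unfolding g_def by (intro degree_diff_le) (auto simp: degree_monom_le)
  have inj: "inj_on (\<lambda>j. \<zeta> ^ j) {..<p}"
  proof -
    have "j = l" if "j < l" "l < p" "\<zeta> ^ j = \<zeta> ^ l" for j l
    proof -
      have "\<zeta> ^ j * \<zeta> ^ (l - j) = \<zeta> ^ l" using that(1) by (simp add: power_add[symmetric])
      then have "\<zeta> ^ j * \<zeta> ^ (l - j) = \<zeta> ^ j" using that(3) by simp
      then have "\<zeta> ^ (l - j) = 1" using root_nz by simp
      then show ?thesis using root_primitive[rule_format, of "l - j"] that by auto
    qed
    then show ?thesis by (intro linorder_inj_onI) auto
  qed
  have "f = g"
  proof (rule poly_eqI_degree_lead_coeff[of _ p _ "(\<lambda>j. \<zeta> ^ j) ` {..<p}"])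
    show "card ((\<lambda>j. \<zeta> ^ j) ` {..<p}) \<ge> p" using card_image[OF inj] by simp
    fix z assume "z \<in> (\<lambda>j. \<zeta> ^ j) ` {..<p}"
    then obtain j where j: "z = \<zeta> ^ j" "j < p" by auto
    have "poly f z = 0" unfolding f_def poly_prod using j by (intro prod_zero) auto
    moreover have "z ^ p = 1"
      unfolding j(1) using root_power_mult[of j] by (simp add: power_mult[symmetric] mult.commute)
    ultimately show "poly f z = poly g z" by (simp add: g_def poly_monom)
  qed (use cf cg degf degg in auto)
  then have "poly f (inverse \<beta>) = poly g (inverse \<beta>)" by simp
  then have "(\<Prod>j<p. inverse \<beta> - \<zeta> ^ j) = inverse \<beta> ^ p - 1"
    by (simp add: f_def g_def poly_prod poly_monom)
  then have "(\<Prod>j<p. \<beta> * (inverse \<beta> - \<zeta> ^ j)) = \<beta> ^ p * (inverse \<beta> ^ p - 1)"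
    by (simp add: prod.distrib)
  moreover have "\<beta> * (inverse \<beta> - \<zeta> ^ j) = 1 - \<zeta> ^ j * \<beta>" for j
    using assms by (simp add: algebra_simps)
  moreover have "\<beta> ^ p * (inverse \<beta> ^ p - 1) = 1 - \<beta> ^ p"
    using assms by (simp add: algebra_simps power_mult_distrib[symmetric])
  ultimately show ?thesis by simp
qed

text \<open>\<open>1 - b\<close> is the norm of \<open>1 - \<beta>\<close>, with coefficients
  \<open>1, -1, 0, ...\<close>. The root is taken in the algebraic closure, where the determinant is
  evaluated before being pulled back.\<close>

lemma one_minus_in_norm_group:
  assumes "b \<noteq> 0"
  shows "1 - b \<in> norm_group K p b"
proof -
  interpret ac: root_field "to_ac ` K" p "to_ac \<zeta>" by (rule root_field_to_ac)
  obtain \<beta> where \<beta>: "\<beta> ^ p = to_ac b" using nth_root_exists[OF p_pos] by blast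
  have nz: "\<beta> \<noteq> 0" using \<beta> assms by (auto simp: power_0_left)
  define c :: "nat \<Rightarrow> 'a" where "c i = (if i = 0 then 1 else if i = 1 then - 1 else 0)" for i
  have split: "{..<p} = insert 0 (insert 1 {2..<p})" using p_gt_2 by auto
  have "(\<Sum>i<p. to_ac (c i) * y ^ i) = 1 - y" for y
    unfolding split using p_gt_2 by (simp add: c_def)
  then have "to_ac (det (mult_matrix p b c)) = (\<Prod>j<p. 1 - to_ac \<zeta> ^ j * \<beta>)"
    unfolding to_ac_det_mult_matrix[symmetric] ac.det_mult_matrix[OF \<beta> nz] by simp
  also have "\<dots> = 1 - \<beta> ^ p" by (rule ac.prod_one_minus[OF nz])
  also have "\<dots> = to_ac (1 - b)" by (simp add: \<beta>)
  finally have "1 - b = det (mult_matrix p b c)" by (simp only: to_ac_eq_iff)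
  moreover have "\<forall>i<p. c i \<in> K" by (auto simp: c_def uminus_mem)
  moreover have "\<exists>i<p. c i \<noteq> 0" using p_pos by (intro exI[of _ 0]) (simp add: c_def)
  ultimately show ?thesis unfolding norm_group_def by blast
qed

subsection \<open>Elements whose Steinberg exponent is not trivial\<close>

definition cls :: "'a \<Rightarrow> 'a \<Rightarrow> int \<Rightarrow> int \<Rightarrow> 'a set" where
  "cls x y i j = {x powi i * y powi j * t | t. t \<in> T}"

definition indep2 :: "'a \<Rightarrow> 'a \<Rightarrow> bool" where
  "indep2 x y \<longleftrightarrow> x \<in> K - {0} \<and> y \<in> K - {0} \<and>
     (\<forall>i j. x powi i * y powi j \<in> T \<longrightarrow> int p dvd i \<and> int p dvd j)"

definition stexp :: "'a \<Rightarrow> int \<Rightarrow> bool" where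
  "stexp x i \<longleftrightarrow> (\<exists>t\<in>T. 1 - x = x powi i * t)"

text \<open>Exponents 0 and 1 are those a valuation predicts, \<open>1 - x\<close> having the class
  of its dominant term.\<close>

definition bad :: "int \<Rightarrow> bool" where
  "bad i \<longleftrightarrow> \<not> int p dvd i \<and> \<not> int p dvd i - 1"

lemma T_power_int: "t \<in> T \<Longrightarrow> t powi n \<in> T"
  by (simp add: power_int_def T_power T_inverse)

lemma K_power_int: "x \<in> K \<Longrightarrow> x powi n \<in> K"
  by (simp add: power_int_def power_mem inverse_mem)

lemma cls_mult:
  assumes nz: "x \<noteq> 0" "y \<noteq> 0" and zw: "z \<in> cls x y i j" "w \<in> cls x y k l"
  shows "z * w \<in> cls x y (i + k) (j + l)"
proof -
  obtain s t where st: "z = x powi i * y powi j * s" "w = x powi k * y powi l * t" "s \<in> T" "t \<in> T"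
    using zw by (auto simp: cls_def)
  have "z * w = x powi (i + k) * y powi (j + l) * (s * t)"
    unfolding st using nz by (simp add: power_int_add)
  then show ?thesis using T_mult[OF st(3,4)] unfolding cls_def by blast
qed

lemma cls_power_int:
  assumes "z \<in> cls x y i j"
  shows "z powi n \<in> cls x y (i * n) (j * n)"
proof -
  obtain s where s: "z = x powi i * y powi j * s" "s \<in> T" using assms by (auto simp: cls_def)
  have "z powi n = x powi (i * n) * y powi (j * n) * s powi n"
    unfolding s by (simp add: power_int_mult_distrib power_int_mult)
  then show ?thesis using T_power_int[OF s(2)] unfolding cls_def by blast
qed

lemma cls_T: "t \<in> T \<Longrightarrow> t \<in> cls x y 0 0"
  unfolding cls_def by auto

lemma cls_unique:
  assumes ind: "indep2 x y" and z: "z \<in> cls x y i j" "z \<in> cls x y k l"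
  shows "int p dvd i - k" "int p dvd j - l"
proof -
  have nz: "x \<noteq> 0" "y \<noteq> 0" using ind by (auto simp: indep2_def)
  obtain s t where st: "z = x powi i * y powi j * s" "z = x powi k * y powi l * t" "s \<in> T" "t \<in> T"
    using z unfolding cls_def by blast
  have pw: "x powi k \<noteq> 0" "y powi l \<noteq> 0" using nz by auto
  have "x powi (i - k) * y powi (j - l) = t / s"
    using st(1,2) nz pw T_nz[OF st(3)] by (simp add: power_int_diff field_simps)
  then have "x powi (i - k) * y powi (j - l) \<in> T" using T_divide[OF st(4,3)] by simp
  then show "int p dvd i - k" "int p dvd j - l" using ind unfolding indep2_def by blast+
qed

lemma not_dvd_one: "\<not> int p dvd 1"
  using p_gt_2 by simp

lemma indep2_notin_T:
  assumes "indep2 x y"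
  shows "x \<notin> T" "y \<notin> T" "x * y \<notin> T"
proof -
  have *: "\<And>i j. x powi i * y powi j \<in> T \<Longrightarrow> int p dvd i \<and> int p dvd j"
    using assms by (auto simp: indep2_def)
  show "x \<notin> T" "y \<notin> T" "x * y \<notin> T" using *[of 1 0] *[of 0 1] *[of 1 1] not_dvd_one by auto
qed

lemma prime_int_p: "prime (int p)" using prime_p by simp

end

section \<open>Multiplicativity of exponents and existence of the valuation ring\<close>

locale steinberg_field = root_field K p \<zeta> for K :: "'a::field set" and p \<zeta> +
  assumes steinberg: "\<And>x. x \<in> K \<Longrightarrow> x \<noteq> 0 \<Longrightarrow> x \<notin> T \<Longrightarrow> 1 - x \<in> pspan x"
begin

lemma ex_stexp: "x \<in> K \<Longrightarrow> x \<noteq> 0 \<Longrightarrow> x \<notin> T \<Longrightarrow> \<exists>i. stexp x i"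
proof -
  assume "x \<in> K" "x \<noteq> 0" "x \<notin> T"
  then obtain k t where "1 - x = x ^ k * t" "t \<in> T" using steinberg[of x] by (auto simp: pspan_def)
  then have "stexp x (int k)" by (auto simp: stexp_def)
  then show ?thesis ..
qed

text \<open>In \<open>1 - x * y = (1 - x) * (1 + B)\<close> the class of \<open>B\<close> has
  exponents \<open>1 - i\<close> and \<open>j\<close>. It is nontrivial because \<open>i\<close> is
  not 1 modulo \<open>p\<close>, so \<open>1 + B\<close> has the class of a power of
  \<open>-B\<close>, and \<open>m\<close> is the exponent of that power.\<close>

lemma stexp_product:
  assumes ind: "indep2 x y" and i: "stexp x i" "\<not> int p dvd i - 1" and j: "stexp y j"
    and l: "stexp (x * y) l"
  obtains m where "int p dvd l - i - m * (1 - i)" "int p dvd l - m * j"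
proof -
  have nz: "x \<noteq> 0" "y \<noteq> 0" and K: "x \<in> K" "y \<in> K" using ind by (auto simp: indep2_def)
  have x1: "1 - x \<in> cls x y i 0" using i(1) unfolding stexp_def cls_def by auto
  have y1: "1 - y \<in> cls x y 0 j" using j unfolding stexp_def cls_def by auto
  have xy1: "1 - x * y \<in> cls x y l l"
    using l nz unfolding stexp_def cls_def by (auto simp: power_int_mult_distrib)
  have nz1: "1 - x \<noteq> 0" "1 - y \<noteq> 0" using indep2_notin_T[OF ind] T_one by auto
  define B where "B = x * (1 - y) * (1 - x) powi - 1"
  have xc: "x \<in> cls x y 1 0" unfolding cls_def using T_one by (auto intro!: exI[of _ 1])
  have "B \<in> cls x y (1 + 0 + i * - 1) (0 + j + 0 * - 1)"
    unfolding B_def by (intro cls_mult nz xc y1 cls_power_int x1)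
  then have Bc: "B \<in> cls x y (1 - i) j" by simp
  have BK: "B \<in> K" "B \<noteq> 0" using K nz nz1 by (auto simp: B_def K_power_int)
  have "B \<notin> T"
  proof
    assume "B \<in> T"
    then have "int p dvd (1 - i) - 0" using cls_unique(1)[OF ind Bc cls_T] by simp
    then show False using i(2) by (simp add: dvd_diff_commute)
  qed
  then obtain m t where mt: "1 - (- B) = (- B) powi m * t" "t \<in> T"
    using ex_stexp[of "- B"] BK by (auto simp: stexp_def uminus_mem)
  have "- B \<in> cls x y ((1 - i) + 0) (j + 0)"
    using cls_mult[OF nz Bc cls_T[of "-1"]] by simp
  then have mB: "(- B) powi m \<in> cls x y ((1 - i) * m) (j * m)" using cls_power_int by fastforce
  have "1 - x * y = (1 - x) * (1 - (- B))"
    unfolding B_def using nz1 by (simp add: power_int_minus field_simps)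
  also have "\<dots> = (1 - x) * ((- B) powi m * t)" unfolding mt(1) ..
  also have "\<dots> \<in> cls x y (i + ((1 - i) * m + 0)) (0 + (j * m + 0))"
    by (intro cls_mult nz x1 mB cls_T mt(2))
  finally have "1 - x * y \<in> cls x y (i + (1 - i) * m) (j * m)" by simp
  then have "int p dvd l - (i + (1 - i) * m)" "int p dvd l - j * m"
    using cls_unique[OF ind xy1] by auto
  then show ?thesis using that[of m] by (simp add: algebra_simps)
qed

text \<open>Elimination of \<open>m\<close> from the two congruences of
  \<open>stexp_product\<close>.\<close>

lemma stexp_mult:
  assumes ind: "indep2 x y" and i: "stexp x i" "bad i" and j: "stexp y j" and l: "stexp (x * y) l"
  shows "int p dvd (i + j - 1) * l - i * j"
proof -
  obtain m where m: "int p dvd l - i - m * (1 - i)" "int p dvd l - m * j"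
    using stexp_product[OF ind i(1) _ j l] i(2) by (auto simp: bad_def)
  have "int p dvd (i + j - 1) * (l - m * j) + j * ((l - i - m * (1 - i)) - (l - m * j))"
    by (rule dvd_add[OF dvd_mult[OF m(2)] dvd_mult[OF dvd_diff[OF m]]])
  then show "int p dvd (i + j - 1) * l - i * j" by (simp add: algebra_simps)
qed

text \<open>Modulo \<open>p\<close>, \<open>(i + j - 1) * l\<close> is the nonzero
  \<open>i * j\<close>, and \<open>l = 1\<close> would give \<open>(i - 1) * (j - 1) = 0\<close>.
  This allows the product relation to be iterated.\<close>

lemma stexp_bad_product:
  assumes ind: "indep2 x y" and i: "stexp x i" "bad i" and j: "stexp y j" "bad j"
    and l: "stexp (x * y) l"
  shows "bad l" "\<not> int p dvd i + j - 1"
proof -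
  note d = stexp_mult[OF ind i j(1) l]
  have ij: "\<not> int p dvd i * j" using i j prime_int_p by (auto simp: bad_def prime_dvd_mult_iff)
  have *: "\<not> int p dvd (i + j - 1) * l"
    using d ij by (metis dvd_diff_right_iff)
  then show "\<not> int p dvd i + j - 1" by auto
  show "bad l" unfolding bad_def
  proof
    show "\<not> int p dvd l" using * by auto
    show "\<not> int p dvd l - 1"
    proof
      assume "int p dvd l - 1"
      then have "int p dvd (i + j - 1) * (l - 1)" by simp
      then have "int p dvd ((i + j - 1) * l - i * j) - (i + j - 1) * (l - 1)" by (rule dvd_diff[OF d])
      then have "int p dvd - ((i - 1) * (j - 1))" by (simp add: algebra_simps)
      then show False using i j prime_int_p by (auto simp: bad_def prime_dvd_mult_iff)
    qed
  qed
qed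

lemma indep2_twist:
  assumes "indep2 x y"
  shows "indep2 (x * y ^ r) y" and "\<not> p dvd r \<Longrightarrow> indep2 x (y ^ r)"
proof -
  have nz: "x \<noteq> 0" "y \<noteq> 0" and K: "x \<in> K" "y \<in> K" using assms by (auto simp: indep2_def)
  have *: "\<And>i j. x powi i * y powi j \<in> T \<Longrightarrow> int p dvd i \<and> int p dvd j"
    using assms by (auto simp: indep2_def)
  show "indep2 (x * y ^ r) y"
    unfolding indep2_def
  proof (intro conjI allI impI)
    fix i j assume "(x * y ^ r) powi i * y powi j \<in> T"
    moreover have "(x * y ^ r) powi i * y powi j = x powi i * y powi (int r * i + j)"
      using nz by (simp add: power_int_mult_distrib power_int_add power_int_mult)
    ultimately have "int p dvd i \<and> int p dvd int r * i + j" using * by simp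
    then show "int p dvd i" "int p dvd j" by (auto simp: dvd_add_right_iff)
  qed (use nz K in auto)
  show "indep2 x (y ^ r)" if "\<not> p dvd r"
    unfolding indep2_def
  proof (intro conjI allI impI)
    fix i j assume "x powi i * (y ^ r) powi j \<in> T"
    moreover have "(y ^ r) powi j = y powi (int r * j)" by (simp add: power_int_mult)
    ultimately have "int p dvd i \<and> int p dvd int r * j" using * by simp
    moreover have "\<not> int p dvd int r" using that by simp
    ultimately show "int p dvd i" "int p dvd j" using prime_int_p by (auto simp: prime_dvd_mult_iff)
  qed (use nz K in auto)
qed

lemma fermat_int: "\<not> int p dvd j \<Longrightarrow> int p dvd j ^ (p - 1) - 1"
proof -
  assume n: "\<not> int p dvd j"
  define k where "k = nat (j mod int p)"
  have k: "int k = j mod int p" using p_pos by (simp add: k_def)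
  have "\<not> p dvd k" using n k by (metis dvd_mod_iff dvd_refl int_dvd_int_iff)
  then have "[k ^ (p - 1) = 1] (mod p)" using fermat_theorem[OF prime_p] by blast
  then have "[int k ^ (p - 1) = 1] (mod int p)" using cong_int_iff[of "k ^ (p - 1)" 1 p] by simp
  moreover have "[int k ^ (p - 1) = j ^ (p - 1)] (mod int p)"
    by (intro cong_pow) (simp add: k cong_def)
  ultimately have "[j ^ (p - 1) = 1] (mod int p)" using cong_sym cong_trans by blast
  then show ?thesis by (simp add: cong_iff_dvd_diff)
qed

text \<open>\<open>i \<mapsto> (i - 1)/i\<close> is multiplicative along independent classes with bad exponents, while
  by Fermat it would be trivial on \<open>(p-1)\<close>-st powers.\<close>

lemma no_two_bad:
  assumes ind: "indep2 x y" and i: "stexp x i" "bad i" and j: "stexp y j" "bad j"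
  shows False
proof -
  have nz: "x \<noteq> 0" "y \<noteq> 0" and K: "x \<in> K" "y \<in> K" using ind by (auto simp: indep2_def)
  \<comment> \<open>The product formula for \<open>(l - 1)/l\<close>, cross-multiplied to avoid
    division modulo \<open>p\<close>.\<close>
  have chain: "\<exists>l. stexp (x * y ^ r) l \<and> bad l \<and>
      int p dvd (l - 1) * (i * j ^ r) - l * ((i - 1) * (j - 1) ^ r)" for r
  proof (induction r)
    case 0
    show ?case using i by (intro exI[of _ i]) (simp add: algebra_simps)
  next
    case (Suc r)
    then obtain l where l: "stexp (x * y ^ r) l" "bad l"
      "int p dvd (l - 1) * (i * j ^ r) - l * ((i - 1) * (j - 1) ^ r)" by blast
    have ind': "indep2 (x * y ^ r) y" by (rule indep2_twist(1)[OF ind])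
    obtain l' where l': "stexp (x * y ^ r * y) l'"
      using ex_stexp[of "x * y ^ r * y"] indep2_notin_T(3)[OF ind'] K nz by auto
    note d = stexp_mult[OF ind' l(1,2) j(1) l'] and b = stexp_bad_product[OF ind' l(1,2) j l']
    let ?s = "l + j - 1" and ?A = "i * j ^ r" and ?C = "(i - 1) * (j - 1) ^ r"
    have "int p dvd (?s * l' - l * j) * (j * ?A - (j - 1) * ?C) + j * (j - 1) * ((l - 1) * ?A - l * ?C)"
      by (rule dvd_add[OF dvd_mult2[OF d] dvd_mult[OF l(3)]])
    also have "(?s * l' - l * j) * (j * ?A - (j - 1) * ?C) + j * (j - 1) * ((l - 1) * ?A - l * ?C) =
        ?s * ((l' - 1) * (j * ?A) - l' * ((j - 1) * ?C))"
      by (simp add: algebra_simps)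
    finally have "int p dvd (l' - 1) * (j * ?A) - l' * ((j - 1) * ?C)"
      using b(2) prime_int_p by (auto simp: prime_dvd_mult_iff)
    then show ?case
      using l' b(1) by (intro exI[of _ l']) (auto simp: mult_ac)
  qed
  obtain l where l: "stexp (x * y ^ (p - 1)) l" "bad l"
    "int p dvd (l - 1) * (i * j ^ (p - 1)) - l * ((i - 1) * (j - 1) ^ (p - 1))"
    using chain[of "p - 1"] by blast
  \<comment> \<open>By Fermat the factors coming from \<open>y\<close> are 1, so
    \<open>x * y ^ (p - 1)\<close> has the exponent of \<open>x\<close>.\<close>
  have "int p dvd j ^ (p - 1) - 1" "int p dvd (j - 1) ^ (p - 1) - 1"
    using j(2) fermat_int by (auto simp: bad_def)
  then have "int p dvd ((l - 1) * (i * j ^ (p - 1)) - l * ((i - 1) * (j - 1) ^ (p - 1)))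
      - (l - 1) * i * (j ^ (p - 1) - 1) + l * (i - 1) * ((j - 1) ^ (p - 1) - 1)"
    by (intro dvd_add[OF dvd_diff[OF l(3) dvd_mult] dvd_mult])
  then have li: "int p dvd l - i" by (simp add: algebra_simps)
  have "\<not> p dvd p - 1" using p_gt_2 by (auto dest: dvd_imp_le)
  then have ind': "indep2 x (y ^ (p - 1))" by (rule indep2_twist(2)[OF ind])
  \<comment> \<open>The same product is now read with \<open>y ^ (p - 1)\<close> as one factor:
    whatever its exponent \<open>k\<close>, the equality of \<open>l\<close> and \<open>i\<close>
    forces \<open>i * (i - 1) = 0\<close>.\<close>
  obtain k where k: "stexp (y ^ (p - 1)) k"
    using ex_stexp[of "y ^ (p - 1)"] indep2_notin_T(2)[OF ind'] K nz by auto
  have "int p dvd (i + k - 1) * l - i * k" by (rule stexp_mult[OF ind' i k l(1)])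
  then have "int p dvd ((i + k - 1) * l - i * k) - (i + k - 1) * (l - i)"
    by (rule dvd_diff[OF _ dvd_mult[OF li]])
  then have "int p dvd i * (i - 1)" by (simp add: algebra_simps)
  then show False using i(2) prime_int_p by (auto simp: bad_def prime_dvd_mult_iff)
qed

lemma stexp_not_bad:
  assumes "x \<noteq> 0" "x \<in> K" "stexp x i" "\<not> bad i"
  shows "1 - x \<in> T \<or> inverse x * (1 - x) \<in> T"
proof -
  obtain t where t: "t \<in> T" "1 - x = x powi i * t" using assms by (auto simp: stexp_def)
  have pT: "x powi (int p * q) \<in> T" for q
    using T_power_int[OF power_in_T[OF assms(2,1)], of q] by (simp add: power_int_mult)
  consider "int p dvd i" | "int p dvd i - 1" using assms(4) by (auto simp: bad_def)
  then show ?thesis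
  proof cases
    case 1
    then show ?thesis using t pT T_mult by (auto simp: dvd_def)
  next
    case 2
    then obtain q where q: "i - 1 = int p * q" by (auto simp: dvd_def)
    have "inverse x * (1 - x) = x powi (i - 1) * t"
      unfolding t(2) using assms(1) by (simp add: power_int_diff field_simps)
    moreover have "x powi (i - 1) * t \<in> T" unfolding q by (rule T_mult[OF pT t(1)])
    ultimately show ?thesis by simp
  qed
qed

text \<open>Classes modulo \<open>T\<close> form a vector space over the field with \<open>p\<close>
  elements. \<open>red\<close> replaces integer exponents by their residues, to match the natural
  exponents of \<open>pspan\<close>.\<close>

lemma indep2_I:
  assumes u: "u \<in> K" "u \<noteq> 0" "u \<notin> T" and x: "x \<in> K" "x \<noteq> 0" "x \<notin> pspan u"
  shows "indep2 u x"
  unfolding indep2_def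
proof (intro conjI allI impI)
  have red: "\<exists>n. z powi i / z ^ n \<in> T \<and> (int p dvd i \<longleftrightarrow> p dvd n)" if z: "z \<in> K" "z \<noteq> 0" for z i
  proof -
    define n where "n = nat (i mod int p)"
    have n: "int n = i mod int p" using p_pos by (simp add: n_def)
    have "i - int n = int p * (i div int p)" using n by (simp add: minus_mod_eq_mult_div)
    then have "z powi (i - int n) = (z ^ p) powi (i div int p)" by (simp add: power_int_mult)
    then have "z powi (i - int n) \<in> T" using T_power_int[OF power_in_T[OF z]] by simp
    moreover have "int p dvd i \<longleftrightarrow> p dvd n" using n by (metis dvd_mod_iff dvd_refl int_dvd_int_iff)
    ultimately show ?thesis using z by (intro exI[of _ n]) (simp add: power_int_diff)
  qed
  fix i j assume h: "u powi i * x powi j \<in> T"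
  obtain m where m: "u powi i / u ^ m \<in> T" "int p dvd i \<longleftrightarrow> p dvd m" using red[OF u(1,2)] by blast
  obtain n where n: "x powi j / x ^ n \<in> T" "int p dvd j \<longleftrightarrow> p dvd n" using red[OF x(1,2)] by blast
  have pw: "u powi i \<noteq> 0" "x powi j \<noteq> 0" using u x by auto
  have "u ^ m * x ^ n = (u powi i * x powi j) / ((u powi i / u ^ m) * (x powi j / x ^ n))"
    using u x pw by (simp add: field_simps)
  then have mn: "u ^ m * x ^ n \<in> T" using T_divide[OF h T_mult[OF m(1) n(1)]] by simp
  have "x ^ n = (u ^ m * x ^ n) / u ^ m" using u by simp
  moreover have "(u ^ m * x ^ n) / u ^ m \<in> pspan u"
    using mn T_subset_pspan pspan_power[OF gen_in_pspan] u by (intro pspan_divide) auto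
  ultimately have "x ^ n \<in> pspan u" by metis
  then have pn: "p dvd n" using pspan_root x by blast
  then show "int p dvd j" using n by simp
  obtain q where "n = q * p" using pn by (auto simp: dvd_def mult.commute)
  then have "x ^ n \<in> T" using power_in_T[of "x ^ q"] x by (auto simp: power_mult)
  then have "u ^ m \<in> T" using mn T_mult_right_iff by blast
  then show "int p dvd i" using T_root[OF u(1,2)] u(3) m by blast
qed (use u x in auto)

text \<open>If a bad class exists, it serves as \<open>u\<close>, and elements outside
  \<open>pspan u\<close> are independent of it, hence not bad. If none exists, \<open>u = 1\<close>
  gives \<open>H = T\<close>.\<close>

lemma ex_rigid_val: "\<exists>V u. rigid_val K p \<zeta> V u"
proof -
  obtain u where u: "u \<in> K" "u \<noteq> 0"
    "\<And>x. x \<in> K \<Longrightarrow> x \<noteq> 0 \<Longrightarrow> x \<notin> pspan u \<Longrightarrow> 1 - x \<in> T \<or> inverse x * (1 - x) \<in> T"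
  proof (cases "\<exists>u i. u \<in> K \<and> u \<noteq> 0 \<and> u \<notin> T \<and> stexp u i \<and> bad i")
    case True
    then obtain u i where u: "u \<in> K" "u \<noteq> 0" "u \<notin> T" "stexp u i" "bad i" by blast
    show ?thesis
    proof (rule that[OF u(1,2)])
      fix x assume x: "x \<in> K" "x \<noteq> 0" "x \<notin> pspan u"
      then have "x \<notin> T" using T_subset_pspan by auto
      then obtain j where j: "stexp x j" using ex_stexp x by blast
      have "\<not> bad j" using no_two_bad[OF indep2_I[OF u(1-3) x] u(4,5) j] by blast
      then show "1 - x \<in> T \<or> inverse x * (1 - x) \<in> T" using stexp_not_bad x j by blast
    qed
  next
    case False
    show ?thesis
    proof (rule that[of 1])
      fix x assume x: "x \<in> K" "x \<noteq> 0" "x \<notin> pspan 1"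
      then have "x \<notin> T" using T_subset_pspan by auto
      then obtain j where j: "stexp x j" using ex_stexp x by blast
      then have "\<not> bad j" using False x \<open>x \<notin> T\<close> by blast
      then show "1 - x \<in> T \<or> inverse x * (1 - x) \<in> T" using stexp_not_bad x j by blast
    qed auto
  qed
  have neg: "- x \<in> pspan u \<longleftrightarrow> x \<in> pspan u" for x
  proof -
    have "- 1 \<in> T" by simp
    then have "- 1 \<in> pspan u" using T_subset_pspan by blast
    then show ?thesis using pspan_mult[of "-1" u x] pspan_mult[of "-1" u "-x"] by auto
  qed
  interpret W: ware K T "pspan u"
  proof
    show "pspan u \<subseteq> K - {0}" using pspan_memD pspan_nz u by auto
    show "T \<subseteq> pspan u" by (rule T_subset_pspan)
    show "x \<in> pspan u" if "x \<in> K" "x ^ 2 \<in> pspan u" for x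
    proof (rule pspan_root)
      show "x ^ 2 \<in> pspan u" by fact
      show "x \<noteq> 0" using pspan_nz[OF that(2)] u by auto
      show "\<not> p dvd 2" using p_gt_2 by (auto dest: dvd_imp_le)
    qed fact
    show "1 + x \<in> T \<or> inverse x * (1 + x) \<in> T" if "x \<in> K" "x \<noteq> 0" "x \<notin> pspan u" for x
    proof -
      have "1 - (- x) \<in> T \<or> inverse (- x) * (1 - (- x)) \<in> T" using u(3)[of "-x"] that neg by auto
      then show ?thesis by auto
    qed
  qed (auto simp: T_mult T_inverse pspan_mult pspan_inverse u)
  have "rigid_val K p \<zeta> W.W u"
  proof
    show "1 + x \<in> T" if "x \<in> W.val.M" for x using W.val_M that .
    show "W.val.U \<subseteq> pspan u" by (rule W.val_U)
  qed (rule u)+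
  then show ?thesis by blast
qed

end

section \<open>Rigidity of fields with such a valuation\<close>

context subfield_set
begin

lemma poly_division:
  assumes g: "\<And>i. poly.coeff g i \<in> K" "poly.coeff g d = 1" "\<And>i. i > d \<Longrightarrow> poly.coeff g i = 0"
    and f: "\<And>i. poly.coeff f i \<in> K"
  obtains s r where "\<And>i. poly.coeff r i \<in> K" "\<And>i. i \<ge> d \<Longrightarrow> poly.coeff r i = 0" "f = g * s + r"
proof -
  have "\<exists>s r. (\<forall>i. poly.coeff r i \<in> K) \<and> (\<forall>i\<ge>d. poly.coeff r i = 0) \<and> f = g * s + r"
    if "\<And>i. poly.coeff f i \<in> K" "\<And>i. i \<ge> n \<Longrightarrow> poly.coeff f i = 0" for f n
    using that
  proof (induction n arbitrary: f)
    case 0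
    then have "f = 0" by (intro poly_eqI) auto
    then show ?case by (intro exI[of _ 0]) auto
  next
    case (Suc n)
    show ?case
    proof (cases "n < d")
      case True
      then show ?thesis using Suc.prems by (intro exI[of _ 0] exI[of _ f]) auto
    next
      case False
      define m where "m = Polynomial.monom (poly.coeff f n) (n - d)"
      have cm: "poly.coeff (m * g) i = (if n - d \<le> i then poly.coeff f n * poly.coeff g (i - (n - d)) else 0)" for i
        by (simp add: m_def coeff_monom_mult)
      have "\<exists>s r. (\<forall>i. poly.coeff r i \<in> K) \<and> (\<forall>i\<ge>d. poly.coeff r i = 0) \<and> f - m * g = g * s + r"
      proof (rule Suc.IH)
        show "poly.coeff (f - m * g) i \<in> K" for i using Suc.prems(1) g(1) by (auto simp: cm)
        show "poly.coeff (f - m * g) i = 0" if "i \<ge> n" for i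
        proof (cases "i = n")
          case True
          then show ?thesis using False g(2) by (simp add: cm)
        next
          case ne: False
          then have "i - (n - d) > d" using that False by simp
          then show ?thesis using Suc.prems(2)[of i] g(3) that ne by (simp add: cm)
        qed
      qed
      then obtain s r where "\<forall>i. poly.coeff r i \<in> K" "\<forall>i\<ge>d. poly.coeff r i = 0" "f - m * g = g * s + r"
        by blast
      moreover from this have "f = g * (s + m) + r" by (simp add: algebra_simps)
      ultimately show ?thesis by blast
    qed
  qed
  moreover have "\<And>i. i \<ge> Suc (Polynomial.degree f) \<Longrightarrow> poly.coeff f i = 0" by (simp add: coeff_eq_0)
  ultimately show ?thesis using that f by blast
qed

end

text \<open>A proper factor of \<open>X^p - b\<close> of degree \<open>d\<close> has a constant term whose \<open>p\<close>-th power
  is \<open>\<plusminus>b^d\<close>.\<close>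

lemma kummer_independent:
  fixes K :: "'a::alg_closed_field set"
  assumes "root_field K p \<zeta>" and b: "b \<in> K" "b \<noteq> 0" "b \<notin> pth_powers K p" and \<beta>: "\<beta> ^ p = b"
    and c: "\<forall>i<p. c i \<in> K" "(\<Sum>i<p. c i * \<beta> ^ i) = 0" and k: "k < p"
  shows "c k = 0"
proof (rule ccontr)
  interpret root_field K p \<zeta> by fact
  assume ck: "c k \<noteq> 0"
  \<comment> \<open>\<open>q\<close> is monic of degree \<open>d\<close> over \<open>K\<close> with
    root \<open>\<beta>\<close>; the least such \<open>d\<close> is the degree of the minimal
    polynomial.\<close>
  define P where "P d q \<longleftrightarrow> (\<forall>i. poly.coeff q i \<in> K) \<and> poly.coeff q d = 1 \<and>
    (\<forall>i>d. poly.coeff q i = 0) \<and> poly q \<beta> = 0" for d and q :: "'a poly"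
  have mk: "\<exists>d<n. \<exists>q. P d q"
    if r: "\<And>i. poly.coeff r i \<in> K" "\<And>i. i \<ge> n \<Longrightarrow> poly.coeff r i = 0" "poly r \<beta> = 0" "r \<noteq> 0" for r n
  proof -
    let ?d = "Polynomial.degree r"
    have lc: "poly.coeff r ?d \<noteq> 0" using r(4) by simp
    then have "?d < n" using r(2)[of ?d] by (cases "?d < n") auto
    moreover have "P ?d (Polynomial.smult (inverse (poly.coeff r ?d)) r)"
      unfolding P_def using r lc by (auto simp: coeff_eq_0)
    ultimately show ?thesis by blast
  qed
  define q0 where "q0 = (\<Sum>i<p. Polynomial.monom (c i) i)"
  have cq0: "poly.coeff q0 i = (if i < p then c i else 0)" for i
    unfolding q0_def coeff_sum by (simp add: sum.delta)
  have "\<exists>d<p. \<exists>q. P d q"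
  proof (rule mk)
    show "poly.coeff q0 i \<in> K" for i using c(1) by (simp add: cq0)
    show "poly.coeff q0 i = 0" if "i \<ge> p" for i using that by (simp add: cq0)
    show "poly q0 \<beta> = 0" using c(2) by (simp add: q0_def poly_sum poly_monom)
    show "q0 \<noteq> 0" using cq0[of k] k ck by auto
  qed
  then obtain d0 where d0: "d0 < p" "\<exists>q. P d0 q" by blast
  define d where "d = (LEAST d. \<exists>q. P d q)"
  obtain q where q: "P d q" using LeastI[of "\<lambda>d. \<exists>q. P d q", OF d0(2)] by (auto simp: d_def)
  have dp: "d < p" using Least_le[of "\<lambda>d. \<exists>q. P d q", OF d0(2)] d0(1) by (simp add: d_def)
  have least: "d \<le> d'" if "\<exists>q. P d' q" for d' using Least_le[of "\<lambda>d. \<exists>q. P d q", OF that] by (simp add: d_def)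
  have qd: "\<And>i. poly.coeff q i \<in> K" "poly.coeff q d = 1" "\<And>i. i > d \<Longrightarrow> poly.coeff q i = 0" "poly q \<beta> = 0"
    using q by (auto simp: P_def)
  define f where "f = Polynomial.monom 1 p - [:b:]"
  have fK: "poly.coeff f i \<in> K" for i
    unfolding f_def using b by (auto simp: coeff_pCons split: nat.splits)
  obtain s r where r: "\<And>i. poly.coeff r i \<in> K" "\<And>i. i \<ge> d \<Longrightarrow> poly.coeff r i = 0" "f = q * s + r"
    using poly_division[OF qd(1-3) fK] by blast
  \<comment> \<open>A nonzero remainder, made monic, would contradict minimality. Hence
    \<open>q\<close> divides \<open>X^p - b\<close> and each of its roots is a \<open>p\<close>-th
    root of \<open>b\<close>.\<close>
  have "r = 0"
  proof (rule ccontr)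
    assume "r \<noteq> 0"
    moreover have "poly r \<beta> = 0"
      using arg_cong[OF r(3), of "\<lambda>f. poly f \<beta>"] qd(4) \<beta> by (simp add: f_def poly_monom)
    ultimately obtain d' where "d' < d" "\<exists>q. P d' q" using mk[OF r(1,2)] by blast
    then show False using least by fastforce
  qed
  then have fq: "f = q * s" using r(3) by simp
  have "q \<noteq> 0" using qd(2) by auto
  have degq: "Polynomial.degree q = d"
    using qd(2,3) by (intro antisym degree_le le_degree) auto
  obtain A where A: "size A = Polynomial.degree q"
    "q = Polynomial.smult (lead_coeff q) (\<Prod>x\<in>#A. [:- x, 1:])"
    using alg_closed_imp_factorization[OF \<open>q \<noteq> 0\<close>] by blast
  have q_eq: "q = (\<Prod>x\<in>#A. [:- x, 1:])" using A(2) degq qd(2) by simp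
  have root: "x ^ p = b" if "x \<in># A" for x
  proof -
    have "poly q x = 0"
      unfolding q_eq using that by (simp add: poly_prod_mset prod_mset_zero_iff)
    then have "poly f x = 0" unfolding fq by simp
    then show ?thesis by (simp add: f_def poly_monom)
  qed
  define t where "t = poly.coeff q 0"
  have "t = poly q 0" by (simp add: t_def poly_0_coeff_0)
  also have "\<dots> = (\<Prod>x\<in>#A. - x)" by (subst q_eq) (simp add: poly_prod_mset)
  finally have t: "t = (\<Prod>x\<in>#A. - x)" .
  have "(\<Prod>x\<in>#B. - x) ^ p = (- b) ^ size B" if "\<forall>x\<in>#B. x ^ p = b" for B
    using that by (induction B) (auto simp: power_mult_distrib odd_p)
  then have tp: "t ^ p = (- b) ^ d" using root A(1) degq by (simp add: t)
  have tK: "t \<in> K" using qd(1) by (simp add: t_def)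
  have tnz: "t \<noteq> 0" using tp b(2) by (auto simp: power_0_left)
  have "(- b) ^ d \<in> T" using power_in_T[OF tK tnz] tp by simp
  moreover have "d \<noteq> 0"
  proof
    assume d: "d = 0"
    then have "q = [:1:]"
      using qd(2,3) by (intro poly_eqI) (auto simp: coeff_pCons split: nat.splits)
    then show False using qd(4) by simp
  qed
  ultimately have "- b \<in> T"
    using T_root[of "- b" d] b dp nat_dvd_not_less[of d p] by (simp add: uminus_mem)
  then show False using b(3) by simp
qed

context root_field
begin

text \<open>Replacing \<open>c i\<close> by \<open>c i / y ^ i\<close> compensates the change of
  root from \<open>\<beta>\<close> to \<open>\<beta> * y\<close> in every conjugate factor.\<close>

lemma norm_group_scale:
  assumes "\<beta> ^ p = b" "b \<noteq> 0" "y \<in> K" "y \<noteq> 0"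
  shows "norm_group K p b \<subseteq> norm_group K p (b * y ^ p)"
proof
  fix z assume "z \<in> norm_group K p b"
  then obtain c where c: "z = det (mult_matrix p b c)" "\<forall>i<p. c i \<in> K" "\<exists>i<p. c i \<noteq> 0"
    by (auto simp: norm_group_def)
  define d where "d i = c i / y ^ i" for i
  have nz: "\<beta> \<noteq> 0" using assms by (auto simp: power_0_left)
  have p1: "(\<beta> * y) ^ p = b * y ^ p" by (simp add: assms(1) power_mult_distrib)
  have "z = (\<Prod>j<p. \<Sum>i<p. c i * (\<zeta> ^ j * \<beta>) ^ i)"
    unfolding c(1) by (rule det_mult_matrix[OF assms(1) nz])
  also have "\<dots> = (\<Prod>j<p. \<Sum>i<p. d i * (\<zeta> ^ j * (\<beta> * y)) ^ i)"
    using assms(4) by (simp add: d_def power_mult_distrib)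
  also have "\<dots> = det (mult_matrix p (b * y ^ p) d)"
    using nz assms(4) by (intro det_mult_matrix[OF p1, symmetric]) auto
  finally have "z = det (mult_matrix p (b * y ^ p) d)" .
  moreover have "\<forall>i<p. d i \<in> K" using c(2) assms(3) by (auto simp: d_def)
  moreover have "\<exists>i<p. d i \<noteq> 0" using c(3) assms(4) by (auto simp: d_def)
  ultimately show "z \<in> norm_group K p (b * y ^ p)" unfolding norm_group_def by blast
qed

lemma pspan_scale: "y \<in> K \<Longrightarrow> y \<noteq> 0 \<Longrightarrow> pspan (b * y ^ p) \<subseteq> pspan b"
  using pspan_mult[OF gen_in_pspan[of b]] power_in_T[of y] T_subset_pspan by (intro pspan_subset) blast

end

text \<open>Either \<open>b\<close> can be rescaled by a \<open>p\<close>-th power to a unit, or it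
  is ramified; the type class supplies the root and the independence required by
  \<open>kummer\<close>.\<close>

lemma p_rigid_elem_alg_closed:
  fixes K :: "'a::alg_closed_field set"
  assumes "rigid_val K p \<zeta> V u" and b: "b \<in> K" "b \<noteq> 0" "b \<notin> pth_powers K p"
  shows "p_rigid_elem K p b"
proof -
  interpret rigid_val K p \<zeta> V u by fact
  have main: "norm_group K p b \<subseteq> pspan b"
    if b: "b \<in> K" "b \<noteq> 0" "b \<notin> T" and ur: "b \<in> U \<or> (\<forall>y\<in>K. b * y ^ p \<notin> U)" for b
  proof -
    obtain \<beta> where \<beta>: "\<beta> ^ p = b" using nth_root_exists[OF p_pos] by blast
    interpret kummer_rigid_val K p \<zeta> b \<beta> V u
    proof
      show "c i = 0" if "\<forall>i<p. c i \<in> K" "(\<Sum>i<p. c i * \<beta> ^ i) = 0" "i < p" for c i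
        using kummer_independent[OF root_field_axioms b \<beta> that] .
    qed (use b \<beta> in auto)
    show ?thesis unfolding norm_group_eq using norm_in_pspan[OF ur] by auto
  qed
  have "norm_group K p b \<subseteq> pspan b"
  proof (cases "\<exists>y\<in>K. b * y ^ p \<in> U")
    case True
    then obtain y where y: "y \<in> K" "b * y ^ p \<in> U" by blast
    have ynz: "y \<noteq> 0" using U_nz[OF y(2)] by (auto simp: power_0_left)
    obtain \<beta> where \<beta>: "\<beta> ^ p = b" using nth_root_exists[OF p_pos] by blast
    have "b * y ^ p \<notin> T" using b(3) T_mult_right_iff[OF power_in_T[OF y(1) ynz]] by blast
    then have "norm_group K p (b * y ^ p) \<subseteq> pspan (b * y ^ p)"
      using b y ynz by (intro main) auto
    then show ?thesis
      using norm_group_scale[OF \<beta> b(2) y(1) ynz] pspan_scale[OF y(1) ynz, of b] by blast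
  next
    case False
    then show ?thesis using b by (intro main) auto
  qed
  then show ?thesis using b by (simp add: p_rigid_elem_iff)
qed

section \<open>Transfer of rigidity from the algebraic closure\<close>

lemma pth_powers_to_ac: "pth_powers (to_ac ` K) p = to_ac ` pth_powers K p"
proof
  show "to_ac ` pth_powers K p \<subseteq> pth_powers (to_ac ` K) p"
  proof
    fix z assume "z \<in> to_ac ` pth_powers K p"
    then obtain y where "z = to_ac y ^ p" "y \<in> K" "y \<noteq> 0" by (auto simp: pth_powers_def)
    then have "z = to_ac y ^ p \<and> to_ac y \<in> to_ac ` K \<and> to_ac y \<noteq> 0" by simp
    then show "z \<in> pth_powers (to_ac ` K) p" unfolding pth_powers_def by blast
  qed
  show "pth_powers (to_ac ` K) p \<subseteq> to_ac ` pth_powers K p"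
  proof
    fix z assume "z \<in> pth_powers (to_ac ` K) p"
    then obtain y where "z = to_ac (y ^ p)" "y \<in> K" "y \<noteq> 0" by (auto simp: pth_powers_def)
    then show "z \<in> to_ac ` pth_powers K p" by (auto simp: pth_powers_def simp del: to_ac_power)
  qed
qed

text \<open>An arbitrary \<open>b\<close> may have no \<open>p\<close>-th root in the ambient type,
  so field and valuation ring are carried along \<open>to_ac\<close>, with which the determinantal
  norms are compatible.\<close>

lemma p_rigid_rigid_val:
  assumes "rigid_val K p \<zeta> V u"
  shows "p_rigid K p"
  unfolding p_rigid_def
proof
  interpret rigid_val K p \<zeta> V u by fact
  interpret ac: root_field "to_ac ` K" p "to_ac \<zeta>" by (rule root_field_to_ac)
  interpret ac: val_ring "to_ac ` K" "to_ac ` V"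
  proof
    show "to_ac ` V \<subseteq> to_ac ` K" using V_subset by auto
    show "0 \<in> to_ac ` V" "1 \<in> to_ac ` V" using V_zero V_one to_ac_0 to_ac_1 by (metis image_eqI)+
    show "x + y \<in> to_ac ` V" "x * y \<in> to_ac ` V" if "x \<in> to_ac ` V" "y \<in> to_ac ` V" for x y
      using that V_add V_mult by (auto simp flip: to_ac_add to_ac_mult)
    show "- x \<in> to_ac ` V" if "x \<in> to_ac ` V" for x
      using that V_uminus by (auto simp flip: to_ac_minus)
    show "x \<in> to_ac ` V \<or> inverse x \<in> to_ac ` V" if x: "x \<in> to_ac ` K" "x \<noteq> 0" for x
    proof -
      obtain y where "x = to_ac y" "y \<in> K" "y \<noteq> 0" using x by auto
      then show ?thesis using V_total[of y] by (auto simp flip: to_ac_inverse)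
    qed
  qed
  have inv_V: "inverse (to_ac x) \<in> to_ac ` V \<longleftrightarrow> inverse x \<in> V" for x
    by (simp add: inj_image_mem_iff[OF inj_to_ac] flip: to_ac_inverse)
  have im: "{y \<in> to_ac ` V. P y} = to_ac ` {x \<in> V. P (to_ac x)}" for P by auto
  have M: "ac.M = to_ac ` M" unfolding ac.M_def M_def im inv_V by simp
  have U: "ac.U = to_ac ` U" unfolding ac.U_def U_def im inv_V by simp
  have rv: "rigid_val (to_ac ` K) p (to_ac \<zeta>) (to_ac ` V) (to_ac u)"
  proof
    show "1 + x \<in> ac.T" if x: "x \<in> ac.M" for x
    proof -
      obtain y where y: "x = to_ac y" "y \<in> M" using x M by auto
      then have "to_ac (1 + y) \<in> ac.T" unfolding pth_powers_to_ac using one_plus_M_T by blast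
      then show ?thesis using y by simp
    qed
    show "to_ac u \<in> to_ac ` K" "to_ac u \<noteq> 0" using u_mem u_nz by auto
    show "ac.U \<subseteq> ac.pspan (to_ac u)"
    proof
      fix x assume "x \<in> ac.U"
      then obtain y where y: "x = to_ac y" "y \<in> U" using U by auto
      then obtain k t where "y = u ^ k * t" "t \<in> T" using U_span by (auto simp: pspan_def)
      then have "x = to_ac u ^ k * to_ac t" "to_ac t \<in> ac.T" using y by (auto simp: pth_powers_to_ac)
      then show "x \<in> ac.pspan (to_ac u)" using ac.pspanI by simp
    qed
  qed
  fix b assume b: "b \<in> K - {0} - T"
  have "to_ac b \<notin> ac.T"
    unfolding pth_powers_to_ac using b by (simp add: inj_image_mem_iff[OF inj_to_ac])
  then have "p_rigid_elem (to_ac ` K) p (to_ac b)" using b by (intro p_rigid_elem_alg_closed[OF rv]) auto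
  then have ng: "norm_group (to_ac ` K) p (to_ac b) \<subseteq> ac.pspan (to_ac b)" by (simp add: ac.p_rigid_elem_iff)
  have "norm_group K p b \<subseteq> pspan b"
  proof
    fix z assume "z \<in> norm_group K p b"
    then obtain c where c: "z = det (mult_matrix p b c)" "\<forall>i<p. c i \<in> K" "\<exists>i<p. c i \<noteq> 0"
      by (auto simp: norm_group_def)
    have "to_ac z = det (mult_matrix p (to_ac b) (\<lambda>i. to_ac (c i)))"
      unfolding c(1) by (rule to_ac_det_mult_matrix[symmetric])
    moreover have "\<forall>i<p. to_ac (c i) \<in> to_ac ` K" "\<exists>i<p. to_ac (c i) \<noteq> 0" using c by auto
    ultimately have "to_ac z \<in> norm_group (to_ac ` K) p (to_ac b)"
      unfolding norm_group_def by (intro CollectI exI[of _ "\<lambda>i. to_ac (c i)"]) auto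
    then have "to_ac z \<in> ac.pspan (to_ac b)" using ng by auto
    then obtain k t where kt: "to_ac z = to_ac b ^ k * to_ac t" "t \<in> T"
      unfolding ac.pspan_def pth_powers_to_ac by auto
    then have "z = b ^ k * t" by (simp flip: to_ac_power to_ac_mult)
    then show "z \<in> pspan b" using kt(2) pspanI by simp
  qed
  then show "p_rigid_elem K p b" using b by (simp add: p_rigid_elem_iff)
qed

section \<open>The extension field itself\<close>

lemma gen_field_scale:
  fixes F :: "'a::field set"
  assumes "y \<in> F" "y \<noteq> 0"
  shows "gen_field (insert (\<alpha> * y) F) = gen_field (insert \<alpha> F)"
proof -
  have "insert (\<alpha> * y) F \<subseteq> L \<longleftrightarrow> insert \<alpha> F \<subseteq> L" if "is_subfield L" for L
  proof -
    interpret subfield_set L using that by unfold_locales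
    have "\<alpha> \<in> L" if "\<alpha> * y \<in> L" "y \<in> L"
      using divide_mem[OF that] assms(2) by simp
    then show ?thesis using assms(1) by auto
  qed
  then show ?thesis unfolding gen_field_def by (intro arg_cong[of _ _ Inter]) auto
qed

lemma p_rigid_extension:
  fixes F :: "'a::field set"
  assumes "rigid_val F p \<zeta> V u" and rig: "p_rigid F p"
    and a: "a \<in> F" "a \<noteq> 0" "a \<notin> pth_powers F p" and \<alpha>: "\<alpha> ^ p = a"
    and ur: "a \<in> val_ring.U V \<or> (\<forall>y\<in>F. a * y ^ p \<notin> val_ring.U V)"
  shows "p_rigid (gen_field (insert \<alpha> F)) p"
proof -
  interpret rigid_val F p \<zeta> V u by fact
  have ng: "norm_group F p a \<subseteq> pspan a"
    using rig a p_rigid_elem_iff[of a] by (auto simp: p_rigid_def)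
  have anz: "\<alpha> \<noteq> 0" using \<alpha> a by (auto simp: power_0_left)
  interpret kummer_rigid_val F p \<zeta> a \<alpha> V u
  proof
    show "c i = 0" if c: "\<forall>i<p. c i \<in> F" "(\<Sum>i<p. c i * \<alpha> ^ i) = 0" "i < p" for c i
    proof (rule ccontr)
      assume "c i \<noteq> 0"
      then have "det (mult_matrix p a c) \<in> norm_group F p a" unfolding norm_group_def using c by blast
      then have "det (mult_matrix p a c) \<noteq> 0" using ng pspan_nz a by auto
      \<comment> \<open>The factor at \<open>j = 0\<close> is the assumed linear relation, whereas
        rigidity of \<open>a\<close> keeps 0 out of its norm group.\<close>
      moreover have "det (mult_matrix p a c) = 0"
        unfolding det_mult_matrix[OF \<alpha> anz] using c(2) p_pos
        by (intro prod_zero) (auto intro!: bexI[of _ 0])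
      ultimately show False by simp
    qed
  qed (use a \<alpha> in auto)
  have norms: "N x \<in> pspan a" if "x \<in> L" "x \<noteq> 0" for x
    using ng that unfolding norm_group_eq by auto
  have "\<exists>u'. rigid_val L p \<zeta> VE u'"
    using ur rigid_val_unramified[OF norms] rigid_val_ramified[OF norms] by blast
  then show ?thesis unfolding gen_field_eq using p_rigid_rigid_val by blast
qed

theorem theorem3p16:
  fixes F :: "'a::field set" and p :: nat and a \<alpha> \<zeta> :: 'a
  assumes "prime p" and "odd p"
    and "is_subfield F"
    and "\<zeta> \<in> F" and "\<zeta> ^ p = 1" and "\<forall>k. 0 < k \<and> k < p \<longrightarrow> \<zeta> ^ k \<noteq> 1"
    and "a \<in> F - {0} - pth_powers F p"
    and "\<alpha> ^ p = a"
    and "p_rigid F p"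
  shows "p_rigid (gen_field (insert \<alpha> F)) p"
proof -
  interpret root_field F p \<zeta> using assms by unfold_locales
  interpret steinberg_field F p \<zeta>
  proof
    fix x assume "x \<in> F" "x \<noteq> 0" "x \<notin> T"
    then show "1 - x \<in> pspan x"
      using assms(9) p_rigid_elem_iff[of x] one_minus_in_norm_group[of x] by (auto simp: p_rigid_def)
  qed
  obtain V u where rv: "rigid_val F p \<zeta> V u" using ex_rigid_val by blast
  then interpret rigid_val F p \<zeta> V u .
  have a: "a \<in> F" "a \<noteq> 0" "a \<notin> T" using assms(7) by auto
  show ?thesis
  proof (cases "\<exists>y\<in>F. a * y ^ p \<in> U")
    case True
    \<comment> \<open>Replacing \<open>\<alpha>\<close> by \<open>\<alpha> * y\<close> changes
      \<open>a\<close> to the unit \<open>a * y ^ p\<close> but leaves the generated field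
      unchanged.\<close>
    then obtain y where y: "y \<in> F" "a * y ^ p \<in> U" by blast
    have ynz: "y \<noteq> 0" using U_nz[OF y(2)] by (auto simp: power_0_left)
    have "a * y ^ p \<notin> T" using a(3) T_mult_right_iff[OF power_in_T[OF y(1) ynz]] by blast
    then have "p_rigid (gen_field (insert (\<alpha> * y) F)) p"
      using a y ynz assms(8) by (intro p_rigid_extension[OF rv assms(9)]) (auto simp: power_mult_distrib)
    then show ?thesis using gen_field_scale[OF y(1) ynz] by simp
  next
    case False
    then show ?thesis by (intro p_rigid_extension[OF rv assms(9) a assms(8)]) auto
  qed
qed

end
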